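(* There is an adjunction from the category $\mathbf{RRB}$ of right regular bands to the category $\mathbf{SC}$ of supported categories. In particular, the category $\mathbf{RRB}$ is coreflective in the category $\mathbf{SC}$.
   Context: Conventions. Mappings, morphisms and functors are composed from left to right ($fg$ means first $f$, then $g$). For a category $\mathcal C$, $v\mathcal C$ denotes its class of objects and $\mathcal C(c,c')$ the set of morphisms from $c$ to $c'$. A monomorphism is a right cancellable morphism and an epimorphism is a left cancellable morphism. Bands. A right regular band is a semigroup in which every element is idempotent and the identity $efe=fe$ holds. $\mathbf{RRB}$ is the category of right regular bands with all semigroup homomorphisms as morphisms. Adjunctions. An adjunction $\mathbf C\to\mathbf D$ is a triple $(\mathtt F,\mathtt G,\eta)$ with functors $\mathtt F\colon\mathbf C\to\mathbf D$, $\mathtt G\colon\mathbf D\to\mathbf C$ and a natural transformation $\eta\colon 1_{\mathbf C}\to\mathtt F\mathtt G$ ($\mathtt F$ first, then $\mathtt G$) such that for all objects $X$ of $\mathbf C$, $Y$ of $\mathbf D$ and every morphism $\phi\colon X\to\mathtt G(Y)$ in $\mathbf C$ there is a unique morphism $\bar\phi\colon\mathtt F(X)\to Y$ in $\mathbf D$ with $\eta_X\,\mathtt G(\bar\phi)=\phi$. $\mathtt F$ is the left adjoint and $\mathtt G$ the right adjoint. A coreflective subcategory of $\mathbf D$ is a full subcategory whose inclusion functor has a right adjoint; a category $\mathbf C$ is coreflective in $\mathbf D$ if $\mathbf C$ is equivalent to a coreflective subcategory of $\mathbf D$. Normal categories. A strict preorder is a category with at most one morphism between any two (possibly equal) objects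 in which the only isomorphisms are identities. A category with subobjects is a small category $\mathcal C$ with a subcategory $\mathcal P$ such that: $\mathcal P$ is a strict preorder with $v\mathcal P=v\mathcal C$; every $f\in\mathcal P$ is a monomorphism in $\mathcal C$; if $f,g\in\mathcal P$ and $f=hg$ with $h\in\mathcal C$, then $h\in\mathcal P$. Morphisms of $\mathcal P$ are called inclusions; $c\preceq c'$ means $\mathcal P(c,c')\neq\emptyset$, and $j(c,c')$ is then the unique inclusion. An inclusion $j\colon c\to c'$ splits if there is $q\colon c'\to c$ in $\mathcal C$ with $jq=1_c$; such a $q$ is called a retraction. A normal factorisation of a morphism $f$ is $f=quj$ with $q$ a retraction, $u$ an isomorphism, $j$ an inclusion. A cone with vertex $z\in v\mathcal C$ is a map $\gamma$ assigning to each $c\in v\mathcal C$ a morphism $\gamma(c)\in\mathcal C(c,z)$ such that $j(a,b)\gamma(b)=\gamma(a)$ whenever $a\preceq b$, and $\gamma(c)$ is an isomorphism for at least one $c$; the vertex is denoted $z_\gamma$. $\mathcal C$ is a normal category if it is a category with subobjects in which every inclusion splits, every morphism has a normal factorisation, and for each $c\in v\mathcal C$ there is a cone $\mu$ with vertex $c$ and $\mu(c)=1_c$. In a normal category, for a normal factorisation $f=quj$ the epimorphism $f^\circ:=qu$ does not depend on the factorisation. Semigroup of cones. For a cone $\gamma$ and an epimorphism $f$ with domain $z_\gamma$, $\gamma\ast f$ is the cone $c\mapsto\gamma(c)f$. The set $\widehat{\mathcal C}$ of all cones in a normal category $\mathcal C$ is a regular semigroup under $\gamma\cdot\delta=\gamma\ast(\delta(z_\gamma))^\circ$.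 Let $\mathscr R$ be Green's relation on $\widehat{\mathcal C}$, $R_\gamma$ the $\mathscr R$-class of $\gamma$; $\widehat{\mathcal C}/\mathscr R$ is partially ordered by $R_\gamma\sqsubseteq R_\delta$ iff the principal right ideal generated by $\gamma$ is contained in that generated by $\delta$. Connected and supported categories. Let $\mathcal C$ be a normal category and $\mathfrak D$ a down-set of $(\widehat{\mathcal C}/\mathscr R,\sqsubseteq)$. An object $c$ is connected by (or to) $\mathfrak d\in\mathfrak D$ if $\mathfrak d$ contains an idempotent cone with vertex $c$; this idempotent cone is then unique and is denoted $\epsilon(c,\mathfrak d)$. $\mathcal C$ is connected by $\mathfrak D$ if every $c\in v\mathcal C$ is connected by some $\mathfrak d\in\mathfrak D$; then the pair is denoted $\mathcal C_{\mathfrak D}$ and called a connected category. A connected category is supported if each $c\in v\mathcal C$ is connected by a unique $\mathfrak d\in\mathfrak D$. A CC-morphism from $\mathcal C_{\mathfrak D}$ to $\mathcal C'_{\mathfrak D'}$ is a pair $(F,G)$ where $F\colon\mathcal C\to\mathcal C'$ is an inclusion preserving functor and $G\colon\mathfrak D\to\mathfrak D'$ is an order preserving map such that whenever $c$ is connected to $\mathfrak d$, $F(c)$ is connected to $G(\mathfrak d)$ and $F(\epsilon(c,\mathfrak d)(c'))=\epsilon(F(c),G(\mathfrak d))(F(c'))$ for every $c'\in v\mathcal C$. $\mathbf{CC}$ is the category of connected categories with CC-morphisms, and $\mathbf{SC}$ is its full subcategory of supported categories. *)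

theory Defs
  imports Main "HOL-Library.FuncSet"
begin

text \<open>Composition is written from left to right throughout: \<open>f \<cdot>\<^bsub>C\<^esub> g\<close> is first \<open>f\<close>, then \<open>g\<close>,
  and is meaningful only if \<open>Cod C f = Dom C g\<close>.\<close>

section \<open>Categories, functors, adjunctions\<close>

record ('o, 'm) cat =
  Obj :: "'o set"
  Arr :: "'m set"
  Dom :: "'m \<Rightarrow> 'o"
  Cod :: "'m \<Rightarrow> 'o"
  Ide :: "'o \<Rightarrow> 'm"
  Cmp :: "'m \<Rightarrow> 'm \<Rightarrow> 'm"  (infixl "\<cdot>\<index>" 70)

definition hom :: "('o, 'm, 'x) cat_scheme \<Rightarrow> 'o \<Rightarrow> 'o \<Rightarrow> 'm set" where
  "hom C a b = {f \<in> Arr C. Dom C f = a \<and> Cod C f = b}"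

definition category :: "('o, 'm, 'x) cat_scheme \<Rightarrow> bool" where
  "category C \<longleftrightarrow>
     (\<forall>f \<in> Arr C. Dom C f \<in> Obj C \<and> Cod C f \<in> Obj C) \<and>
     (\<forall>a \<in> Obj C. Ide C a \<in> hom C a a) \<and>
     (\<forall>f \<in> Arr C. \<forall>g \<in> Arr C. Cod C f = Dom C g \<longrightarrow>
        f \<cdot>\<^bsub>C\<^esub> g \<in> hom C (Dom C f) (Cod C g)) \<and>
     (\<forall>f \<in> Arr C. Ide C (Dom C f) \<cdot>\<^bsub>C\<^esub> f = f \<and> f \<cdot>\<^bsub>C\<^esub> Ide C (Cod C f) = f) \<and>
     (\<forall>f \<in> Arr C. \<forall>g \<in> Arr C. \<forall>h \<in> Arr C. Cod C f = Dom C g \<and> Cod C g = Dom C h \<longrightarrow>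
        (f \<cdot>\<^bsub>C\<^esub> g) \<cdot>\<^bsub>C\<^esub> h = f \<cdot>\<^bsub>C\<^esub> (g \<cdot>\<^bsub>C\<^esub> h))"

definition monomorphism :: "('o, 'm, 'x) cat_scheme \<Rightarrow> 'm \<Rightarrow> bool" where
  "monomorphism C f \<longleftrightarrow> f \<in> Arr C \<and>
     (\<forall>g \<in> Arr C. \<forall>h \<in> Arr C. Cod C g = Dom C f \<and> Cod C h = Dom C f \<and>
        g \<cdot>\<^bsub>C\<^esub> f = h \<cdot>\<^bsub>C\<^esub> f \<longrightarrow> g = h)"

definition isomorphism :: "('o, 'm, 'x) cat_scheme \<Rightarrow> 'm \<Rightarrow> bool" where
  "isomorphism C f \<longleftrightarrow> f \<in> Arr C \<and>
     (\<exists>g \<in> hom C (Cod C f) (Dom C f).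
        f \<cdot>\<^bsub>C\<^esub> g = Ide C (Dom C f) \<and> g \<cdot>\<^bsub>C\<^esub> f = Ide C (Cod C f))"

record ('o1, 'm1, 'o2, 'm2) func =
  OMap :: "'o1 \<Rightarrow> 'o2"
  AMap :: "'m1 \<Rightarrow> 'm2"

definition is_functor ::
  "('o1, 'm1, 'x) cat_scheme \<Rightarrow> ('o2, 'm2, 'y) cat_scheme \<Rightarrow> ('o1, 'm1, 'o2, 'm2) func \<Rightarrow> bool"
  where
  "is_functor C D F \<longleftrightarrow> category C \<and> category D \<and>
     (\<forall>a \<in> Obj C. OMap F a \<in> Obj D) \<and>
     (\<forall>f \<in> Arr C. AMap F f \<in> hom D (OMap F (Dom C f)) (OMap F (Cod C f))) \<and>
     (\<forall>a \<in> Obj C. AMap F (Ide C a) = Ide D (OMap F a)) \<and>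
     (\<forall>f \<in> Arr C. \<forall>g \<in> Arr C. Cod C f = Dom C g \<longrightarrow>
        AMap F (f \<cdot>\<^bsub>C\<^esub> g) = AMap F f \<cdot>\<^bsub>D\<^esub> AMap F g)"

definition id_functor :: "('o, 'm, 'o, 'm) func" where
  "id_functor = \<lparr>OMap = (\<lambda>a. a), AMap = (\<lambda>f. f)\<rparr>"

definition comp_functor ::
  "('o1, 'm1, 'o2, 'm2) func \<Rightarrow> ('o2, 'm2, 'o3, 'm3) func \<Rightarrow> ('o1, 'm1, 'o3, 'm3) func"
  (infixl "\<then>" 70) where
  "F \<then> G = \<lparr>OMap = (\<lambda>a. OMap G (OMap F a)), AMap = (\<lambda>f. AMap G (AMap F f))\<rparr>"

definition nat_transf ::
  "('o1, 'm1, 'x) cat_scheme \<Rightarrow> ('o2, 'm2, 'y) cat_scheme \<Rightarrow>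
   ('o1, 'm1, 'o2, 'm2) func \<Rightarrow> ('o1, 'm1, 'o2, 'm2) func \<Rightarrow> ('o1 \<Rightarrow> 'm2) \<Rightarrow> bool" where
  "nat_transf C D F G \<eta> \<longleftrightarrow> is_functor C D F \<and> is_functor C D G \<and>
     (\<forall>a \<in> Obj C. \<eta> a \<in> hom D (OMap F a) (OMap G a)) \<and>
     (\<forall>f \<in> Arr C. AMap F f \<cdot>\<^bsub>D\<^esub> \<eta> (Cod C f) = \<eta> (Dom C f) \<cdot>\<^bsub>D\<^esub> AMap G f)"

definition nat_iso ::
  "('o1, 'm1, 'x) cat_scheme \<Rightarrow> ('o2, 'm2, 'y) cat_scheme \<Rightarrow>
   ('o1, 'm1, 'o2, 'm2) func \<Rightarrow> ('o1, 'm1, 'o2, 'm2) func \<Rightarrow> ('o1 \<Rightarrow> 'm2) \<Rightarrow> bool" where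
  "nat_iso C D F G \<eta> \<longleftrightarrow> nat_transf C D F G \<eta> \<and> (\<forall>a \<in> Obj C. isomorphism D (\<eta> a))"

definition adjunction ::
  "('o1, 'm1, 'x) cat_scheme \<Rightarrow> ('o2, 'm2, 'y) cat_scheme \<Rightarrow>
   ('o1, 'm1, 'o2, 'm2) func \<Rightarrow> ('o2, 'm2, 'o1, 'm1) func \<Rightarrow> ('o1 \<Rightarrow> 'm1) \<Rightarrow> bool" where
  "adjunction C D F G \<eta> \<longleftrightarrow>
     is_functor C D F \<and> is_functor D C G \<and> nat_transf C C id_functor (F \<then> G) \<eta> \<and>
     (\<forall>X \<in> Obj C. \<forall>Y \<in> Obj D. \<forall>\<phi> \<in> hom C X (OMap G Y).
        \<exists>!\<psi>. \<psi> \<in> hom D (OMap F X) Y \<and> \<eta> X \<cdot>\<^bsub>C\<^esub> AMap G \<psi> = \<phi>)"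

definition equivalent_cats ::
  "('o1, 'm1, 'x) cat_scheme \<Rightarrow> ('o2, 'm2, 'y) cat_scheme \<Rightarrow> bool" where
  "equivalent_cats C D \<longleftrightarrow>
     (\<exists>(F :: ('o1, 'm1, 'o2, 'm2) func) (G :: ('o2, 'm2, 'o1, 'm1) func) \<eta> \<epsilon>.
        is_functor C D F \<and> is_functor D C G \<and>
        nat_iso C C id_functor (F \<then> G) \<eta> \<and> nat_iso D D (G \<then> F) id_functor \<epsilon>)"

definition full_subcat :: "('o, 'm, 'x) cat_scheme \<Rightarrow> 'o set \<Rightarrow> ('o, 'm, 'x) cat_scheme" where
  "full_subcat D S = D\<lparr>Obj := S, Arr := {f \<in> Arr D. Dom D f \<in> S \<and> Cod D f \<in> S}\<rparr>"

text \<open>The inclusion functor of a full subcategory is given by \<^const>\<open>id_functor\<close>.\<close>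

definition coreflective_subcat :: "('o, 'm, 'x) cat_scheme \<Rightarrow> 'o set \<Rightarrow> bool" where
  "coreflective_subcat D S \<longleftrightarrow> S \<subseteq> Obj D \<and>
     (\<exists>G \<eta>. adjunction (full_subcat D S) D id_functor G \<eta>)"

definition coreflective_in ::
  "('o1, 'm1, 'x) cat_scheme \<Rightarrow> ('o2, 'm2, 'y) cat_scheme \<Rightarrow> bool" where
  "coreflective_in C D \<longleftrightarrow>
     (\<exists>S. coreflective_subcat D S \<and> equivalent_cats C (full_subcat D S))"


section \<open>Semigroups and right regular bands\<close>

record 'a sgrp =
  carrier :: "'a set"
  mult :: "'a \<Rightarrow> 'a \<Rightarrow> 'a"  (infixl "\<star>\<index>" 70)

definition is_semigroup :: "'a sgrp \<Rightarrow> bool" where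
  "is_semigroup S \<longleftrightarrow>
     (\<forall>x \<in> carrier S. \<forall>y \<in> carrier S. x \<star>\<^bsub>S\<^esub> y \<in> carrier S) \<and>
     (\<forall>x \<in> carrier S. \<forall>y \<in> carrier S. \<forall>z \<in> carrier S.
        (x \<star>\<^bsub>S\<^esub> y) \<star>\<^bsub>S\<^esub> z = x \<star>\<^bsub>S\<^esub> (y \<star>\<^bsub>S\<^esub> z))"

definition right_regular_band :: "'a sgrp \<Rightarrow> bool" where
  "right_regular_band S \<longleftrightarrow> is_semigroup S \<and>
     (\<forall>e \<in> carrier S. e \<star>\<^bsub>S\<^esub> e = e) \<and>
     (\<forall>e \<in> carrier S. \<forall>f \<in> carrier S. (e \<star>\<^bsub>S\<^esub> f) \<star>\<^bsub>S\<^esub> e = f \<star>\<^bsub>S\<^esub> e)"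

definition sgrp_homs :: "'a sgrp \<Rightarrow> 'b sgrp \<Rightarrow> ('a \<Rightarrow> 'b) set" where
  "sgrp_homs S T = {h \<in> carrier S \<rightarrow>\<^sub>E carrier T.
     \<forall>x \<in> carrier S. \<forall>y \<in> carrier S. h (x \<star>\<^bsub>S\<^esub> y) = h x \<star>\<^bsub>T\<^esub> h y}"

definition principal_right_ideal :: "'a sgrp \<Rightarrow> 'a \<Rightarrow> 'a set" where
  "principal_right_ideal S a = insert a {a \<star>\<^bsub>S\<^esub> x |x. x \<in> carrier S}"

definition green_R :: "'a sgrp \<Rightarrow> ('a \<times> 'a) set" where
  "green_R S = {(a, b). a \<in> carrier S \<and> b \<in> carrier S \<and>
     principal_right_ideal S a = principal_right_ideal S b}"

definition R_classes :: "'a sgrp \<Rightarrow> 'a set set" where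
  "R_classes S = carrier S // green_R S"

definition R_class_le :: "'a sgrp \<Rightarrow> 'a set \<Rightarrow> 'a set \<Rightarrow> bool" where
  "R_class_le S X Y \<longleftrightarrow>
     (\<exists>a \<in> X. \<exists>b \<in> Y. principal_right_ideal S a \<subseteq> principal_right_ideal S b)"

text \<open>An arrow of a concrete category is a triple (source, underlying map, target). Underlying
  maps are extensional, i.e. \<^const>\<open>undefined\<close> off their domain, so that equality of arrows is
  equality of the maps they stand for.\<close>

definition RRB :: "('a sgrp, 'a sgrp \<times> ('a \<Rightarrow> 'a) \<times> 'a sgrp) cat" where
  "RRB = \<lparr>
     Obj = {S. right_regular_band S},
     Arr = {(S, h, T). right_regular_band S \<and> right_regular_band T \<and> h \<in> sgrp_homs S T},
     Dom = (\<lambda>(S, h, T). S),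
     Cod = (\<lambda>(S, h, T). T),
     Ide = (\<lambda>S. (S, \<lambda>x \<in> carrier S. x, S)),
     Cmp = (\<lambda>(S, h, T) (T', k, U). (S, compose (carrier S) k h, U))\<rparr>"


section \<open>Normal categories\<close>

record ('o, 'm) subobj_cat = "('o, 'm) cat" +
  Incl :: "'m set"

definition incl_cat :: "('o, 'm, 'x) subobj_cat_scheme \<Rightarrow> ('o, 'm, 'x) subobj_cat_scheme" where
  "incl_cat C = C\<lparr>Arr := Incl C\<rparr>"

definition strict_preorder :: "('o, 'm, 'x) cat_scheme \<Rightarrow> bool" where
  "strict_preorder P \<longleftrightarrow> category P \<and>
     (\<forall>a \<in> Obj P. \<forall>b \<in> Obj P. \<forall>f \<in> hom P a b. \<forall>g \<in> hom P a b. f = g) \<and>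
     (\<forall>f. isomorphism P f \<longrightarrow> (\<exists>a \<in> Obj P. f = Ide P a))"

definition category_with_subobjects :: "('o, 'm, 'x) subobj_cat_scheme \<Rightarrow> bool" where
  "category_with_subobjects C \<longleftrightarrow> category C \<and> Incl C \<subseteq> Arr C \<and>
     strict_preorder (incl_cat C) \<and>
     (\<forall>f \<in> Incl C. monomorphism C f) \<and>
     (\<forall>f \<in> Incl C. \<forall>g \<in> Incl C. \<forall>h \<in> Arr C.
        Cod C h = Dom C g \<and> f = h \<cdot>\<^bsub>C\<^esub> g \<longrightarrow> h \<in> Incl C)"

definition splits_via :: "('o, 'm, 'x) subobj_cat_scheme \<Rightarrow> 'm \<Rightarrow> 'm \<Rightarrow> bool" where
  "splits_via C j q \<longleftrightarrow> j \<in> Incl C \<and> q \<in> hom C (Cod C j) (Dom C j) \<and>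
     j \<cdot>\<^bsub>C\<^esub> q = Ide C (Dom C j)"

definition retraction :: "('o, 'm, 'x) subobj_cat_scheme \<Rightarrow> 'm \<Rightarrow> bool" where
  "retraction C q \<longleftrightarrow> (\<exists>j. splits_via C j q)"

definition normal_factorisation ::
  "('o, 'm, 'x) subobj_cat_scheme \<Rightarrow> 'm \<Rightarrow> 'm \<Rightarrow> 'm \<Rightarrow> 'm \<Rightarrow> bool" where
  "normal_factorisation C f q u j \<longleftrightarrow>
     retraction C q \<and> isomorphism C u \<and> j \<in> Incl C \<and>
     Cod C q = Dom C u \<and> Cod C u = Dom C j \<and> f = (q \<cdot>\<^bsub>C\<^esub> u) \<cdot>\<^bsub>C\<^esub> j"

definition cone_at :: "('o, 'm, 'x) subobj_cat_scheme \<Rightarrow> 'o \<Rightarrow> ('o \<Rightarrow> 'm) \<Rightarrow> bool" where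
  "cone_at C z \<gamma> \<longleftrightarrow> z \<in> Obj C \<and> \<gamma> \<in> (\<Pi>\<^sub>E c \<in> Obj C. hom C c z) \<and>
     (\<forall>a \<in> Obj C. \<forall>b \<in> Obj C. \<forall>j \<in> hom (incl_cat C) a b. j \<cdot>\<^bsub>C\<^esub> \<gamma> b = \<gamma> a) \<and>
     (\<exists>c \<in> Obj C. isomorphism C (\<gamma> c))"

definition normal_category :: "('o, 'm, 'x) subobj_cat_scheme \<Rightarrow> bool" where
  "normal_category C \<longleftrightarrow> category_with_subobjects C \<and>
     (\<forall>j \<in> Incl C. \<exists>q. splits_via C j q) \<and>
     (\<forall>f \<in> Arr C. \<exists>q u j. normal_factorisation C f q u j) \<and>
     (\<forall>c \<in> Obj C. \<exists>\<mu>. cone_at C c \<mu> \<and> \<mu> c = Ide C c)"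

text \<open>In a normal category both of the following descriptions determine a unique object: a cone
  has exactly one vertex, and \<open>q \<cdot> u\<close> is the same for all normal factorisations of \<open>f\<close>.\<close>

definition vertex :: "('o, 'm, 'x) subobj_cat_scheme \<Rightarrow> ('o \<Rightarrow> 'm) \<Rightarrow> 'o" where
  "vertex C \<gamma> = (THE z. cone_at C z \<gamma>)"

definition epi_part :: "('o, 'm, 'x) subobj_cat_scheme \<Rightarrow> 'm \<Rightarrow> 'm" where
  "epi_part C f = (THE h. \<exists>q u j. normal_factorisation C f q u j \<and> h = q \<cdot>\<^bsub>C\<^esub> u)"

definition cone_extend ::
  "('o, 'm, 'x) subobj_cat_scheme \<Rightarrow> ('o \<Rightarrow> 'm) \<Rightarrow> 'm \<Rightarrow> ('o \<Rightarrow> 'm)" where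
  "cone_extend C \<gamma> f = (\<lambda>c \<in> Obj C. \<gamma> c \<cdot>\<^bsub>C\<^esub> f)"

definition cone_semigroup :: "('o, 'm, 'x) subobj_cat_scheme \<Rightarrow> ('o \<Rightarrow> 'm) sgrp" where
  "cone_semigroup C = \<lparr>
     carrier = {\<gamma>. \<exists>z. cone_at C z \<gamma>},
     mult = (\<lambda>\<gamma> \<delta>. cone_extend C \<gamma> (epi_part C (\<delta> (vertex C \<gamma>))))\<rparr>"


section \<open>Connected and supported categories\<close>

record ('o, 'm) conn_cat = "('o, 'm) subobj_cat" +
  DSet :: "('o \<Rightarrow> 'm) set set"

definition idempotent_cone_in ::
  "('o, 'm, 'x) subobj_cat_scheme \<Rightarrow> 'o \<Rightarrow> ('o \<Rightarrow> 'm) set \<Rightarrow> ('o \<Rightarrow> 'm) \<Rightarrow> bool" where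
  "idempotent_cone_in C c d \<gamma> \<longleftrightarrow>
     \<gamma> \<in> d \<and> cone_at C c \<gamma> \<and> \<gamma> \<star>\<^bsub>cone_semigroup C\<^esub> \<gamma> = \<gamma>"

definition connected_to ::
  "('o, 'm, 'x) subobj_cat_scheme \<Rightarrow> 'o \<Rightarrow> ('o \<Rightarrow> 'm) set \<Rightarrow> bool" where
  "connected_to C c d \<longleftrightarrow> (\<exists>\<gamma>. idempotent_cone_in C c d \<gamma>)"

text \<open>An \<open>\<R>\<close>-class contains at most one idempotent cone with a given vertex.\<close>

definition eps ::
  "('o, 'm, 'x) subobj_cat_scheme \<Rightarrow> 'o \<Rightarrow> ('o \<Rightarrow> 'm) set \<Rightarrow> ('o \<Rightarrow> 'm)" where
  "eps C c d = (THE \<gamma>. idempotent_cone_in C c d \<gamma>)"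

definition connected_category :: "('o, 'm, 'x) conn_cat_scheme \<Rightarrow> bool" where
  "connected_category C \<longleftrightarrow> normal_category C \<and>
     DSet C \<subseteq> R_classes (cone_semigroup C) \<and>
     (\<forall>d \<in> DSet C. \<forall>d' \<in> R_classes (cone_semigroup C).
        R_class_le (cone_semigroup C) d' d \<longrightarrow> d' \<in> DSet C) \<and>
     (\<forall>c \<in> Obj C. \<exists>d \<in> DSet C. connected_to C c d)"

definition supported_category :: "('o, 'm, 'x) conn_cat_scheme \<Rightarrow> bool" where
  "supported_category C \<longleftrightarrow> connected_category C \<and>
     (\<forall>c \<in> Obj C. \<exists>!d. d \<in> DSet C \<and> connected_to C c d)"

type_synonym ('o1, 'm1, 'o2, 'm2) cc_map =
  "('o1, 'm1, 'o2, 'm2) func \<times> (('o1 \<Rightarrow> 'm1) set \<Rightarrow> ('o2 \<Rightarrow> 'm2) set)"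

definition cc_morphisms ::
  "('o1, 'm1) conn_cat \<Rightarrow> ('o2, 'm2) conn_cat \<Rightarrow> ('o1, 'm1, 'o2, 'm2) cc_map set" where
  "cc_morphisms C C' = {(F, G).
     is_functor C C' F \<and> OMap F \<in> extensional (Obj C) \<and> AMap F \<in> extensional (Arr C) \<and>
     (\<forall>j \<in> Incl C. AMap F j \<in> Incl C') \<and>
     G \<in> DSet C \<rightarrow>\<^sub>E DSet C' \<and>
     (\<forall>d \<in> DSet C. \<forall>d' \<in> DSet C. R_class_le (cone_semigroup C) d d' \<longrightarrow>
        R_class_le (cone_semigroup C') (G d) (G d')) \<and>
     (\<forall>c \<in> Obj C. \<forall>d \<in> DSet C. connected_to C c d \<longrightarrow>
        connected_to C' (OMap F c) (G d) \<and>
        (\<forall>c' \<in> Obj C. AMap F (eps C c d c') = eps C' (OMap F c) (G d) (OMap F c')))}"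

definition cc_id :: "('o, 'm) conn_cat \<Rightarrow> ('o, 'm, 'o, 'm) cc_map" where
  "cc_id C = (\<lparr>OMap = \<lambda>c \<in> Obj C. c, AMap = \<lambda>f \<in> Arr C. f\<rparr>, \<lambda>d \<in> DSet C. d)"

definition cc_comp ::
  "('o1, 'm1) conn_cat \<Rightarrow> ('o1, 'm1, 'o2, 'm2) cc_map \<Rightarrow> ('o2, 'm2, 'o3, 'm3) cc_map \<Rightarrow>
   ('o1, 'm1, 'o3, 'm3) cc_map" where
  "cc_comp C = (\<lambda>(F, G) (F', G').
     (\<lparr>OMap = compose (Obj C) (OMap F') (OMap F), AMap = compose (Arr C) (AMap F') (AMap F)\<rparr>,
      compose (DSet C) G' G))"

text \<open>The type \<open>'u\<close> plays the role of the universe: bands have carriers in \<open>'u\<close>, and small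
  categories have objects and arrows in \<open>'u\<close>. If \<open>'u\<close> is infinite, the category of principal left
  ideals of a band on \<open>'u\<close> can again be realised on \<open>'u\<close>.\<close>

definition CC ::
  "(('u, 'u) conn_cat, ('u, 'u) conn_cat \<times> ('u, 'u, 'u, 'u) cc_map \<times> ('u, 'u) conn_cat) cat" where
  "CC = \<lparr>
     Obj = {C. connected_category C},
     Arr = {(C, \<Phi>, C'). connected_category C \<and> connected_category C' \<and> \<Phi> \<in> cc_morphisms C C'},
     Dom = (\<lambda>(C, \<Phi>, C'). C),
     Cod = (\<lambda>(C, \<Phi>, C'). C'),
     Ide = (\<lambda>C. (C, cc_id C, C)),
     Cmp = (\<lambda>(C, \<Phi>, C') (C'', \<Psi>, C'''). (C, cc_comp C \<Phi> \<Psi>, C'''))\<rparr>"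

definition SC ::
  "(('u, 'u) conn_cat, ('u, 'u) conn_cat \<times> ('u, 'u, 'u, 'u) cc_map \<times> ('u, 'u) conn_cat) cat" where
  "SC = full_subcat CC {C. supported_category C}"

end

theory Submission
  imports Defs
begin

text \<open>A band \<open>B\<close> is sent to the category of its principal left ideals, supported by the
  \<open>\<R>\<close>-classes of the principal cones. Conversely, the idempotent cones \<open>\<epsilon>\<^sub>c\<close> supporting the objects
  \<open>c\<close> of a supported category have pairwise distinct vertices and are closed under multiplication:
  the vertex of \<open>\<epsilon>\<^sub>a \<epsilon>\<^sub>b\<close> is the image of the morphism \<open>\<epsilon>\<^sub>b(a)\<close>. They form a right regular band,
  which is carried by the set of objects. A homomorphism \<open>\<phi>\<close> from \<open>B\<close> to this band extends
  uniquely to a CC-morphism, since the translation \<open>x \<mapsto> xu\<close> from \<open>Be\<close> to \<open>Bf\<close> is a component of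
  the principal cone of \<open>u\<close> followed by an inclusion and so must go to
  \<open>\<epsilon>\<^bsub>\<phi>u\<^esub>(\<phi>e) j(\<phi>u, \<phi>f)\<close>. The unit of the resulting adjunction is bijective, which gives
  the coreflection.\<close>

section \<open>Categories, universal arrows and coreflections\<close>

text \<open>The hard point is that the supporting cones are closed under multiplication, since a
  product of idempotents need not be idempotent. The down-set supplies the missing rigidity:
  extending \<open>\<epsilon>\<^sub>c\<close> along a split epimorphism gives a cone that generates
  a smaller right ideal, so its class stays in \<open>DSet\<close>. If that cone is idempotent,
  uniqueness of support forces it to be the supporting cone of its vertex. In the opposite direction
  the objects of the translation category are the band elements themselves, so only the arrows need
  encoding: a right translation is a triple of elements, and triples can be coded injectively inside
  an infinite universe. The unit is then the identity map on the carrier. Functoriality of the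
  extended homomorphism again comes down to the product formula for supporting cones, now read as a
  rule for composing cone components with epi parts. The passage to the coreflection is purely
  formal: an invertible unit makes the counit invertible on the image of the left adjoint, so the
  inclusion of that image acquires a right adjoint.\<close>

lemma homD:
  assumes "f \<in> hom C a b"
  shows "f \<in> Arr C" "Dom C f = a" "Cod C f = b"
  using assms by (auto simp: hom_def)

lemma arr_in_hom: "f \<in> Arr C \<Longrightarrow> f \<in> hom C (Dom C f) (Cod C f)"
  by (simp add: hom_def)

lemma categoryI:
  assumes "\<And>f. f \<in> Arr C \<Longrightarrow> Dom C f \<in> Obj C \<and> Cod C f \<in> Obj C"
    and "\<And>a. a \<in> Obj C \<Longrightarrow> Ide C a \<in> hom C a a"
    and "\<And>f g a b c. f \<in> hom C a b \<Longrightarrow> g \<in> hom C b c \<Longrightarrow> f \<cdot>\<^bsub>C\<^esub> g \<in> hom C a c"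
    and "\<And>f a b. f \<in> hom C a b \<Longrightarrow> Ide C a \<cdot>\<^bsub>C\<^esub> f = f"
    and "\<And>f a b. f \<in> hom C a b \<Longrightarrow> f \<cdot>\<^bsub>C\<^esub> Ide C b = f"
    and "\<And>f g h a b c d. f \<in> hom C a b \<Longrightarrow> g \<in> hom C b c \<Longrightarrow> h \<in> hom C c d \<Longrightarrow>
      (f \<cdot>\<^bsub>C\<^esub> g) \<cdot>\<^bsub>C\<^esub> h = f \<cdot>\<^bsub>C\<^esub> (g \<cdot>\<^bsub>C\<^esub> h)"
  shows "category C"
  unfolding category_def
  using assms by (auto simp: hom_def)

lemma hom_objs:
  assumes "category C" "f \<in> hom C a b"
  shows "a \<in> Obj C" "b \<in> Obj C"
  using assms by (auto simp: category_def hom_def)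

lemma ide_in_hom: "category C \<Longrightarrow> a \<in> Obj C \<Longrightarrow> Ide C a \<in> hom C a a"
  by (simp add: category_def)

lemma cmp_in_hom:
  "category C \<Longrightarrow> f \<in> hom C a b \<Longrightarrow> g \<in> hom C b c \<Longrightarrow> f \<cdot>\<^bsub>C\<^esub> g \<in> hom C a c"
  by (auto simp: category_def hom_def)

lemma ide_cmp: "category C \<Longrightarrow> f \<in> hom C a b \<Longrightarrow> Ide C a \<cdot>\<^bsub>C\<^esub> f = f"
  by (auto simp: category_def hom_def)

lemma cmp_ide: "category C \<Longrightarrow> f \<in> hom C a b \<Longrightarrow> f \<cdot>\<^bsub>C\<^esub> Ide C b = f"
  by (auto simp: category_def hom_def)

lemma cmp_assoc:
  "category C \<Longrightarrow> f \<in> hom C a b \<Longrightarrow> g \<in> hom C b c \<Longrightarrow> h \<in> hom C c d \<Longrightarrow>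
    (f \<cdot>\<^bsub>C\<^esub> g) \<cdot>\<^bsub>C\<^esub> h = f \<cdot>\<^bsub>C\<^esub> (g \<cdot>\<^bsub>C\<^esub> h)"
  by (auto simp: category_def hom_def)

lemma is_functorI:
  assumes "category C" "category D"
    and "\<And>a. a \<in> Obj C \<Longrightarrow> OMap F a \<in> Obj D"
    and "\<And>f a b. f \<in> hom C a b \<Longrightarrow> AMap F f \<in> hom D (OMap F a) (OMap F b)"
    and "\<And>a. a \<in> Obj C \<Longrightarrow> AMap F (Ide C a) = Ide D (OMap F a)"
    and "\<And>f g a b c. f \<in> hom C a b \<Longrightarrow> g \<in> hom C b c \<Longrightarrow>
      AMap F (f \<cdot>\<^bsub>C\<^esub> g) = AMap F f \<cdot>\<^bsub>D\<^esub> AMap F g"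
  shows "is_functor C D F"
  unfolding is_functor_def using assms by (auto simp: hom_def)

lemma is_functorD:
  assumes "is_functor C D F"
  shows functor_cats: "category C" "category D"
    and functor_obj: "a \<in> Obj C \<Longrightarrow> OMap F a \<in> Obj D"
    and functor_hom: "f \<in> hom C a b \<Longrightarrow> AMap F f \<in> hom D (OMap F a) (OMap F b)"
    and functor_ide: "a \<in> Obj C \<Longrightarrow> AMap F (Ide C a) = Ide D (OMap F a)"
    and functor_cmp: "f \<in> hom C a b \<Longrightarrow> g \<in> hom C b c \<Longrightarrow>
      AMap F (f \<cdot>\<^bsub>C\<^esub> g) = AMap F f \<cdot>\<^bsub>D\<^esub> AMap F g"
  using assms unfolding is_functor_def hom_def by auto

lemma functor_id: "category C \<Longrightarrow> is_functor C C id_functor"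
  by (rule is_functorI) (auto simp: id_functor_def ide_in_hom)

lemma functor_comp:
  assumes "is_functor C D F" "is_functor D E G"
  shows "is_functor C E (F \<then> G)"
proof (rule is_functorI)
  fix f g a b c assume f: "f \<in> hom C a b" and g: "g \<in> hom C b c"
  show "AMap (F \<then> G) (f \<cdot>\<^bsub>C\<^esub> g) = AMap (F \<then> G) f \<cdot>\<^bsub>E\<^esub> AMap (F \<then> G) g"
    using functor_cmp[OF assms(1) f g]
      functor_cmp[OF assms(2) functor_hom[OF assms(1) f] functor_hom[OF assms(1) g]]
    by (simp add: comp_functor_def)
qed (auto simp: comp_functor_def functor_cats[OF assms(1)] functor_cats[OF assms(2)]
    functor_ide[OF assms(1)] functor_ide[OF assms(2)] functor_obj[OF assms(1)]
    intro: functor_obj[OF assms(2)] functor_hom[OF assms(2)] functor_hom[OF assms(1)])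

lemma nat_transfI:
  assumes "is_functor C D F" "is_functor C D G"
    and "\<And>a. a \<in> Obj C \<Longrightarrow> \<eta> a \<in> hom D (OMap F a) (OMap G a)"
    and "\<And>f a b. f \<in> hom C a b \<Longrightarrow> AMap F f \<cdot>\<^bsub>D\<^esub> \<eta> b = \<eta> a \<cdot>\<^bsub>D\<^esub> AMap G f"
  shows "nat_transf C D F G \<eta>"
  unfolding nat_transf_def using assms by (auto simp: hom_def)

lemma isomorphismI:
  assumes "f \<in> hom C a b" "g \<in> hom C b a" "f \<cdot>\<^bsub>C\<^esub> g = Ide C a" "g \<cdot>\<^bsub>C\<^esub> f = Ide C b"
  shows "isomorphism C f"
  using assms by (auto simp: isomorphism_def hom_def)

lemma isomorphismE:
  assumes "isomorphism C f" "f \<in> hom C a b"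
  obtains g where "g \<in> hom C b a" "f \<cdot>\<^bsub>C\<^esub> g = Ide C a" "g \<cdot>\<^bsub>C\<^esub> f = Ide C b"
  using assms by (auto simp: isomorphism_def hom_def)

lemma hom_full_subcat:
  "hom (full_subcat D S) a b = (if a \<in> S \<and> b \<in> S then hom D a b else {})"
  by (auto simp: hom_def full_subcat_def)

lemma full_subcat_simps [simp]:
  "Obj (full_subcat D S) = S" "Ide (full_subcat D S) = Ide D" "Cmp (full_subcat D S) = Cmp D"
  "Dom (full_subcat D S) = Dom D" "Cod (full_subcat D S) = Cod D"
  by (simp_all add: full_subcat_def)

lemma category_full_subcat:
  assumes "category D" "S \<subseteq> Obj D"
  shows "category (full_subcat D S)"
proof (rule categoryI)
  show "Dom (full_subcat D S) f \<in> Obj (full_subcat D S) \<and> Cod (full_subcat D S) f \<in> Obj (full_subcat D S)"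
    if "f \<in> Arr (full_subcat D S)" for f
    using that by (simp add: full_subcat_def)
qed (use assms in \<open>auto simp: hom_full_subcat ide_cmp cmp_ide cmp_assoc
      intro: ide_in_hom cmp_in_hom split: if_splits\<close>)

section \<open>Adjunctions assembled from universal arrows\<close>

locale universal_arrows =
  fixes C :: "('o1, 'm1, 'x) cat_scheme" and D :: "('o2, 'm2, 'y) cat_scheme"
    and F\<^sub>0 :: "'o1 \<Rightarrow> 'o2" and G :: "('o2, 'm2, 'o1, 'm1) func" and \<eta> :: "'o1 \<Rightarrow> 'm1"
  assumes C: "category C" and G: "is_functor D C G"
    and obj: "\<And>X. X \<in> Obj C \<Longrightarrow> F\<^sub>0 X \<in> Obj D"
    and unit: "\<And>X. X \<in> Obj C \<Longrightarrow> \<eta> X \<in> hom C X (OMap G (F\<^sub>0 X))"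
    and universal: "\<And>X Y \<phi>. X \<in> Obj C \<Longrightarrow> Y \<in> Obj D \<Longrightarrow> \<phi> \<in> hom C X (OMap G Y) \<Longrightarrow>
      \<exists>!\<psi>. \<psi> \<in> hom D (F\<^sub>0 X) Y \<and> \<eta> X \<cdot>\<^bsub>C\<^esub> AMap G \<psi> = \<phi>"
begin

lemma D: "category D"
  using G by (rule functor_cats)

definition lift :: "'o1 \<Rightarrow> 'o2 \<Rightarrow> 'm1 \<Rightarrow> 'm2" where
  "lift X Y \<phi> = (THE \<psi>. \<psi> \<in> hom D (F\<^sub>0 X) Y \<and> \<eta> X \<cdot>\<^bsub>C\<^esub> AMap G \<psi> = \<phi>)"

lemma lift:
  assumes "Y \<in> Obj D" "\<phi> \<in> hom C X (OMap G Y)"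
  shows "lift X Y \<phi> \<in> hom D (F\<^sub>0 X) Y" "\<eta> X \<cdot>\<^bsub>C\<^esub> AMap G (lift X Y \<phi>) = \<phi>"
  using theI'[OF universal[OF hom_objs(1)[OF C assms(2)] assms]] unfolding lift_def by simp_all

lemma cancel:
  assumes "\<psi> \<in> hom D (F\<^sub>0 X) Y" "\<psi>' \<in> hom D (F\<^sub>0 X) Y" "X \<in> Obj C"
    and "\<eta> X \<cdot>\<^bsub>C\<^esub> AMap G \<psi> = \<eta> X \<cdot>\<^bsub>C\<^esub> AMap G \<psi>'"
  shows "\<psi> = \<psi>'"
proof -
  have "Y \<in> Obj D" using hom_objs(2)[OF D assms(1)] .
  moreover have "\<eta> X \<cdot>\<^bsub>C\<^esub> AMap G \<psi> \<in> hom C X (OMap G Y)"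
    by (rule cmp_in_hom[OF C unit[OF assms(3)] functor_hom[OF G assms(1)]])
  ultimately show ?thesis
    using ex1E[OF universal[OF assms(3)]] assms(1,2,4) by metis
qed

text \<open>The value on arrows is forced: it is the only choice that makes the unit
  natural.\<close>

definition left_adjoint :: "('o1, 'm1, 'o2, 'm2) func" where
  "left_adjoint = \<lparr>OMap = F\<^sub>0,
     AMap = (\<lambda>f. lift (Dom C f) (F\<^sub>0 (Cod C f)) (f \<cdot>\<^bsub>C\<^esub> \<eta> (Cod C f)))\<rparr>"

lemma omap [simp]: "OMap left_adjoint = F\<^sub>0"
  by (simp add: left_adjoint_def)

lemma left_adjoint_hom:
  assumes "f \<in> hom C a b"
  shows "AMap left_adjoint f \<in> hom D (F\<^sub>0 a) (F\<^sub>0 b)"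
    and "\<eta> a \<cdot>\<^bsub>C\<^esub> AMap G (AMap left_adjoint f) = f \<cdot>\<^bsub>C\<^esub> \<eta> b"
proof -
  have ob: "b \<in> Obj C" using hom_objs(2)[OF C assms] .
  have "f \<cdot>\<^bsub>C\<^esub> \<eta> b \<in> hom C a (OMap G (F\<^sub>0 b))"
    by (rule cmp_in_hom[OF C assms unit[OF ob]])
  from lift[OF obj[OF ob] this] homD[OF assms]
  show "AMap left_adjoint f \<in> hom D (F\<^sub>0 a) (F\<^sub>0 b)"
    and "\<eta> a \<cdot>\<^bsub>C\<^esub> AMap G (AMap left_adjoint f) = f \<cdot>\<^bsub>C\<^esub> \<eta> b"
    by (simp_all add: left_adjoint_def)
qed

text \<open>In each functor law both sides have the same composite with the unit, and
  \<open>cancel\<close> turns this into equality.\<close>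

lemma functor_left_adjoint: "is_functor C D left_adjoint"
proof (rule is_functorI)
  fix a assume a: "a \<in> Obj C"
  show "AMap left_adjoint (Ide C a) = Ide D (OMap left_adjoint a)"
  proof (rule cancel[OF left_adjoint_hom(1)[OF ide_in_hom[OF C a]] _ a])
    show "Ide D (OMap left_adjoint a) \<in> hom D (F\<^sub>0 a) (F\<^sub>0 a)"
      using ide_in_hom[OF D obj[OF a]] by simp
    show "\<eta> a \<cdot>\<^bsub>C\<^esub> AMap G (AMap left_adjoint (Ide C a)) = \<eta> a \<cdot>\<^bsub>C\<^esub> AMap G (Ide D (OMap left_adjoint a))"
      by (simp add: left_adjoint_hom(2)[OF ide_in_hom[OF C a]] omap functor_ide[OF G obj[OF a]]
          ide_cmp[OF C unit[OF a]] cmp_ide[OF C unit[OF a]])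
  qed
next
  fix f g a b c assume f: "f \<in> hom C a b" and g: "g \<in> hom C b c"
  note fg = cmp_in_hom[OF C f g]
  note ff = left_adjoint_hom[OF f] and gg = left_adjoint_hom[OF g] and ffgg = left_adjoint_hom[OF fg]
  have a: "a \<in> Obj C" and b: "b \<in> Obj C" and c: "c \<in> Obj C"
    using hom_objs[OF C f] hom_objs[OF C g] by auto
  show "AMap left_adjoint (f \<cdot>\<^bsub>C\<^esub> g) = AMap left_adjoint f \<cdot>\<^bsub>D\<^esub> AMap left_adjoint g"
  proof (rule cancel[OF ffgg(1) cmp_in_hom[OF D ff(1) gg(1)] a])
    have "\<eta> a \<cdot>\<^bsub>C\<^esub> AMap G (AMap left_adjoint f \<cdot>\<^bsub>D\<^esub> AMap left_adjoint g)
        = \<eta> a \<cdot>\<^bsub>C\<^esub> (AMap G (AMap left_adjoint f) \<cdot>\<^bsub>C\<^esub> AMap G (AMap left_adjoint g))"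
      by (simp add: functor_cmp[OF G ff(1) gg(1)])
    also have "\<dots> = (f \<cdot>\<^bsub>C\<^esub> \<eta> b) \<cdot>\<^bsub>C\<^esub> AMap G (AMap left_adjoint g)"
      using cmp_assoc[OF C unit[OF a] functor_hom[OF G ff(1)] functor_hom[OF G gg(1)]] ff(2) by simp
    also have "\<dots> = f \<cdot>\<^bsub>C\<^esub> (g \<cdot>\<^bsub>C\<^esub> \<eta> c)"
      using cmp_assoc[OF C f unit[OF b] functor_hom[OF G gg(1)]] gg(2) by simp
    also have "\<dots> = (f \<cdot>\<^bsub>C\<^esub> g) \<cdot>\<^bsub>C\<^esub> \<eta> c"
      using cmp_assoc[OF C f g unit[OF c]] by simp
    finally show "\<eta> a \<cdot>\<^bsub>C\<^esub> AMap G (AMap left_adjoint (f \<cdot>\<^bsub>C\<^esub> g))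
        = \<eta> a \<cdot>\<^bsub>C\<^esub> AMap G (AMap left_adjoint f \<cdot>\<^bsub>D\<^esub> AMap left_adjoint g)"
      using ffgg(2) by simp
  qed
qed (simp_all add: C D obj left_adjoint_hom(1))

lemma adjunction: "adjunction C D left_adjoint G \<eta>"
  unfolding adjunction_def
proof (intro conjI ballI)
  show "nat_transf C C id_functor (left_adjoint \<then> G) \<eta>"
  proof (rule nat_transfI)
    show "\<eta> a \<in> hom C (OMap id_functor a) (OMap (left_adjoint \<then> G) a)" if "a \<in> Obj C" for a
      using unit[OF that] by (simp add: id_functor_def comp_functor_def)
    show "AMap id_functor f \<cdot>\<^bsub>C\<^esub> \<eta> b = \<eta> a \<cdot>\<^bsub>C\<^esub> AMap (left_adjoint \<then> G) f" if "f \<in> hom C a b" for f a b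
      using left_adjoint_hom(2)[OF that] by (simp add: id_functor_def comp_functor_def)
  qed (rule functor_id[OF C] functor_comp[OF functor_left_adjoint G])+
  show "is_functor C D left_adjoint" "is_functor D C G"
    by (rule functor_left_adjoint G)+
  show "\<exists>!\<psi>. \<psi> \<in> hom D (OMap left_adjoint X) Y \<and> \<eta> X \<cdot>\<^bsub>C\<^esub> AMap G \<psi> = \<phi>"
    if "X \<in> Obj C" "Y \<in> Obj D" "\<phi> \<in> hom C X (OMap G Y)" for X Y \<phi>
    using universal[OF that] by simp
qed

end

section \<open>Adjunctions with invertible unit and the coreflective image\<close>

locale iso_unit_adjunction =
  fixes C :: "('o1, 'm1, 'x) cat_scheme" and D :: "('o2, 'm2, 'y) cat_scheme"
    and F :: "('o1, 'm1, 'o2, 'm2) func" and G :: "('o2, 'm2, 'o1, 'm1) func" and \<eta> :: "'o1 \<Rightarrow> 'm1"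
  assumes adj: "adjunction C D F G \<eta>"
    and unit_iso: "\<And>X. X \<in> Obj C \<Longrightarrow> isomorphism C (\<eta> X)"
begin

lemma F: "is_functor C D F" and G: "is_functor D C G"
  using adj by (auto simp: adjunction_def)

lemma unit: "X \<in> Obj C \<Longrightarrow> \<eta> X \<in> hom C X (OMap G (OMap F X))"
  using adj by (simp add: adjunction_def nat_transf_def id_functor_def comp_functor_def)

lemma unit_nat:
  assumes "f \<in> hom C X X'"
  shows "f \<cdot>\<^bsub>C\<^esub> \<eta> X' = \<eta> X \<cdot>\<^bsub>C\<^esub> AMap G (AMap F f)"
  using adj homD[OF assms] by (auto simp: adjunction_def nat_transf_def id_functor_def comp_functor_def)

sublocale universal_arrows C D "OMap F" G \<eta>
proof
  show "category C" using functor_cats(1)[OF F] .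
  show "is_functor D C G" using G .
  show "\<And>X. X \<in> Obj C \<Longrightarrow> OMap F X \<in> Obj D" using functor_obj[OF F] .
  show "\<And>X. X \<in> Obj C \<Longrightarrow> \<eta> X \<in> hom C X (OMap G (OMap F X))" using unit .
qed (use adj in \<open>simp add: adjunction_def\<close>)

definition counit :: "'o2 \<Rightarrow> 'm2" where
  "counit Y = lift (OMap G Y) Y (Ide C (OMap G Y))"

lemma counit:
  assumes "Y \<in> Obj D"
  shows "counit Y \<in> hom D (OMap F (OMap G Y)) Y"
    and "\<eta> (OMap G Y) \<cdot>\<^bsub>C\<^esub> AMap G (counit Y) = Ide C (OMap G Y)"
  using lift[OF assms ide_in_hom[OF C functor_obj[OF G assms]]] by (simp_all add: counit_def)

lemma counit_nat:
  assumes g: "g \<in> hom D Y Y'"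
  shows "AMap F (AMap G g) \<cdot>\<^bsub>D\<^esub> counit Y' = counit Y \<cdot>\<^bsub>D\<^esub> g"
proof -
  have Y: "Y \<in> Obj D" and Y': "Y' \<in> Obj D" using hom_objs[OF D g] by auto
  have GY: "OMap G Y \<in> Obj C" and GY': "OMap G Y' \<in> Obj C" using Y Y' functor_obj[OF G] by auto
  note Gg = functor_hom[OF G g] and FGg = functor_hom[OF F functor_hom[OF G g]]
  note eY = counit[OF Y] and eY' = counit[OF Y']
  show ?thesis
  proof (rule cancel[OF cmp_in_hom[OF D FGg eY'(1)] cmp_in_hom[OF D eY(1) g] GY])
    have "\<eta> (OMap G Y) \<cdot>\<^bsub>C\<^esub> AMap G (AMap F (AMap G g) \<cdot>\<^bsub>D\<^esub> counit Y')
        = (\<eta> (OMap G Y) \<cdot>\<^bsub>C\<^esub> AMap G (AMap F (AMap G g))) \<cdot>\<^bsub>C\<^esub> AMap G (counit Y')"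
      by (simp add: functor_cmp[OF G FGg eY'(1)]
          cmp_assoc[OF C unit[OF GY] functor_hom[OF G FGg] functor_hom[OF G eY'(1)]])
    also have "\<dots> = (AMap G g \<cdot>\<^bsub>C\<^esub> \<eta> (OMap G Y')) \<cdot>\<^bsub>C\<^esub> AMap G (counit Y')"
      by (simp add: unit_nat[OF Gg])
    also have "\<dots> = AMap G g"
      by (simp add: cmp_assoc[OF C Gg unit[OF GY'] functor_hom[OF G eY'(1)]] eY'(2) cmp_ide[OF C Gg])
    also have "\<dots> = (\<eta> (OMap G Y) \<cdot>\<^bsub>C\<^esub> AMap G (counit Y)) \<cdot>\<^bsub>C\<^esub> AMap G g"
      by (simp add: eY(2) ide_cmp[OF C Gg])
    also have "\<dots> = \<eta> (OMap G Y) \<cdot>\<^bsub>C\<^esub> AMap G (counit Y \<cdot>\<^bsub>D\<^esub> g)"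
      by (simp add: functor_cmp[OF G eY(1) g] cmp_assoc[OF C unit[OF GY] functor_hom[OF G eY(1)] Gg])
    finally show "\<eta> (OMap G Y) \<cdot>\<^bsub>C\<^esub> AMap G (AMap F (AMap G g) \<cdot>\<^bsub>D\<^esub> counit Y')
      = \<eta> (OMap G Y) \<cdot>\<^bsub>C\<^esub> AMap G (counit Y \<cdot>\<^bsub>D\<^esub> g)" .
  qed
qed

lemma triangle:
  assumes X: "X \<in> Obj C"
  shows "AMap F (\<eta> X) \<cdot>\<^bsub>D\<^esub> counit (OMap F X) = Ide D (OMap F X)"
proof -
  have FX: "OMap F X \<in> Obj D" using X functor_obj[OF F] by auto
  note e = counit[OF FX] and GFX = functor_obj[OF G FX]
  note Fu = functor_hom[OF F unit[OF X]]
  show ?thesis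
  proof (rule cancel[OF cmp_in_hom[OF D Fu e(1)] ide_in_hom[OF D FX] X])
    have "\<eta> X \<cdot>\<^bsub>C\<^esub> AMap G (AMap F (\<eta> X) \<cdot>\<^bsub>D\<^esub> counit (OMap F X))
        = (\<eta> X \<cdot>\<^bsub>C\<^esub> AMap G (AMap F (\<eta> X))) \<cdot>\<^bsub>C\<^esub> AMap G (counit (OMap F X))"
      by (simp add: functor_cmp[OF G Fu e(1)]
          cmp_assoc[OF C unit[OF X] functor_hom[OF G Fu] functor_hom[OF G e(1)]])
    also have "\<dots> = (\<eta> X \<cdot>\<^bsub>C\<^esub> \<eta> (OMap G (OMap F X))) \<cdot>\<^bsub>C\<^esub> AMap G (counit (OMap F X))"
      by (simp add: unit_nat[OF unit[OF X]])
    also have "\<dots> = \<eta> X"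
      by (simp add: cmp_assoc[OF C unit[OF X] unit[OF GFX] functor_hom[OF G e(1)]] e(2)
          cmp_ide[OF C unit[OF X]])
    finally show "\<eta> X \<cdot>\<^bsub>C\<^esub> AMap G (AMap F (\<eta> X) \<cdot>\<^bsub>D\<^esub> counit (OMap F X))
      = \<eta> X \<cdot>\<^bsub>C\<^esub> AMap G (Ide D (OMap F X))"
      by (simp add: functor_ide[OF G FX] cmp_ide[OF C unit[OF X]])
  qed
qed

text \<open>If \<open>v\<close> inverts the unit at \<open>X\<close>, the other triangle identity
  gives \<open>counit (OMap F X) = AMap F v\<close>. Hence the counit at \<open>F X\<close> is
  invertible, with inverse the image of the unit under \<open>F\<close>.\<close>

lemma triangle':
  assumes X: "X \<in> Obj C"
  shows "counit (OMap F X) \<cdot>\<^bsub>D\<^esub> AMap F (\<eta> X) = Ide D (OMap F (OMap G (OMap F X)))"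
proof -
  have FX: "OMap F X \<in> Obj D" using X functor_obj[OF F] by auto
  note e = counit(1)[OF FX] and u = unit[OF X] and GFX = functor_obj[OF G FX]
  obtain v where v: "v \<in> hom C (OMap G (OMap F X)) X"
    and uv: "\<eta> X \<cdot>\<^bsub>C\<^esub> v = Ide C X" and vu: "v \<cdot>\<^bsub>C\<^esub> \<eta> X = Ide C (OMap G (OMap F X))"
    by (rule isomorphismE[OF unit_iso[OF X] u])
  note Fu = functor_hom[OF F u] and Fv = functor_hom[OF F v]
  have vu': "AMap F v \<cdot>\<^bsub>D\<^esub> AMap F (\<eta> X) = Ide D (OMap F (OMap G (OMap F X)))"
    using functor_cmp[OF F v u] vu functor_ide[OF F GFX] by simp
  have "counit (OMap F X) = (AMap F v \<cdot>\<^bsub>D\<^esub> AMap F (\<eta> X)) \<cdot>\<^bsub>D\<^esub> counit (OMap F X)"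
    by (simp add: vu' ide_cmp[OF D e])
  also have "\<dots> = AMap F v"
    by (simp add: cmp_assoc[OF D Fv Fu e] triangle[OF X] cmp_ide[OF D Fv])
  finally show ?thesis using vu' by simp
qed

abbreviation \<open>ess \<equiv> OMap F ` Obj C\<close>

text \<open>The unit of the coreflection has to be a function of the object of \<open>D\<close>,
  whereas \<open>AMap F (\<eta> X)\<close> depends on a preimage \<open>X\<close>, which need not be
  unique. Inverses are unique, so a definite description avoids choosing a preimage.\<close>

definition counit_inv :: "'o2 \<Rightarrow> 'm2" where
  "counit_inv Y = (THE f. f \<in> hom D Y (OMap F (OMap G Y)) \<and> counit Y \<cdot>\<^bsub>D\<^esub> f = Ide D (OMap F (OMap G Y))
     \<and> f \<cdot>\<^bsub>D\<^esub> counit Y = Ide D Y)"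

lemma counit_inv_eq:
  assumes X: "X \<in> Obj C"
  shows "counit_inv (OMap F X) = AMap F (\<eta> X)"
  unfolding counit_inv_def
proof (rule the_equality)
  have FX: "OMap F X \<in> Obj D" using X functor_obj[OF F] by auto
  note Fu = functor_hom[OF F unit[OF X]] and e = counit(1)[OF FX]
  show "AMap F (\<eta> X) \<in> hom D (OMap F X) (OMap F (OMap G (OMap F X))) \<and>
    counit (OMap F X) \<cdot>\<^bsub>D\<^esub> AMap F (\<eta> X) = Ide D (OMap F (OMap G (OMap F X))) \<and>
    AMap F (\<eta> X) \<cdot>\<^bsub>D\<^esub> counit (OMap F X) = Ide D (OMap F X)"
    using Fu triangle[OF X] triangle'[OF X] by simp
  fix f assume f: "f \<in> hom D (OMap F X) (OMap F (OMap G (OMap F X))) \<and>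
    counit (OMap F X) \<cdot>\<^bsub>D\<^esub> f = Ide D (OMap F (OMap G (OMap F X))) \<and> f \<cdot>\<^bsub>D\<^esub> counit (OMap F X) = Ide D (OMap F X)"
  then have fh: "f \<in> hom D (OMap F X) (OMap F (OMap G (OMap F X)))" ..
  have "f = (f \<cdot>\<^bsub>D\<^esub> counit (OMap F X)) \<cdot>\<^bsub>D\<^esub> AMap F (\<eta> X)"
    by (simp add: cmp_assoc[OF D fh e Fu] triangle'[OF X] cmp_ide[OF D fh])
  then show "f = AMap F (\<eta> X)" using f ide_cmp[OF D Fu] by simp
qed

lemma counit_inv:
  assumes "A \<in> ess"
  shows "counit_inv A \<in> hom D A (OMap F (OMap G A))"
    and "counit A \<cdot>\<^bsub>D\<^esub> counit_inv A = Ide D (OMap F (OMap G A))"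
    and "counit_inv A \<cdot>\<^bsub>D\<^esub> counit A = Ide D A"
  using assms counit_inv_eq functor_hom[OF F unit] triangle triangle' by auto

lemma ess_sub: "ess \<subseteq> Obj D"
  using functor_obj[OF F] by auto

lemma category_ess: "category (full_subcat D ess)"
  using category_full_subcat[OF D ess_sub] .

lemma functor_to_ess: "is_functor C (full_subcat D ess) F"
proof (rule is_functorI)
  show "AMap F f \<in> hom (full_subcat D ess) (OMap F a) (OMap F b)" if "f \<in> hom C a b" for f a b
    using functor_hom[OF F that] hom_objs[OF C that] by (auto simp: hom_full_subcat)
qed (auto simp: C category_ess functor_ide[OF F] functor_cmp[OF F])

lemma functor_from_ess: "is_functor (full_subcat D ess) C G"
  by (rule is_functorI)
    (use ess_sub in \<open>auto simp: C category_ess functor_ide[OF G] functor_cmp[OF G] hom_full_subcat obj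
      intro!: functor_obj[OF G] functor_hom[OF G] split: if_splits\<close>)

lemma inclusion_functor: "is_functor (full_subcat D ess) D id_functor"
  by (rule is_functorI)
    (use ess_sub in \<open>auto simp: D category_ess id_functor_def hom_full_subcat obj split: if_splits\<close>)

lemma equivalent_ess: "equivalent_cats C (full_subcat D ess)"
  unfolding equivalent_cats_def
proof (intro exI conjI)
  show "nat_iso C C id_functor (F \<then> G) \<eta>"
    unfolding nat_iso_def using adj unit_iso by (auto simp: adjunction_def)
  show "nat_iso (full_subcat D ess) (full_subcat D ess) (G \<then> F) id_functor counit"
    unfolding nat_iso_def
  proof (intro conjI ballI nat_transfI)
    show "is_functor (full_subcat D ess) (full_subcat D ess) (G \<then> F)"
      by (rule functor_comp[OF functor_from_ess functor_to_ess])
    show "is_functor (full_subcat D ess) (full_subcat D ess) id_functor"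
      by (rule functor_id[OF category_ess])
    fix A assume "A \<in> Obj (full_subcat D ess)"
    then have A: "A \<in> ess" by simp
    then have A': "A \<in> Obj D" using ess_sub by blast
    have FGA: "OMap F (OMap G A) \<in> ess" using functor_obj[OF G A'] by blast
    show "counit A \<in> hom (full_subcat D ess) (OMap (G \<then> F) A) (OMap id_functor A)"
      using counit(1)[OF A'] A FGA by (simp add: hom_full_subcat comp_functor_def id_functor_def)
    show "isomorphism (full_subcat D ess) (counit A)"
      by (rule isomorphismI[where a = "OMap F (OMap G A)" and b = A and g = "counit_inv A"])
        (use counit(1)[OF A'] A FGA counit_inv[OF A] in \<open>simp_all add: hom_full_subcat\<close>)
  next
    fix f A B assume "f \<in> hom (full_subcat D ess) A B"
    then show "AMap (G \<then> F) f \<cdot>\<^bsub>full_subcat D ess\<^esub> counit B =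
      counit A \<cdot>\<^bsub>full_subcat D ess\<^esub> AMap id_functor f"
      by (simp add: hom_full_subcat comp_functor_def id_functor_def counit_nat split: if_splits)
  qed
qed (rule functor_to_ess functor_from_ess)+

lemma counit_inv_nat:
  assumes g: "g \<in> hom D A B" and A: "A \<in> ess" and B: "B \<in> ess"
  shows "g \<cdot>\<^bsub>D\<^esub> counit_inv B = counit_inv A \<cdot>\<^bsub>D\<^esub> AMap F (AMap G g)"
proof -
  note kA = counit_inv[OF A] and kB = counit_inv[OF B]
  have eA: "counit A \<in> hom D (OMap F (OMap G A)) A" and eB: "counit B \<in> hom D (OMap F (OMap G B)) B"
    using counit(1) A B ess_sub by auto
  note FGg = functor_hom[OF F functor_hom[OF G g]]
  have "g \<cdot>\<^bsub>D\<^esub> counit_inv B = (counit_inv A \<cdot>\<^bsub>D\<^esub> counit A) \<cdot>\<^bsub>D\<^esub> (g \<cdot>\<^bsub>D\<^esub> counit_inv B)"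
    by (simp add: kA(3) ide_cmp[OF D cmp_in_hom[OF D g kB(1)]])
  also have "\<dots> = counit_inv A \<cdot>\<^bsub>D\<^esub> ((counit A \<cdot>\<^bsub>D\<^esub> g) \<cdot>\<^bsub>D\<^esub> counit_inv B)"
    by (simp add: cmp_assoc[OF D kA(1) eA cmp_in_hom[OF D g kB(1)]] cmp_assoc[OF D eA g kB(1)])
  also have "\<dots> = counit_inv A \<cdot>\<^bsub>D\<^esub> (AMap F (AMap G g) \<cdot>\<^bsub>D\<^esub> (counit B \<cdot>\<^bsub>D\<^esub> counit_inv B))"
    by (simp add: counit_nat[OF g, symmetric] cmp_assoc[OF D FGg eB kB(1)])
  finally show ?thesis by (simp add: kB(2) cmp_ide[OF D FGg])
qed

text \<open>The coreflector is \<open>G \<then> F\<close>, and the transpose of \<phi> is \<phi>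
  followed by the counit. Invertibility of the counit on the image supplies the unit of this second
  adjunction.\<close>

lemma coreflective_ess: "coreflective_subcat D ess"
  unfolding coreflective_subcat_def
proof (intro conjI exI)
  show "ess \<subseteq> Obj D" by (rule ess_sub)
  have GF: "is_functor D (full_subcat D ess) (G \<then> F)"
    by (rule functor_comp[OF G functor_to_ess])
  show "adjunction (full_subcat D ess) D id_functor (G \<then> F) counit_inv"
    unfolding adjunction_def
  proof (intro conjI ballI)
    show "nat_transf (full_subcat D ess) (full_subcat D ess) id_functor (id_functor \<then> (G \<then> F)) counit_inv"
    proof (rule nat_transfI)
      show "is_functor (full_subcat D ess) (full_subcat D ess) id_functor"
        by (rule functor_id[OF category_ess])
      show "is_functor (full_subcat D ess) (full_subcat D ess) (id_functor \<then> (G \<then> F))"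
        by (rule functor_comp[OF inclusion_functor GF])
      show "counit_inv A \<in> hom (full_subcat D ess) (OMap id_functor A) (OMap (id_functor \<then> (G \<then> F)) A)"
        if "A \<in> Obj (full_subcat D ess)" for A
        using that counit_inv(1)[of A] ess_sub functor_obj[OF G]
        by (auto simp: hom_full_subcat id_functor_def comp_functor_def obj)
      show "AMap id_functor f \<cdot>\<^bsub>full_subcat D ess\<^esub> counit_inv B =
        counit_inv A \<cdot>\<^bsub>full_subcat D ess\<^esub> AMap (id_functor \<then> (G \<then> F)) f"
        if "f \<in> hom (full_subcat D ess) A B" for f A B
        using that counit_inv_nat[of f A B]
        by (simp add: hom_full_subcat id_functor_def comp_functor_def split: if_splits)
    qed
  next
    fix A Y \<phi> assume "A \<in> Obj (full_subcat D ess)" and Y: "Y \<in> Obj D"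
      and "\<phi> \<in> hom (full_subcat D ess) A (OMap (G \<then> F) Y)"
    then have A: "A \<in> ess" and phi: "\<phi> \<in> hom D A (OMap F (OMap G Y))"
      by (auto simp: hom_full_subcat comp_functor_def split: if_splits)
    have GY: "OMap G Y \<in> Obj C" by (rule functor_obj[OF G Y])
    have FGY: "OMap F (OMap G Y) \<in> ess" using GY by blast
    have eA: "counit A \<in> hom D (OMap F (OMap G A)) A" using counit(1) A ess_sub by auto
    note kA = counit_inv[OF A] and eY = counit[OF Y]
    note FGeY = functor_hom[OF F functor_hom[OF G eY(1)]]
    note u = unit[OF GY]
    \<comment> \<open>Naturality of the counit moves \<open>AMap F (AMap G \<psi>)\<close> past it,
      and the counit at \<open>A\<close> cancels against its inverse. So \<psi> is recovered from
      its transpose, which gives uniqueness.\<close>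
    have inv: "\<psi> = (counit_inv A \<cdot>\<^bsub>D\<^esub> AMap F (AMap G \<psi>)) \<cdot>\<^bsub>D\<^esub> counit Y" if psi: "\<psi> \<in> hom D A Y" for \<psi>
      by (simp add: cmp_assoc[OF D kA(1) functor_hom[OF F functor_hom[OF G psi]] eY(1)] counit_nat[OF psi]
          cmp_assoc[OF D kA(1) eA psi, symmetric] kA(3) ide_cmp[OF D psi])
    \<comment> \<open>Existence: naturality of \<open>counit_inv\<close> applies to \<phi> because
      its target \<open>F (G Y)\<close> also lies in the image. What remains after \<phi> is
      \<open>F\<close> applied to the triangle identity at \<open>Y\<close>.\<close>
    have "counit_inv A \<cdot>\<^bsub>D\<^esub> AMap F (AMap G (\<phi> \<cdot>\<^bsub>D\<^esub> counit Y))
        = counit_inv A \<cdot>\<^bsub>D\<^esub> (AMap F (AMap G \<phi>) \<cdot>\<^bsub>D\<^esub> AMap F (AMap G (counit Y)))"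
      by (simp add: functor_cmp[OF G phi eY(1)] functor_cmp[OF F functor_hom[OF G phi] functor_hom[OF G eY(1)]])
    also have "\<dots> = (\<phi> \<cdot>\<^bsub>D\<^esub> counit_inv (OMap F (OMap G Y))) \<cdot>\<^bsub>D\<^esub> AMap F (AMap G (counit Y))"
      by (simp add: counit_inv_nat[OF phi A FGY]
          cmp_assoc[OF D kA(1) functor_hom[OF F functor_hom[OF G phi]] FGeY])
    also have "\<dots> = \<phi> \<cdot>\<^bsub>D\<^esub> AMap F (\<eta> (OMap G Y) \<cdot>\<^bsub>C\<^esub> AMap G (counit Y))"
      using cmp_assoc[OF D phi counit_inv(1)[OF FGY] FGeY]
      by (simp add: counit_inv_eq[OF GY] functor_cmp[OF F u functor_hom[OF G eY(1)]])
    also have "\<dots> = \<phi>"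
      by (simp add: eY(2) functor_ide[OF F GY] cmp_ide[OF D phi])
    finally have ex: "counit_inv A \<cdot>\<^bsub>D\<^esub> AMap F (AMap G (\<phi> \<cdot>\<^bsub>D\<^esub> counit Y)) = \<phi>" .
    show "\<exists>!\<psi>. \<psi> \<in> hom D (OMap id_functor A) Y \<and> counit_inv A \<cdot>\<^bsub>full_subcat D ess\<^esub> AMap (G \<then> F) \<psi> = \<phi>"
    proof (rule ex1I[of _ "\<phi> \<cdot>\<^bsub>D\<^esub> counit Y"])
      show "\<phi> \<cdot>\<^bsub>D\<^esub> counit Y \<in> hom D (OMap id_functor A) Y \<and>
        counit_inv A \<cdot>\<^bsub>full_subcat D ess\<^esub> AMap (G \<then> F) (\<phi> \<cdot>\<^bsub>D\<^esub> counit Y) = \<phi>"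
        using ex cmp_in_hom[OF D phi eY(1)] by (simp add: comp_functor_def id_functor_def)
      show "\<psi> = \<phi> \<cdot>\<^bsub>D\<^esub> counit Y"
        if "\<psi> \<in> hom D (OMap id_functor A) Y \<and> counit_inv A \<cdot>\<^bsub>full_subcat D ess\<^esub> AMap (G \<then> F) \<psi> = \<phi>" for \<psi>
        using that inv[of \<psi>] by (simp add: comp_functor_def id_functor_def)
    qed
  qed (rule inclusion_functor GF)+
qed

lemma coreflective_in: "coreflective_in C D"
  unfolding coreflective_in_def using coreflective_ess equivalent_ess by blast

end

section \<open>Cones in normal categories\<close>

definition incls :: "('o, 'm, 'x) subobj_cat_scheme \<Rightarrow> 'o \<Rightarrow> 'o \<Rightarrow> 'm set" where
  "incls C a b = {j \<in> Incl C. Dom C j = a \<and> Cod C j = b}"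

text \<open>In a normal category these are exactly the epimorphisms: if \<open>f = q u j\<close> is
  epi, the inclusion \<open>j\<close> is both split and epi, hence an identity. The section is what
  the later computations use.\<close>

definition split_epis :: "('o, 'm, 'x) cat_scheme \<Rightarrow> 'o \<Rightarrow> 'o \<Rightarrow> 'm set" where
  "split_epis C a b = {f \<in> hom C a b. \<exists>s \<in> hom C b a. s \<cdot>\<^bsub>C\<^esub> f = Ide C b}"

definition img :: "('o, 'm, 'x) subobj_cat_scheme \<Rightarrow> 'm \<Rightarrow> 'o" where
  "img C f = Cod C (epi_part C f)"

lemma split_episE:
  assumes "f \<in> split_epis C a b"
  obtains s where "f \<in> hom C a b" "s \<in> hom C b a" "s \<cdot>\<^bsub>C\<^esub> f = Ide C b"
  using assms by (auto simp: split_epis_def)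

lemma split_episI: "f \<in> hom C a b \<Longrightarrow> s \<in> hom C b a \<Longrightarrow> s \<cdot>\<^bsub>C\<^esub> f = Ide C b \<Longrightarrow> f \<in> split_epis C a b"
  by (auto simp: split_epis_def)

lemma split_epi_hom: "f \<in> split_epis C a b \<Longrightarrow> f \<in> hom C a b"
  by (simp add: split_epis_def)

lemma hom_incl_cat: "hom (incl_cat C) a b = incls C a b"
  by (auto simp: hom_def incls_def incl_cat_def)

lemma incl_cat_simps [simp]:
  "Obj (incl_cat C) = Obj C" "Arr (incl_cat C) = Incl C" "Dom (incl_cat C) = Dom C"
  "Cod (incl_cat C) = Cod C" "Ide (incl_cat C) = Ide C" "Cmp (incl_cat C) = Cmp C"
  by (simp_all add: incl_cat_def)

lemma cone_atD:
  assumes "cone_at C z \<gamma>"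
  shows cone_vertex_obj: "z \<in> Obj C"
    and cone_ext: "\<gamma> \<in> extensional (Obj C)"
    and cone_hom: "c \<in> Obj C \<Longrightarrow> \<gamma> c \<in> hom C c z"
    and cone_incl: "a \<in> Obj C \<Longrightarrow> b \<in> Obj C \<Longrightarrow> j \<in> incls C a b \<Longrightarrow> j \<cdot>\<^bsub>C\<^esub> \<gamma> b = \<gamma> a"
    and cone_iso: "\<exists>c \<in> Obj C. isomorphism C (\<gamma> c)"
  using assms by (auto simp: cone_at_def PiE_iff hom_incl_cat)

lemma cone_atI:
  assumes "z \<in> Obj C" "\<gamma> \<in> extensional (Obj C)"
    and "\<And>c. c \<in> Obj C \<Longrightarrow> \<gamma> c \<in> hom C c z"
    and "\<And>a b j. a \<in> Obj C \<Longrightarrow> b \<in> Obj C \<Longrightarrow> j \<in> incls C a b \<Longrightarrow> j \<cdot>\<^bsub>C\<^esub> \<gamma> b = \<gamma> a"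
    and "c \<in> Obj C" "isomorphism C (\<gamma> c)"
  shows "cone_at C z \<gamma>"
  using assms by (auto simp: cone_at_def PiE_iff hom_incl_cat)

lemma vertex_eq:
  assumes "cone_at C z \<gamma>"
  shows "vertex C \<gamma> = z"
  unfolding vertex_def
proof (rule the_equality)
  show "cone_at C z \<gamma>" by (rule assms)
  fix z' assume "cone_at C z' \<gamma>"
  then show "z' = z"
    using cone_hom[of C z' \<gamma> z] cone_hom[of C z \<gamma> z] assms cone_vertex_obj[OF assms]
    by (metis homD(3))
qed

section \<open>Inclusions and factorisations in a normal category\<close>

locale normal_cat =
  fixes C :: "('o, 'm, 'x) subobj_cat_scheme" (structure)
  assumes normal: "normal_category C"
begin

lemma subobjects: "category_with_subobjects C"
  using normal by (simp add: normal_category_def)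

lemma cat: "category C"
  using subobjects by (simp add: category_with_subobjects_def)

lemma preorder: "strict_preorder (incl_cat C)"
  using subobjects by (simp add: category_with_subobjects_def)

lemma incl_category: "category (incl_cat C)"
  using preorder by (simp add: strict_preorder_def)

lemma incl_hom: "j \<in> incls C a b \<Longrightarrow> j \<in> hom C a b"
  using subobjects by (auto simp: category_with_subobjects_def incls_def hom_def)

lemma incl_ide: "a \<in> Obj C \<Longrightarrow> Ide C a \<in> incls C a a"
  using ide_in_hom[OF incl_category] by (simp add: hom_incl_cat)

lemma incl_cmp: "j \<in> incls C a b \<Longrightarrow> k \<in> incls C b c \<Longrightarrow> j \<cdot> k \<in> incls C a c"
  using cmp_in_hom[OF incl_category, of j a b k c] by (simp add: hom_incl_cat)

lemma incl_unique: 
  assumes "j \<in> incls C a b" "k \<in> incls C a b"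
  shows "j = k"
proof -
  have "a \<in> Obj C" "b \<in> Obj C" using hom_objs[OF cat incl_hom[OF assms(1)]] by auto
  then show ?thesis
    using preorder assms by (simp add: strict_preorder_def hom_incl_cat)
qed

text \<open>Both composites are identities by uniqueness of inclusions, so \<open>j\<close> is
  invertible inside the strict preorder of inclusions and must itself be an identity.\<close>

lemma incl_antisym:
  assumes j: "j \<in> incls C a b" and k: "k \<in> incls C b a"
  shows "a = b"
proof -
  have ab: "a \<in> Obj C" "b \<in> Obj C" using hom_objs[OF cat incl_hom[OF j]] by auto
  have "j \<cdot> k = Ide C a" "k \<cdot> j = Ide C b"
    using incl_unique incl_cmp[OF j k] incl_cmp[OF k j] incl_ide ab by auto
  then have "isomorphism (incl_cat C) j"
    using j k by (intro isomorphismI[of _ _ a b k]) (simp_all add: hom_incl_cat)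
  then obtain x where x: "x \<in> Obj C" "j = Ide C x"
    using preorder by (auto simp: strict_preorder_def)
  then have "j \<in> incls C x x" using incl_ide by auto
  then show ?thesis using j by (auto simp: incls_def)
qed

lemma incl_endo: "j \<in> incls C a a \<Longrightarrow> j = Ide C a"
  using incl_unique incl_ide hom_objs(1)[OF cat incl_hom] by metis

lemma incl_mono:
  assumes "j \<in> incls C a b" "f \<in> hom C x a" "g \<in> hom C x a" "f \<cdot> j = g \<cdot> j"
  shows "f = g"
proof -
  have "monomorphism C j" using subobjects assms(1) by (auto simp: category_with_subobjects_def incls_def)
  moreover have "f \<in> Arr C" "g \<in> Arr C" "Cod C f = Dom C j" "Cod C g = Dom C j"
    using assms homD[OF assms(2)] homD[OF assms(3)] homD[OF incl_hom[OF assms(1)]] by auto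
  ultimately show ?thesis using assms(4) unfolding monomorphism_def by blast
qed

lemma incl_left_factor:
  assumes "f \<in> incls C a c" "g \<in> incls C b c" "h \<in> hom C a b" "f = h \<cdot> g"
  shows "h \<in> incls C a b"
proof -
  have "f \<in> Incl C" "g \<in> Incl C" "h \<in> Arr C" "Cod C h = Dom C g"
    using assms by (auto simp: incls_def hom_def)
  then have "h \<in> Incl C" using subobjects assms(4) unfolding category_with_subobjects_def by blast
  then show ?thesis using assms(3) by (simp add: incls_def hom_def)
qed

lemma incl_splits:
  assumes j: "j \<in> incls C a b"
  obtains q where "q \<in> split_epis C b a" "j \<cdot> q = Ide C a"
proof -
  have "j \<in> Incl C" using j by (simp add: incls_def)
  then obtain q where "splits_via C j q" using normal unfolding normal_category_def by blast
  then have "q \<in> hom C b a" "j \<cdot> q = Ide C a"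
    using j by (auto simp: splits_via_def incls_def)
  then show ?thesis using that split_episI incl_hom[OF j] by metis
qed

lemma ide_split_epi: "a \<in> Obj C \<Longrightarrow> Ide C a \<in> split_epis C a a"
  using split_episI[OF ide_in_hom[OF cat] ide_in_hom[OF cat]] ide_cmp[OF cat ide_in_hom[OF cat]] by metis

lemma iso_split_epi:
  assumes "isomorphism C f" "f \<in> hom C a b"
  shows "f \<in> split_epis C a b"
proof -
  obtain g where "g \<in> hom C b a" "g \<cdot> f = Ide C b"
    using isomorphismE[OF assms] by metis
  then show ?thesis using split_episI[OF assms(2)] by metis
qed

lemma split_epi_cmp:
  assumes "f \<in> split_epis C a b" "g \<in> split_epis C b c"
  shows "f \<cdot> g \<in> split_epis C a c"
proof -
  obtain s where f: "f \<in> hom C a b" and s: "s \<in> hom C b a" and sf: "s \<cdot> f = Ide C b"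
    using assms(1) by (rule split_episE)
  obtain t where g: "g \<in> hom C b c" and t: "t \<in> hom C c b" and tg: "t \<cdot> g = Ide C c"
    using assms(2) by (rule split_episE)
  have "(t \<cdot> s) \<cdot> (f \<cdot> g) = t \<cdot> ((s \<cdot> f) \<cdot> g)"
    using cmp_assoc[OF cat t s cmp_in_hom[OF cat f g]] cmp_assoc[OF cat s f g] by simp
  also have "\<dots> = Ide C c" using sf tg ide_cmp[OF cat g] by simp
  finally show ?thesis
    using split_episI[OF cmp_in_hom[OF cat f g] cmp_in_hom[OF cat t s]] by simp
qed

lemma normal_factorisationE:
  assumes "normal_factorisation C f q u j" "f \<in> hom C a b"
  obtains x w i v where "q \<in> hom C a x" "i \<in> incls C x a" "i \<cdot> q = Ide C x"
    "u \<in> hom C x w" "v \<in> hom C w x" "u \<cdot> v = Ide C x" "v \<cdot> u = Ide C w"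
    "j \<in> incls C w b" "f = (q \<cdot> u) \<cdot> j"
proof -
  obtain i where i: "splits_via C i q"
    using assms(1) by (auto simp: normal_factorisation_def retraction_def)
  let ?x = "Cod C q" and ?w = "Cod C u"
  have u: "u \<in> hom C ?x ?w" and u_iso: "isomorphism C u"
    using assms(1) by (auto simp: normal_factorisation_def hom_def isomorphism_def)
  obtain v where v: "v \<in> hom C ?w ?x" "u \<cdot> v = Ide C ?x" "v \<cdot> u = Ide C ?w"
    by (rule isomorphismE[OF u_iso u])
  have q: "q \<in> hom C (Dom C q) ?x" and i': "i \<in> incls C ?x (Dom C q)" "i \<cdot> q = Ide C ?x"
    using i by (auto simp: splits_via_def hom_def incls_def)
  have j: "j \<in> incls C ?w (Cod C j)" and f: "f = (q \<cdot> u) \<cdot> j"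
    using assms(1) by (auto simp: normal_factorisation_def incls_def)
  have "f \<in> hom C (Dom C q) (Cod C j)"
    unfolding f by (rule cmp_in_hom[OF cat cmp_in_hom[OF cat q u] incl_hom[OF j]])
  then have "Dom C q = a" "Cod C j = b" using assms(2) by (auto simp: hom_def)
  then show ?thesis using that q i' u v j f by metis
qed

text \<open>With a section \<open>s\<close> of \<open>p\<close>, the morphism \<open>s p'\<close>
  followed by \<open>j'\<close> is \<open>j\<close>, so it is an inclusion from \<open>w\<close> to
  \<open>w'\<close>. By symmetry there is one back, antisymmetry identifies the middle objects, and
  \<open>j = j'\<close> is right cancellable.\<close>

lemma factorisation_unique:
  assumes p: "p \<in> split_epis C a w" and j: "j \<in> incls C w b"
    and p': "p' \<in> split_epis C a w'" and j': "j' \<in> incls C w' b" and eq: "p \<cdot> j = p' \<cdot> j'"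
  shows "p = p'"
proof -
  have incl: "\<exists>k. k \<in> incls C w w'"
    if p: "p \<in> split_epis C a w" and j: "j \<in> incls C w b"
      and p': "p' \<in> split_epis C a w'" and j': "j' \<in> incls C w' b" and eq: "p \<cdot> j = p' \<cdot> j'"
    for p w j p' w' j'
  proof -
    obtain s where ph: "p \<in> hom C a w" and s: "s \<in> hom C w a" and sp: "s \<cdot> p = Ide C w"
      using p by (rule split_episE)
    note p'h = split_epi_hom[OF p']
    have "(s \<cdot> p') \<cdot> j' = (s \<cdot> p) \<cdot> j"
      by (simp add: cmp_assoc[OF cat s p'h incl_hom[OF j']] cmp_assoc[OF cat s ph incl_hom[OF j]] eq)
    also have "\<dots> = j" by (simp add: sp ide_cmp[OF cat incl_hom[OF j]])
    finally have "s \<cdot> p' \<in> incls C w w'"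
      using incl_left_factor[OF j j' cmp_in_hom[OF cat s p'h]] by simp
    then show ?thesis by blast
  qed
  have "w = w'" using incl[OF assms] incl[OF p' j' p j eq[symmetric]] incl_antisym by blast
  then show ?thesis
    using incl_mono[OF j split_epi_hom[OF p]] split_epi_hom[OF p'] eq incl_unique[OF j] j' by metis
qed

lemma factorisation_exists:
  assumes f: "f \<in> hom C a b"
  obtains q u j w where "normal_factorisation C f q u j"
    "q \<cdot> u \<in> split_epis C a w" "j \<in> incls C w b" "f = (q \<cdot> u) \<cdot> j"
proof -
  obtain q u j where n: "normal_factorisation C f q u j"
    using normal homD(1)[OF f] unfolding normal_category_def by blast
  obtain x w i v where *: "q \<in> hom C a x" "i \<in> incls C x a" "i \<cdot> q = Ide C x"
    "u \<in> hom C x w" "v \<in> hom C w x" "u \<cdot> v = Ide C x" "v \<cdot> u = Ide C w"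
    "j \<in> incls C w b" "f = (q \<cdot> u) \<cdot> j"
    by (rule normal_factorisationE[OF n f])
  have "q \<cdot> u \<in> split_epis C a w"
    by (rule split_epi_cmp[OF split_episI[OF *(1) incl_hom[OF *(2)] *(3)] split_episI[OF *(4,5,7)]])
  with n * that show ?thesis by blast
qed

text \<open>This replaces the definite description by a computation. The factor \<open>q u\<close>
  of a normal factorisation is a split epimorphism, so it falls under
  \<open>factorisation_unique\<close>; any factorisation into a split epimorphism and an inclusion
  therefore computes the epi part.\<close>

lemma epi_part_eq:
  assumes p: "p \<in> split_epis C a w" and j: "j \<in> incls C w b"
  shows "epi_part C (p \<cdot> j) = p"
proof -
  have f: "p \<cdot> j \<in> hom C a b" by (rule cmp_in_hom[OF cat split_epi_hom[OF p] incl_hom[OF j]])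
  have unique: "q \<cdot> u = p" if n: "normal_factorisation C (p \<cdot> j) q u k" for q u k
  proof -
    obtain x w' i v where *: "q \<in> hom C a x" "i \<in> incls C x a" "i \<cdot> q = Ide C x"
      "u \<in> hom C x w'" "v \<in> hom C w' x" "u \<cdot> v = Ide C x" "v \<cdot> u = Ide C w'"
      "k \<in> incls C w' b" "p \<cdot> j = (q \<cdot> u) \<cdot> k"
      by (rule normal_factorisationE[OF n f])
    have "q \<cdot> u \<in> split_epis C a w'"
      by (rule split_epi_cmp[OF split_episI[OF *(1) incl_hom[OF *(2)] *(3)] split_episI[OF *(4,5,7)]])
    from factorisation_unique[OF p j this *(8,9)] show ?thesis by simp
  qed
  obtain q u k where n: "normal_factorisation C (p \<cdot> j) q u k"
    using factorisation_exists[OF f] by metis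
  show ?thesis unfolding epi_part_def
    using n unique by (intro the_equality) blast+
qed

lemma epi_part_factor:
  assumes "f \<in> hom C a b"
  obtains j where "epi_part C f \<in> split_epis C a (img C f)" "j \<in> incls C (img C f) b" "f = epi_part C f \<cdot> j"
proof -
  obtain q u j w where *: "q \<cdot> u \<in> split_epis C a w" "j \<in> incls C w b" "f = (q \<cdot> u) \<cdot> j"
    using factorisation_exists[OF assms] by metis
  have "epi_part C f = q \<cdot> u" using epi_part_eq[OF *(1,2)] *(3) by simp
  moreover from this have "img C f = w" using split_epi_hom[OF *(1)] by (simp add: img_def hom_def)
  ultimately show ?thesis using that * by metis
qed

lemma img_eq: "p \<in> split_epis C a w \<Longrightarrow> j \<in> incls C w b \<Longrightarrow> img C (p \<cdot> j) = w"
  using homD(3)[OF split_epi_hom[of p C a w]] by (simp add: img_def epi_part_eq)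

lemma epi_part_split_epi:
  assumes "p \<in> split_epis C a w"
  shows "epi_part C p = p"
proof -
  have "w \<in> Obj C" using hom_objs(2)[OF cat split_epi_hom[OF assms]] .
  from epi_part_eq[OF assms incl_ide[OF this]] show ?thesis
    by (simp add: cmp_ide[OF cat split_epi_hom[OF assms]])
qed

text \<open>A factorisation of \<open>f\<close> can be prolonged at both ends: \<open>p\<close> is
  absorbed by the epi part and \<open>j\<close> by the inclusion, while the middle object
  stays.\<close>

lemma img_cmp:
  assumes p: "p \<in> split_epis C a w" and f: "f \<in> hom C w b" and j: "j \<in> incls C b c"
  shows "img C ((p \<cdot> f) \<cdot> j) = img C f"
proof -
  obtain k where e: "epi_part C f \<in> split_epis C w (img C f)" and k: "k \<in> incls C (img C f) b"
    and fk: "f = epi_part C f \<cdot> k"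
    using epi_part_factor[OF f] by metis
  note ph = split_epi_hom[OF p] and eh = split_epi_hom[OF e] and kh = incl_hom[OF k] and jh = incl_hom[OF j]
  have "(p \<cdot> f) \<cdot> j = (p \<cdot> epi_part C f) \<cdot> (k \<cdot> j)"
    using cmp_assoc[OF cat cmp_in_hom[OF cat ph eh] kh jh] cmp_assoc[OF cat ph eh kh] fk by simp
  then show ?thesis
    using img_eq[OF split_epi_cmp[OF p e] incl_cmp[OF k j]] by simp
qed

section \<open>Extensions of cones and principal right ideals\<close>

lemma cone_extend:
  assumes g: "cone_at C z \<gamma>" and h: "h \<in> split_epis C z w"
  shows "cone_at C w (cone_extend C \<gamma> h)"
proof -
  note hh = split_epi_hom[OF h]
  obtain c where c: "c \<in> Obj C" and iso: "isomorphism C (\<gamma> c)" using cone_iso[OF g] by blast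
  have gc: "\<gamma> c \<in> hom C c z" using cone_hom[OF g c] .
  have gh: "\<gamma> c \<cdot> h \<in> split_epis C c w" by (rule split_epi_cmp[OF iso_split_epi[OF iso gc] h])
  \<comment> \<open>Only the existence of an invertible component is at stake. The split epimorphism
    \<open>\<gamma> c \<cdot> h\<close> factors as a retraction \<open>q\<close> followed by an
    isomorphism \<open>u\<close>; precomposing with the inclusion \<open>i\<close> split by
    \<open>q\<close> shows that the component at \<open>x\<close> is \<open>u\<close>.\<close>
  obtain q u j where n: "normal_factorisation C (\<gamma> c \<cdot> h) q u j"
    using factorisation_exists[OF split_epi_hom[OF gh]] by metis
  obtain x w' i v where *: "q \<in> hom C c x" "i \<in> incls C x c" "i \<cdot> q = Ide C x"
      "u \<in> hom C x w'" "v \<in> hom C w' x" "u \<cdot> v = Ide C x" "v \<cdot> u = Ide C w'"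
      "j \<in> incls C w' w" "\<gamma> c \<cdot> h = (q \<cdot> u) \<cdot> j"
    by (rule normal_factorisationE[OF n split_epi_hom[OF gh]])
  have "q \<cdot> u \<in> split_epis C c w'"
    by (rule split_epi_cmp[OF split_episI[OF *(1) incl_hom[OF *(2)] *(3)] split_episI[OF *(4,5,7)]])
  with epi_part_eq[OF this *(8)] *(9) epi_part_split_epi[OF gh] have qu: "\<gamma> c \<cdot> h = q \<cdot> u" by simp
  have w: "w' = w"
    using split_epi_hom[OF gh] qu cmp_in_hom[OF cat *(1,4)] by (simp add: hom_def)
  have x: "x \<in> Obj C" using hom_objs(2)[OF cat *(1)] .
  have "\<gamma> x \<cdot> h = (i \<cdot> \<gamma> c) \<cdot> h" using cone_incl[OF g x c *(2)] by simp
  also have "\<dots> = i \<cdot> (q \<cdot> u)" using cmp_assoc[OF cat incl_hom[OF *(2)] gc hh] qu by simp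
  also have "\<dots> = u"
    using cmp_assoc[OF cat incl_hom[OF *(2)] *(1,4)] *(3) ide_cmp[OF cat *(4)] by simp
  finally have u: "\<gamma> x \<cdot> h = u" .
  show ?thesis
  proof (rule cone_atI[where c = x])
    show "w \<in> Obj C" using hom_objs(2)[OF cat hh] .
    show "cone_extend C \<gamma> h \<in> extensional (Obj C)" by (simp add: cone_extend_def)
    show "cone_extend C \<gamma> h c \<in> hom C c w" if "c \<in> Obj C" for c
      using that cmp_in_hom[OF cat cone_hom[OF g that] hh] by (simp add: cone_extend_def)
    show "j \<cdot> cone_extend C \<gamma> h b = cone_extend C \<gamma> h a"
      if "a \<in> Obj C" "b \<in> Obj C" "j \<in> incls C a b" for a b j
      using that cmp_assoc[OF cat incl_hom[OF that(3)] cone_hom[OF g that(2)] hh] cone_incl[OF g that]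
      by (simp add: cone_extend_def)
    show "isomorphism C (cone_extend C \<gamma> h x)"
      using x u isomorphismI[OF *(4,5,6,7)] by (simp add: cone_extend_def)
  qed (rule x)
qed

lemma cone_extend_cmp:
  assumes "cone_at C z \<gamma>" "h \<in> hom C z w" "k \<in> hom C w y"
  shows "cone_extend C (cone_extend C \<gamma> h) k = cone_extend C \<gamma> (h \<cdot> k)"
  using cmp_assoc[OF cat cone_hom[OF assms(1)] assms(2,3)] by (auto simp: cone_extend_def)

lemma cone_extend_ide:
  assumes "cone_at C z \<gamma>"
  shows "cone_extend C \<gamma> (Ide C z) = \<gamma>"
  using cmp_ide[OF cat cone_hom[OF assms]] cone_ext[OF assms]
  by (auto simp: cone_extend_def extensional_def)

abbreviation \<open>cones \<equiv> cone_semigroup C\<close>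

lemma cones_carrier: "cone_at C z \<gamma> \<Longrightarrow> \<gamma> \<in> carrier cones"
  by (auto simp: cone_semigroup_def)

lemma cones_mult:
  assumes "cone_at C z \<gamma>"
  shows "\<gamma> \<star>\<^bsub>cones\<^esub> \<delta> = cone_extend C \<gamma> (epi_part C (\<delta> z))"
  using vertex_eq[OF assms] by (simp add: cone_semigroup_def)

text \<open>Evaluate idempotency at an object with invertible component and cancel it: the epi part
  of \<open>\<gamma> z\<close> is the identity. The remaining factor of \<open>\<gamma> z\<close> is
  an inclusion of \<open>z\<close> in itself, hence also the identity.\<close>

lemma cone_idempotent_iff:
  assumes g: "cone_at C z \<gamma>"
  shows "\<gamma> \<star>\<^bsub>cones\<^esub> \<gamma> = \<gamma> \<longleftrightarrow> \<gamma> z = Ide C z"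
proof
  have z: "z \<in> Obj C" using cone_vertex_obj[OF g] .
  note gz = cone_hom[OF g z]
  show "\<gamma> \<star>\<^bsub>cones\<^esub> \<gamma> = \<gamma>" if "\<gamma> z = Ide C z"
    using that epi_part_split_epi[OF ide_split_epi[OF z]] cone_extend_ide[OF g] cones_mult[OF g] by simp
  assume idem: "\<gamma> \<star>\<^bsub>cones\<^esub> \<gamma> = \<gamma>"
  let ?e = "epi_part C (\<gamma> z)"
  obtain c where c: "c \<in> Obj C" and iso: "isomorphism C (\<gamma> c)" using cone_iso[OF g] by blast
  note gc = cone_hom[OF g c]
  obtain v where v: "v \<in> hom C z c" "v \<cdot> \<gamma> c = Ide C z" using isomorphismE[OF iso gc] by metis
  obtain j where e: "?e \<in> split_epis C z (img C (\<gamma> z))" and j: "j \<in> incls C (img C (\<gamma> z)) z"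
    and ej: "\<gamma> z = ?e \<cdot> j" using epi_part_factor[OF gz] by metis
  have "\<gamma> c \<cdot> ?e = \<gamma> c" using idem c cones_mult[OF g, of \<gamma>] by (metis cone_extend_def restrict_apply')
  then have "(v \<cdot> \<gamma> c) \<cdot> ?e = v \<cdot> \<gamma> c"
    using cmp_assoc[OF cat v(1) gc split_epi_hom[OF e]] by simp
  then have e1: "?e = Ide C z" using v(2) ide_cmp[OF cat split_epi_hom[OF e]] by simp
  then have "img C (\<gamma> z) = z" using homD(3)[OF ide_in_hom[OF cat z]] by (simp add: img_def)
  then have "j = Ide C z" using incl_endo j by simp
  then show "\<gamma> z = Ide C z" using ej e1 ide_cmp[OF cat ide_in_hom[OF cat z]] by simp
qed

text \<open>Every split epimorphism \<open>h\<close> out of \<open>z\<close> occurs as the epi part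
  of a component at \<open>z\<close>: normality provides a cone with identity component at
  \<open>z\<close>, and extending it by \<open>h\<close> gives a cone whose component there is
  \<open>h\<close>. The generator itself corresponds to \<open>h\<close> being the identity.\<close>

lemma ideal_eq:
  assumes g: "cone_at C z \<gamma>"
  shows "principal_right_ideal cones \<gamma> = {cone_extend C \<gamma> h |h w. h \<in> split_epis C z w}"
proof (intro set_eqI iffI)
  have z: "z \<in> Obj C" using cone_vertex_obj[OF g] .
  fix \<delta>
  show "\<delta> \<in> {cone_extend C \<gamma> h |h w. h \<in> split_epis C z w}" if d: "\<delta> \<in> principal_right_ideal cones \<gamma>"
  proof (cases "\<delta> = \<gamma>")
    case True
    then show ?thesis using cone_extend_ide[OF g] ide_split_epi[OF z] by (metis (mono_tags, lifting) mem_Collect_eq)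
  next
    case False
    then obtain \<beta> where "\<beta> \<in> carrier cones" and eq: "\<delta> = \<gamma> \<star>\<^bsub>cones\<^esub> \<beta>"
      using d by (auto simp: principal_right_ideal_def)
    then obtain w where b: "cone_at C w \<beta>" by (auto simp: cone_semigroup_def)
    have "epi_part C (\<beta> z) \<in> split_epis C z (img C (\<beta> z))"
      using epi_part_factor[OF cone_hom[OF b z]] by metis
    then show ?thesis using eq cones_mult[OF g] by auto
  qed
  show "\<delta> \<in> principal_right_ideal cones \<gamma>" if d: "\<delta> \<in> {cone_extend C \<gamma> h |h w. h \<in> split_epis C z w}"
  proof -
    obtain h w where h: "h \<in> split_epis C z w" and eq: "\<delta> = cone_extend C \<gamma> h" using d by blast
    obtain \<mu> where m: "cone_at C z \<mu>" "\<mu> z = Ide C z" using normal z unfolding normal_category_def by blast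
    have "cone_extend C \<mu> h z = h"
      using m z ide_cmp[OF cat split_epi_hom[OF h]] by (simp add: cone_extend_def)
    then have "\<delta> = \<gamma> \<star>\<^bsub>cones\<^esub> cone_extend C \<mu> h"
      using cones_mult[OF g] epi_part_split_epi[OF h] eq by simp
    then show ?thesis
      using cones_carrier[OF cone_extend[OF m(1) h]] by (auto simp: principal_right_ideal_def)
  qed
qed

lemma ideal_self: "\<gamma> \<in> principal_right_ideal cones \<gamma>"
  by (simp add: principal_right_ideal_def)

lemma ideal_sub_iff:
  assumes g: "cone_at C z \<gamma>"
  shows "principal_right_ideal cones \<delta> \<subseteq> principal_right_ideal cones \<gamma> \<longleftrightarrow>
    (\<exists>h w. h \<in> split_epis C z w \<and> \<delta> = cone_extend C \<gamma> h)"
proof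
  show "\<exists>h w. h \<in> split_epis C z w \<and> \<delta> = cone_extend C \<gamma> h"
    if "principal_right_ideal cones \<delta> \<subseteq> principal_right_ideal cones \<gamma>"
    using that ideal_self[of \<delta>] ideal_eq[OF g] by blast
  assume "\<exists>h w. h \<in> split_epis C z w \<and> \<delta> = cone_extend C \<gamma> h"
  then obtain h w where h: "h \<in> split_epis C z w" and d: "\<delta> = cone_extend C \<gamma> h" by blast
  have "\<exists>k' w'. k' \<in> split_epis C z w' \<and> cone_extend C \<delta> k = cone_extend C \<gamma> k'"
    if k: "k \<in> split_epis C w y" for k y
    using cone_extend_cmp[OF g split_epi_hom[OF h] split_epi_hom[OF k]] d split_epi_cmp[OF h k] by blast
  then show "principal_right_ideal cones \<delta> \<subseteq> principal_right_ideal cones \<gamma>"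
    unfolding ideal_eq[OF g] ideal_eq[OF cone_extend[OF g h], folded d] by blast
qed

text \<open>A containment in one direction suffices: if \<delta> is \<gamma> extended by
  \<open>h\<close>, the component at \<open>z\<close> gives \<open>h = \<delta> z\<close>, which is
  the identity.\<close>

lemma idempotent_cones_R:
  assumes g: "cone_at C z \<gamma>" "\<gamma> z = Ide C z" and d: "cone_at C z \<delta>" "\<delta> z = Ide C z"
    and sub: "principal_right_ideal cones \<delta> \<subseteq> principal_right_ideal cones \<gamma>"
  shows "\<delta> = \<gamma>"
proof -
  obtain h w where h: "h \<in> split_epis C z w" and dh: "\<delta> = cone_extend C \<gamma> h"
    using ideal_sub_iff[OF g(1)] sub by blast
  have "\<delta> z = h"
    using dh g(2) cone_vertex_obj[OF g(1)] ide_cmp[OF cat split_epi_hom[OF h]] by (simp add: cone_extend_def)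
  then show ?thesis using d(2) dh cone_extend_ide[OF g(1)] by simp
qed

end

section \<open>Classes of Green's relation R in a semigroup\<close>

lemma equiv_green_R: "equiv (carrier S) (green_R S)"
  by (auto simp: equiv_def refl_on_def sym_def trans_def green_R_def)

lemma green_class:
  assumes "X \<in> R_classes S" "a \<in> X"
  shows "X = green_R S `` {a}" "a \<in> carrier S"
  using assms equiv_green_R[of S]
  by (metis R_classes_def Image_singleton_iff equiv_class_eq_iff quotientE)+

lemma green_class_self: "a \<in> carrier S \<Longrightarrow> a \<in> green_R S `` {a}"
  by (simp add: green_R_def)

lemma green_class_in: "a \<in> carrier S \<Longrightarrow> green_R S `` {a} \<in> R_classes S"
  by (simp add: R_classes_def quotientI)

lemma green_class_eq_iff:
  assumes "a \<in> carrier S" "b \<in> carrier S"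
  shows "green_R S `` {a} = green_R S `` {b} \<longleftrightarrow> principal_right_ideal S a = principal_right_ideal S b"
  using assms by (auto simp: green_R_def)

lemma green_class_le_iff:
  assumes "a \<in> carrier S" "b \<in> carrier S"
  shows "R_class_le S (green_R S `` {a}) (green_R S `` {b}) \<longleftrightarrow>
    principal_right_ideal S a \<subseteq> principal_right_ideal S b"
  using assms by (auto simp: R_class_le_def green_R_def)

section \<open>The band of a supported category\<close>

definition sup_class :: "('o, 'm, 'x) conn_cat_scheme \<Rightarrow> 'o \<Rightarrow> ('o \<Rightarrow> 'm) set" where
  "sup_class C c = (THE d. d \<in> DSet C \<and> connected_to C c d)"

definition sup_cone :: "('o, 'm, 'x) conn_cat_scheme \<Rightarrow> 'o \<Rightarrow> 'o \<Rightarrow> 'm" where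
  "sup_cone C c = eps C c (sup_class C c)"

definition band_of :: "('o, 'm, 'x) conn_cat_scheme \<Rightarrow> 'o sgrp" where
  "band_of C = \<lparr>carrier = Obj C, mult = (\<lambda>a b. img C (sup_cone C b a))\<rparr>"

lemma carrier_band_of [simp]: "carrier (band_of C) = Obj C"
  by (simp add: band_of_def)

text \<open>Members of one class generate the same right ideal, so \<open>idempotent_cones_R\<close>
  settles uniqueness for the description behind \<open>eps\<close>.\<close>

lemma (in normal_cat) eps_eq:
  assumes "d \<in> R_classes cones" "idempotent_cone_in C c d \<gamma>"
  shows "eps C c d = \<gamma>"
  unfolding eps_def
proof (rule the_equality)
  show "idempotent_cone_in C c d \<gamma>" by (rule assms)
  fix \<delta> assume d: "idempotent_cone_in C c d \<delta>"
  have "cone_at C c \<gamma>" "\<gamma> c = Ide C c" "cone_at C c \<delta>" "\<delta> c = Ide C c"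
    using assms(2) d cone_idempotent_iff by (auto simp: idempotent_cone_in_def)
  moreover have "principal_right_ideal cones \<delta> = principal_right_ideal cones \<gamma>"
    using assms d green_class[OF assms(1), of \<gamma>] by (auto simp: idempotent_cone_in_def green_R_def)
  ultimately show "\<delta> = \<gamma>" using idempotent_cones_R by simp
qed

lemma connected_to_obj: "connected_to C c d \<Longrightarrow> c \<in> Obj C"
  using cone_vertex_obj by (auto simp: connected_to_def idempotent_cone_in_def)

locale supported_cat =
  fixes C :: "('o, 'm, 'x) conn_cat_scheme" (structure)
  assumes supp: "supported_category C"

sublocale supported_cat \<subseteq> normal_cat C
  by standard (use supp in \<open>simp add: supported_category_def connected_category_def\<close>)

context supported_cat
begin

lemma DSet_R: "d \<in> DSet C \<Longrightarrow> d \<in> R_classes cones"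
  using supp by (auto simp: supported_category_def connected_category_def)

lemma DSet_down: "d \<in> DSet C \<Longrightarrow> d' \<in> R_classes cones \<Longrightarrow> R_class_le cones d' d \<Longrightarrow> d' \<in> DSet C"
  using supp by (auto simp: supported_category_def connected_category_def)

lemma sup_class:
  assumes "c \<in> Obj C"
  shows "sup_class C c \<in> DSet C" "connected_to C c (sup_class C c)"
proof -
  have "\<exists>!d. d \<in> DSet C \<and> connected_to C c d"
    using supp assms by (simp add: supported_category_def)
  from theI'[OF this] show "sup_class C c \<in> DSet C" "connected_to C c (sup_class C c)"
    by (simp_all add: sup_class_def)
qed

lemma sup_class_eq:
  assumes "d \<in> DSet C" "connected_to C c d"
  shows "sup_class C c = d"
proof -
  have "c \<in> Obj C" using connected_to_obj assms(2) .
  then have "\<exists>!d. d \<in> DSet C \<and> connected_to C c d"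
    using supp by (simp add: supported_category_def)
  then show ?thesis using assms unfolding sup_class_def by (simp add: the1_equality)
qed

lemma sup_cone:
  assumes c: "c \<in> Obj C"
  shows "cone_at C c (sup_cone C c)" "sup_cone C c c = Ide C c" "sup_cone C c \<in> sup_class C c"
proof -
  obtain \<gamma> where g: "idempotent_cone_in C c (sup_class C c) \<gamma>"
    using sup_class(2)[OF c] by (auto simp: connected_to_def)
  then have "sup_cone C c = \<gamma>"
    unfolding sup_cone_def using eps_eq[OF DSet_R[OF sup_class(1)[OF c]]] by simp
  then show "cone_at C c (sup_cone C c)" "sup_cone C c c = Ide C c" "sup_cone C c \<in> sup_class C c"
    using g cone_idempotent_iff by (auto simp: idempotent_cone_in_def)
qed

lemma sup_class_green:
  assumes "c \<in> Obj C"
  shows "sup_class C c = green_R cones `` {sup_cone C c}"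
  by (rule green_class(1)[OF DSet_R[OF sup_class(1)] sup_cone(3)]) (rule assms)+

lemma sup_cone_eq:
  assumes "d \<in> DSet C" "\<gamma> \<in> d" "cone_at C z \<gamma>" "\<gamma> z = Ide C z"
  shows "sup_cone C z = \<gamma>" "sup_class C z = d"
proof -
  have i: "idempotent_cone_in C z d \<gamma>"
    using assms cone_idempotent_iff by (simp add: idempotent_cone_in_def)
  then show "sup_class C z = d" using sup_class_eq assms(1) by (auto simp: connected_to_def)
  then show "sup_cone C z = \<gamma>" using eps_eq[OF DSet_R[OF assms(1)] i] by (simp add: sup_cone_def)
qed

text \<open>Here support and the down-set work together. The extended cone lies in the right ideal
  of \<open>sup_cone C c\<close>, so its class belongs to \<open>DSet\<close>; the hypothesis
  \<open>eq\<close> makes it idempotent, and \<open>b\<close> has only one supporting class.\<close>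

lemma sup_cone_extend:
  assumes c: "c \<in> Obj C" and p: "p \<in> split_epis C c b" and eq: "sup_cone C c b \<cdot> p = Ide C b"
  shows "cone_extend C (sup_cone C c) p = sup_cone C b"
proof -
  note e = sup_cone(1)[OF c]
  let ?g = "cone_extend C (sup_cone C c) p"
  have b: "b \<in> Obj C" using hom_objs(2)[OF cat split_epi_hom[OF p]] .
  have g: "cone_at C b ?g" by (rule cone_extend[OF e p])
  note car = cones_carrier[OF g] cones_carrier[OF e]
  have "principal_right_ideal cones ?g \<subseteq> principal_right_ideal cones (sup_cone C c)"
    using ideal_sub_iff[OF e] p by blast
  then have "R_class_le cones (green_R cones `` {?g}) (sup_class C c)"
    using green_class_le_iff[OF car] sup_class_green[OF c] by simp
  then have "green_R cones `` {?g} \<in> DSet C"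
    using DSet_down[OF sup_class(1)[OF c] green_class_in[OF car(1)]] by simp
  moreover have "?g b = Ide C b" using eq b by (simp add: cone_extend_def)
  ultimately show ?thesis using sup_cone_eq(1)[OF _ green_class_self[OF car(1)] g] by simp
qed

lemma sup_cone_hom: "a \<in> Obj C \<Longrightarrow> b \<in> Obj C \<Longrightarrow> sup_cone C b a \<in> hom C a b"
  using cone_hom[OF sup_cone(1)] .

text \<open>The cone condition for \<open>j\<close>, combined with the identity component at
  \<open>b\<close>.\<close>

lemma sup_cone_incl: "j \<in> incls C a b \<Longrightarrow> sup_cone C b a = j"
  using hom_objs[OF cat incl_hom[of j a b]] cone_incl[OF sup_cone(1)] sup_cone(2) cmp_ide[OF cat incl_hom[of j a b]]
  by metis

abbreviation \<open>band \<equiv> band_of C\<close>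

lemma band_mult: "a \<star>\<^bsub>band\<^esub> b = img C (sup_cone C b a)"
  by (simp add: band_of_def)

lemma band_closed:
  assumes "a \<in> Obj C" "b \<in> Obj C"
  shows "a \<star>\<^bsub>band\<^esub> b \<in> Obj C"
  using epi_part_factor[OF sup_cone_hom[OF assms]] hom_objs(1)[OF cat incl_hom] by (metis band_mult)

lemma sup_cone_factor:
  assumes "a \<in> Obj C" "b \<in> Obj C"
  obtains j where "epi_part C (sup_cone C b a) \<in> split_epis C a (a \<star>\<^bsub>band\<^esub> b)"
    "j \<in> incls C (a \<star>\<^bsub>band\<^esub> b) b" "sup_cone C b a = epi_part C (sup_cone C b a) \<cdot> j"
  using epi_part_factor[OF sup_cone_hom[OF assms]] by (metis band_mult)

text \<open>With \<open>\<epsilon>\<close> for the supported cones and \<open>\<epsilon>\<^sub>b(a) = q u j\<close> a normal factorisation, \<open>i q = 1\<close>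
  and \<open>j r = 1\<close>, both \<open>\<epsilon>\<^sub>a * q\<close> and \<open>\<epsilon>\<^sub>b * r u\<inverse>\<close> are idempotent cones with vertex \<open>x = Dom i\<close>
  below the supporting classes, hence both equal \<open>\<epsilon>\<^sub>x\<close>. So \<open>\<epsilon>\<^sub>a * q u\<close> is \<open>\<epsilon>\<^sub>b * r\<close>, which is
  idempotent.\<close>

lemma sup_cone_mult:
  assumes a: "a \<in> Obj C" and b: "b \<in> Obj C"
  shows "sup_cone C (a \<star>\<^bsub>band\<^esub> b) = cone_extend C (sup_cone C a) (epi_part C (sup_cone C b a))"
proof -
  let ?ea = "sup_cone C a" and ?eb = "sup_cone C b"
  note eba = sup_cone_hom[OF a b] and ebb = sup_cone_hom[OF b b]
  obtain q u j where n: "normal_factorisation C (?eb a) q u j"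
    using factorisation_exists[OF eba] by metis
  obtain x w i v where q: "q \<in> hom C a x" and i: "i \<in> incls C x a" and iq: "i \<cdot> q = Ide C x"
    and u: "u \<in> hom C x w" and v: "v \<in> hom C w x" and uv: "u \<cdot> v = Ide C x" and vu: "v \<cdot> u = Ide C w"
    and j: "j \<in> incls C w b" and eq: "?eb a = (q \<cdot> u) \<cdot> j"
    by (rule normal_factorisationE[OF n eba])
  note ih = incl_hom[OF i] and jh = incl_hom[OF j]
  have x: "x \<in> Obj C" and w: "w \<in> Obj C" using hom_objs[OF cat u] by auto
  obtain r where r: "r \<in> split_epis C b w" and jr: "j \<cdot> r = Ide C w" by (rule incl_splits[OF j])
  note rh = split_epi_hom[OF r]
  have q_epi: "q \<in> split_epis C a x" by (rule split_episI[OF q ih iq])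
  have u_epi: "u \<in> split_epis C x w" by (rule split_episI[OF u v vu])
  have v_epi: "v \<in> split_epis C w x" by (rule split_episI[OF v u uv])
  have epi: "epi_part C (?eb a) = q \<cdot> u"
    unfolding eq by (rule epi_part_eq[OF split_epi_cmp[OF q_epi u_epi] j])
  have ab: "a \<star>\<^bsub>band\<^esub> b = w"
    unfolding band_mult eq by (rule img_eq[OF split_epi_cmp[OF q_epi u_epi] j])
  have e1: "cone_extend C ?ea q = sup_cone C x"
    by (rule sup_cone_extend[OF a q_epi]) (simp add: sup_cone_incl[OF i] iq)
  have ebx: "?eb x = u \<cdot> j"
  proof -
    have "?eb x = i \<cdot> ?eb a" using cone_incl[OF sup_cone(1)[OF b] x a i] by simp
    also have "\<dots> = ((i \<cdot> q) \<cdot> u) \<cdot> j"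
      by (simp add: eq cmp_assoc[OF cat ih cmp_in_hom[OF cat q u] jh] cmp_assoc[OF cat ih q u])
    finally show ?thesis by (simp add: iq ide_cmp[OF cat u])
  qed
  have e2: "cone_extend C ?eb (r \<cdot> v) = sup_cone C x"
  proof (rule sup_cone_extend[OF b split_epi_cmp[OF r v_epi]])
    have "?eb x \<cdot> (r \<cdot> v) = (u \<cdot> (j \<cdot> r)) \<cdot> v"
      by (simp add: ebx cmp_assoc[OF cat cmp_in_hom[OF cat u jh] rh v, symmetric] cmp_assoc[OF cat u jh rh])
    then show "?eb x \<cdot> (r \<cdot> v) = Ide C x" by (simp add: jr cmp_ide[OF cat u] uv)
  qed
  have "cone_extend C ?ea (q \<cdot> u) = cone_extend C ?eb ((r \<cdot> v) \<cdot> u)"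
    using cone_extend_cmp[OF sup_cone(1)[OF a] q u] e1 e2
      cone_extend_cmp[OF sup_cone(1)[OF b] cmp_in_hom[OF cat rh v] u] by simp
  also have "(r \<cdot> v) \<cdot> u = r" by (simp add: cmp_assoc[OF cat rh v u] vu cmp_ide[OF cat rh])
  finally have "cone_extend C ?ea (q \<cdot> u) = cone_extend C ?eb r" .
  also have "\<dots> = sup_cone C w"
    by (rule sup_cone_extend[OF b r]) (simp add: sup_cone_incl[OF j] jr)
  finally show ?thesis by (simp add: epi ab)
qed

text \<open>The inclusion part of \<open>\<epsilon>\<^sub>b(a)\<close> starts at the product, and
  conversely an inclusion from \<open>a\<close> is its own component of
  \<open>\<epsilon>\<^sub>b\<close> and has image \<open>a\<close>. Antisymmetry of inclusions can
  thus be used in the band.\<close>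

lemma band_incl_iff:
  assumes "a \<in> Obj C" "b \<in> Obj C"
  shows "a \<star>\<^bsub>band\<^esub> b = a \<longleftrightarrow> incls C a b \<noteq> {}"
proof
  show "incls C a b \<noteq> {}" if "a \<star>\<^bsub>band\<^esub> b = a"
    using that sup_cone_factor[OF assms] by (metis empty_iff)
  assume "incls C a b \<noteq> {}"
  then obtain j where j: "j \<in> incls C a b" by blast
  have "sup_cone C b a = Ide C a \<cdot> j"
    using sup_cone_incl[OF j] ide_cmp[OF cat incl_hom[OF j]] by simp
  then show "a \<star>\<^bsub>band\<^esub> b = a"
    using img_eq[OF ide_split_epi[OF assms(1)] j] by (simp add: band_mult)
qed

text \<open>Both products are the image of \<open>j h\<close>, where \<open>j\<close> is the
  inclusion part of \<open>\<epsilon>\<^sub>b(a)\<close> and \<open>h\<close> the epi part of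
  \<open>\<epsilon>\<^sub>c(b)\<close>. By \<open>sup_cone_mult\<close> the cone of
  \<open>b c\<close> has component \<open>p j h\<close> at \<open>a\<close>, and by the cone
  condition \<open>\<epsilon>\<^sub>c\<close> has component \<open>j h k\<close> at
  \<open>a b\<close>; \<open>img_cmp\<close> removes \<open>p\<close> and \<open>k\<close>.\<close>

lemma band_assoc:
  assumes a: "a \<in> Obj C" and b: "b \<in> Obj C" and c: "c \<in> Obj C"
  shows "(a \<star>\<^bsub>band\<^esub> b) \<star>\<^bsub>band\<^esub> c = a \<star>\<^bsub>band\<^esub> (b \<star>\<^bsub>band\<^esub> c)"
proof -
  note ab = band_closed[OF a b] and bc = band_closed[OF b c]
  obtain j where p: "epi_part C (sup_cone C b a) \<in> split_epis C a (a \<star>\<^bsub>band\<^esub> b)"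
    and j: "j \<in> incls C (a \<star>\<^bsub>band\<^esub> b) b" and pj: "sup_cone C b a = epi_part C (sup_cone C b a) \<cdot> j"
    by (rule sup_cone_factor[OF a b])
  obtain k where h: "epi_part C (sup_cone C c b) \<in> split_epis C b (b \<star>\<^bsub>band\<^esub> c)"
    and k: "k \<in> incls C (b \<star>\<^bsub>band\<^esub> c) c" and hk: "sup_cone C c b = epi_part C (sup_cone C c b) \<cdot> k"
    by (rule sup_cone_factor[OF b c])
  let ?p = "epi_part C (sup_cone C b a)" and ?h = "epi_part C (sup_cone C c b)"
  note ph = split_epi_hom[OF p] and hh = split_epi_hom[OF h] and jh = incl_hom[OF j] and kh = incl_hom[OF k]
  have jh': "j \<cdot> ?h \<in> hom C (a \<star>\<^bsub>band\<^esub> b) (b \<star>\<^bsub>band\<^esub> c)" by (rule cmp_in_hom[OF cat jh hh])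
  have bco: "b \<star>\<^bsub>band\<^esub> c \<in> Obj C" by (rule bc)
  have "sup_cone C (b \<star>\<^bsub>band\<^esub> c) a = (?p \<cdot> j) \<cdot> ?h"
    using sup_cone_mult[OF b c] a pj by (simp add: cone_extend_def)
  also have "\<dots> = (?p \<cdot> (j \<cdot> ?h)) \<cdot> Ide C (b \<star>\<^bsub>band\<^esub> c)"
    using cmp_assoc[OF cat ph jh hh] cmp_ide[OF cat cmp_in_hom[OF cat ph jh']] by simp
  finally have "a \<star>\<^bsub>band\<^esub> (b \<star>\<^bsub>band\<^esub> c) = img C (j \<cdot> ?h)"
    using img_cmp[OF p jh' incl_ide[OF bco]] by (simp add: band_mult)
  also have "\<dots> = img C ((Ide C (a \<star>\<^bsub>band\<^esub> b) \<cdot> (j \<cdot> ?h)) \<cdot> k)"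
    using img_cmp[OF ide_split_epi[OF ab] jh' k] by simp
  also have "(Ide C (a \<star>\<^bsub>band\<^esub> b) \<cdot> (j \<cdot> ?h)) \<cdot> k = j \<cdot> sup_cone C c b"
    using ide_cmp[OF cat jh'] cmp_assoc[OF cat jh hh kh] hk by simp
  also have "\<dots> = sup_cone C c (a \<star>\<^bsub>band\<^esub> b)"
    using cone_incl[OF sup_cone(1)[OF c] ab b j] .
  finally show ?thesis by (simp add: band_mult)
qed

lemma band_rrb: "right_regular_band band"
  unfolding right_regular_band_def is_semigroup_def
proof (intro conjI ballI)
  show idem: "a \<star>\<^bsub>band\<^esub> a = a" if "a \<in> carrier band" for a
    using that band_incl_iff[of a a] incl_ide[of a] by auto
  fix a b assume "a \<in> carrier band" "b \<in> carrier band"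
  then have a: "a \<in> Obj C" and b: "b \<in> Obj C" by simp_all
  note ba = band_closed[OF b a]
  have "incls C (b \<star>\<^bsub>band\<^esub> a) a \<noteq> {}" using sup_cone_factor[OF b a] by (metis empty_iff)
  then have ba_a: "(b \<star>\<^bsub>band\<^esub> a) \<star>\<^bsub>band\<^esub> a = b \<star>\<^bsub>band\<^esub> a" using band_incl_iff[OF ba a] by simp
  let ?c = "b \<star>\<^bsub>band\<^esub> a"
  \<comment> \<open>A product is always a subobject of its right factor, so \<open>a c\<close> lies
    below \<open>c = b a\<close>. The equation \<open>c (a c) = c\<close> gives the reverse
    inclusion, and antisymmetry yields \<open>a b a = b a\<close>.\<close>
  have "?c \<star>\<^bsub>band\<^esub> (a \<star>\<^bsub>band\<^esub> ?c) = ?c"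
    using band_assoc[OF ba a ba] ba_a idem ba by simp
  then obtain k where k: "k \<in> incls C ?c (a \<star>\<^bsub>band\<^esub> ?c)"
    using band_incl_iff[OF ba band_closed[OF a ba]] by auto
  obtain j where "j \<in> incls C (a \<star>\<^bsub>band\<^esub> ?c) ?c" by (rule sup_cone_factor[OF a ba])
  with k have "a \<star>\<^bsub>band\<^esub> ?c = ?c" using incl_antisym by blast
  then show "(a \<star>\<^bsub>band\<^esub> b) \<star>\<^bsub>band\<^esub> a = ?c" using band_assoc[OF a b a] by simp
qed (simp_all add: band_closed band_assoc)

text \<open>When \<open>b a = a\<close>, the product formula exhibits
  \<open>\<epsilon>\<^sub>a\<close> as an extension of \<open>\<epsilon>\<^sub>b\<close>.\<close>

lemma sup_class_le:
  assumes a: "a \<in> Obj C" and b: "b \<in> Obj C" and ba: "b \<star>\<^bsub>band\<^esub> a = a"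
  shows "R_class_le cones (sup_class C a) (sup_class C b)"
proof -
  have "sup_cone C a = cone_extend C (sup_cone C b) (epi_part C (sup_cone C a b))"
    using sup_cone_mult[OF b a] ba by simp
  moreover obtain j where "epi_part C (sup_cone C a b) \<in> split_epis C b (b \<star>\<^bsub>band\<^esub> a)"
    by (rule sup_cone_factor[OF b a])
  ultimately have "principal_right_ideal cones (sup_cone C a) \<subseteq> principal_right_ideal cones (sup_cone C b)"
    using ideal_sub_iff[OF sup_cone(1)[OF b]] by blast
  then show ?thesis
    using sup_class_green a b green_class_le_iff cones_carrier[OF sup_cone(1)] by metis
qed

text \<open>The two equations say that \<open>a\<close> and \<open>b\<close> are R-related in the
  band. This is what makes \<open>class_map\<close> below independent of a chosen generator.\<close>

lemma sup_class_cong: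
  assumes a: "a \<in> Obj C" and b: "b \<in> Obj C" and ab: "a \<star>\<^bsub>band\<^esub> b = b" and ba: "b \<star>\<^bsub>band\<^esub> a = a"
  shows "sup_class C a = sup_class C b"
proof -
  note ca = cones_carrier[OF sup_cone(1)[OF a]] and cb = cones_carrier[OF sup_cone(1)[OF b]]
  have "R_class_le cones (sup_class C a) (sup_class C b)" "R_class_le cones (sup_class C b) (sup_class C a)"
    using sup_class_le[OF a b ba] sup_class_le[OF b a ab] by simp_all
  then show ?thesis
    unfolding sup_class_green[OF a] sup_class_green[OF b] green_class_le_iff[OF ca cb]
      green_class_le_iff[OF cb ca] green_class_eq_iff[OF ca cb] by (rule subset_antisym)
qed

end

section \<open>The categories of bands and of supported categories\<close>

lemma rrbD:
  assumes "right_regular_band B"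
  shows rrb_closed: "x \<in> carrier B \<Longrightarrow> y \<in> carrier B \<Longrightarrow> x \<star>\<^bsub>B\<^esub> y \<in> carrier B"
    and rrb_assoc: "x \<in> carrier B \<Longrightarrow> y \<in> carrier B \<Longrightarrow> z \<in> carrier B \<Longrightarrow>
      (x \<star>\<^bsub>B\<^esub> y) \<star>\<^bsub>B\<^esub> z = x \<star>\<^bsub>B\<^esub> (y \<star>\<^bsub>B\<^esub> z)"
    and rrb_idem: "x \<in> carrier B \<Longrightarrow> x \<star>\<^bsub>B\<^esub> x = x"
    and rrb_regular: "x \<in> carrier B \<Longrightarrow> y \<in> carrier B \<Longrightarrow> x \<star>\<^bsub>B\<^esub> (y \<star>\<^bsub>B\<^esub> x) = y \<star>\<^bsub>B\<^esub> x"
  using assms by (auto simp: right_regular_band_def is_semigroup_def)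

lemma RRB_simps [simp]:
  "Obj RRB = {S. right_regular_band S}"
  "Dom RRB (S, h, T) = S" "Cod RRB (S, h, T) = T"
  "Ide RRB S = (S, \<lambda>x \<in> carrier S. x, S)"
  "(S, h, T) \<cdot>\<^bsub>RRB\<^esub> (T', k, U) = (S, compose (carrier S) k h, U)"
  by (simp_all add: RRB_def)

lemma hom_RRB: "hom RRB S T =
  (if right_regular_band S \<and> right_regular_band T then {(S, h, T) |h. h \<in> sgrp_homs S T} else {})"
  by (auto simp: RRB_def hom_def)

lemma sgrp_homs_compose:
  "is_semigroup S \<Longrightarrow> h \<in> sgrp_homs S T \<Longrightarrow> k \<in> sgrp_homs T U \<Longrightarrow> compose (carrier S) k h \<in> sgrp_homs S U"
  by (auto simp: sgrp_homs_def compose_def is_semigroup_def PiE_iff)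

lemma sgrp_homs_ide: "is_semigroup S \<Longrightarrow> (\<lambda>x \<in> carrier S. x) \<in> sgrp_homs S S"
  by (auto simp: sgrp_homs_def is_semigroup_def)

lemma rrb_sgrp: "right_regular_band S \<Longrightarrow> is_semigroup S"
  by (simp add: right_regular_band_def)

lemma category_RRB: "category RRB"
proof (rule categoryI)
  fix f :: "'a sgrp \<times> ('a \<Rightarrow> 'a) \<times> 'a sgrp" assume "f \<in> Arr RRB"
  then show "Dom RRB f \<in> Obj RRB \<and> Cod RRB f \<in> Obj RRB" by (auto simp: RRB_def)
next
  fix S :: "'a sgrp" assume "S \<in> Obj RRB"
  then show "Ide RRB S \<in> hom RRB S S" by (simp add: hom_RRB sgrp_homs_ide rrb_sgrp)
next
  fix f g :: "'a sgrp \<times> ('a \<Rightarrow> 'a) \<times> 'a sgrp" and S T U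
  assume "f \<in> hom RRB S T" "g \<in> hom RRB T U"
  then show "f \<cdot>\<^bsub>RRB\<^esub> g \<in> hom RRB S U"
    by (auto simp: hom_RRB sgrp_homs_compose rrb_sgrp split: if_splits)
next
  fix f :: "'a sgrp \<times> ('a \<Rightarrow> 'a) \<times> 'a sgrp" and S T assume "f \<in> hom RRB S T"
  then obtain h where f: "f = (S, h, T)" and h: "h \<in> carrier S \<rightarrow>\<^sub>E carrier T"
    by (auto simp: hom_RRB sgrp_homs_def split: if_splits)
  show "Ide RRB S \<cdot>\<^bsub>RRB\<^esub> f = f"
    unfolding f using h by (auto simp: fun_eq_iff compose_def)
  show "f \<cdot>\<^bsub>RRB\<^esub> Ide RRB T = f"
    unfolding f using h by (auto simp: fun_eq_iff compose_def)
next
  fix f g k :: "'a sgrp \<times> ('a \<Rightarrow> 'a) \<times> 'a sgrp" and S T U V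
  assume "f \<in> hom RRB S T" "g \<in> hom RRB T U" "k \<in> hom RRB U V"
  then show "(f \<cdot>\<^bsub>RRB\<^esub> g) \<cdot>\<^bsub>RRB\<^esub> k = f \<cdot>\<^bsub>RRB\<^esub> (g \<cdot>\<^bsub>RRB\<^esub> k)"
    by (auto simp: hom_RRB sgrp_homs_def compose_def fun_eq_iff PiE_iff split: if_splits)
qed

section \<open>CC-morphisms and the categories \<open>CC\<close> and \<open>SC\<close>\<close>

lemma func_eqI:
  fixes F G :: "('o1, 'm1, 'o2, 'm2) func"
  shows "OMap F = OMap G \<Longrightarrow> AMap F = AMap G \<Longrightarrow> F = G"
  by (cases F, cases G) simp

lemma connected_categoryD:
  assumes "connected_category C"
  shows connected_normal: "normal_cat C" and connected_DSet: "DSet C \<subseteq> R_classes (cone_semigroup C)"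
  using assms by (simp_all add: connected_category_def normal_cat_def)

lemma eps_cone:
  assumes "connected_category C" "d \<in> DSet C" "connected_to C c d"
  shows "cone_at C c (eps C c d)"
proof -
  interpret normal_cat C using connected_normal[OF assms(1)] .
  obtain \<gamma> where g: "idempotent_cone_in C c d \<gamma>" using assms(3) by (auto simp: connected_to_def)
  then have "eps C c d = \<gamma>" using eps_eq connected_DSet[OF assms(1)] assms(2) by blast
  then show ?thesis using g by (simp add: idempotent_cone_in_def)
qed

lemma cc_morphismsI:
  assumes "is_functor C C' F" "OMap F \<in> extensional (Obj C)" "AMap F \<in> extensional (Arr C)"
    and "\<And>j a b. j \<in> incls C a b \<Longrightarrow> AMap F j \<in> incls C' (OMap F a) (OMap F b)"
    and "G \<in> DSet C \<rightarrow>\<^sub>E DSet C'"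
    and "\<And>d d'. d \<in> DSet C \<Longrightarrow> d' \<in> DSet C \<Longrightarrow> R_class_le (cone_semigroup C) d d' \<Longrightarrow>
      R_class_le (cone_semigroup C') (G d) (G d')"
    and "\<And>c d. d \<in> DSet C \<Longrightarrow> connected_to C c d \<Longrightarrow> connected_to C' (OMap F c) (G d)"
    and "\<And>c d c'. d \<in> DSet C \<Longrightarrow> connected_to C c d \<Longrightarrow> c' \<in> Obj C \<Longrightarrow>
      AMap F (eps C c d c') = eps C' (OMap F c) (G d) (OMap F c')"
  shows "(F, G) \<in> cc_morphisms C C'"
proof -
  have "AMap F j \<in> Incl C'" if "j \<in> Incl C" for j
    using assms(4)[of j "Dom C j" "Cod C j"] that by (auto simp: incls_def)
  with assms show ?thesis by (simp add: cc_morphisms_def)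
qed

lemma cc_morphismsD:
  assumes "(F, G) \<in> cc_morphisms C C'"
  shows cc_functor: "is_functor C C' F"
    and cc_OMap_ext: "OMap F \<in> extensional (Obj C)" and cc_AMap_ext: "AMap F \<in> extensional (Arr C)"
    and cc_DMap: "G \<in> DSet C \<rightarrow>\<^sub>E DSet C'"
    and cc_mono: "d \<in> DSet C \<Longrightarrow> d' \<in> DSet C \<Longrightarrow> R_class_le (cone_semigroup C) d d' \<Longrightarrow>
      R_class_le (cone_semigroup C') (G d) (G d')"
    and cc_connected: "d \<in> DSet C \<Longrightarrow> connected_to C c d \<Longrightarrow> connected_to C' (OMap F c) (G d)"
    and cc_eps: "d \<in> DSet C \<Longrightarrow> connected_to C c d \<Longrightarrow> c' \<in> Obj C \<Longrightarrow>
      AMap F (eps C c d c') = eps C' (OMap F c) (G d) (OMap F c')"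
  using assms connected_to_obj[of C c d] by (auto simp: cc_morphisms_def)

lemma cc_incl:
  assumes "(F, G) \<in> cc_morphisms C C'" "normal_cat C" "j \<in> incls C a b"
  shows "AMap F j \<in> incls C' (OMap F a) (OMap F b)"
proof -
  interpret normal_cat C by fact
  have "AMap F j \<in> Incl C'" using assms(1,3) by (auto simp: cc_morphisms_def incls_def)
  then show ?thesis
    using functor_hom[OF cc_functor[OF assms(1)] incl_hom[OF assms(3)]] by (auto simp: incls_def hom_def)
qed

lemma cc_id_morphism:
  assumes "connected_category C"
  shows "cc_id C \<in> cc_morphisms C C"
  unfolding cc_id_def
proof (rule cc_morphismsI)
  interpret normal_cat C using connected_normal[OF assms] .
  show "is_functor C C \<lparr>OMap = \<lambda>c \<in> Obj C. c, AMap = \<lambda>f \<in> Arr C. f\<rparr>"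
    by (rule is_functorI)
      (auto simp: cat hom_objs[OF cat] homD(1) homD(1)[OF cmp_in_hom[OF cat]] homD(1)[OF ide_in_hom[OF cat]])
  show "AMap \<lparr>OMap = \<lambda>c \<in> Obj C. c, AMap = \<lambda>f \<in> Arr C. f\<rparr> j
    \<in> incls C (OMap \<lparr>OMap = \<lambda>c \<in> Obj C. c, AMap = \<lambda>f \<in> Arr C. f\<rparr> a)
       (OMap \<lparr>OMap = \<lambda>c \<in> Obj C. c, AMap = \<lambda>f \<in> Arr C. f\<rparr> b)" if "j \<in> incls C a b" for j a b
    using that hom_objs[OF cat incl_hom[OF that]] homD(1)[OF incl_hom[OF that]] by simp
  show "AMap \<lparr>OMap = \<lambda>c \<in> Obj C. c, AMap = \<lambda>f \<in> Arr C. f\<rparr> (eps C c d c') =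
    eps C (OMap \<lparr>OMap = \<lambda>c \<in> Obj C. c, AMap = \<lambda>f \<in> Arr C. f\<rparr> c) ((\<lambda>d \<in> DSet C. d) d)
     (OMap \<lparr>OMap = \<lambda>c \<in> Obj C. c, AMap = \<lambda>f \<in> Arr C. f\<rparr> c')"
    if "d \<in> DSet C" "connected_to C c d" "c' \<in> Obj C" for c d c'
    using that connected_to_obj[OF that(2)] homD(1)[OF cone_hom[OF eps_cone[OF assms that(1,2)] that(3)]]
    by simp
qed (auto simp: connected_to_obj)

lemma cc_comp_morphism:
  assumes C: "connected_category C" and P: "(F, G) \<in> cc_morphisms C C'" and Q: "(F', G') \<in> cc_morphisms C' C''"
  shows "cc_comp C (F, G) (F', G') \<in> cc_morphisms C C''"
proof -
  let ?F = "\<lparr>OMap = compose (Obj C) (OMap F') (OMap F), AMap = compose (Arr C) (AMap F') (AMap F)\<rparr>"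
  let ?G = "compose (DSet C) G' G"
  note F = cc_functor[OF P] and F' = cc_functor[OF Q]
  interpret normal_cat C using connected_normal[OF C] .
  have C'n: "AMap F j \<in> incls C' (OMap F a) (OMap F b)" if "j \<in> incls C a b" for j a b
    using cc_incl[OF P normal_cat_axioms that] .
  have om: "OMap ?F a = OMap F' (OMap F a)" if "a \<in> Obj C" for a using that by (simp add: compose_def)
  have am: "AMap ?F f = AMap F' (AMap F f)" if "f \<in> hom C a b" for f a b
    using homD(1)[OF that] by (simp add: compose_def)
  have gm: "?G d = G' (G d)" "G d \<in> DSet C'" if "d \<in> DSet C" for d
    using that cc_DMap[OF P] by (auto simp: compose_def)
  have "(?F, ?G) \<in> cc_morphisms C C''"
  proof (rule cc_morphismsI)
    show "is_functor C C'' ?F"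
    proof (rule is_functorI)
      fix f g a b c assume f: "f \<in> hom C a b" and g: "g \<in> hom C b c"
      show "AMap ?F (f \<cdot>\<^bsub>C\<^esub> g) = AMap ?F f \<cdot>\<^bsub>C''\<^esub> AMap ?F g"
        using functor_cmp[OF F f g] functor_cmp[OF F' functor_hom[OF F f] functor_hom[OF F g]]
        unfolding am[OF cmp_in_hom[OF cat f g]] am[OF f] am[OF g] by simp
    next
      fix a assume a: "a \<in> Obj C"
      show "OMap ?F a \<in> Obj C''" unfolding om[OF a] using functor_obj[OF F'] functor_obj[OF F a] by simp
      show "AMap ?F (Ide C a) = Ide C'' (OMap ?F a)"
        unfolding om[OF a] am[OF ide_in_hom[OF cat a]] functor_ide[OF F a]
        using functor_ide[OF F' functor_obj[OF F a]] .
    next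
      fix f a b assume f: "f \<in> hom C a b"
      show "AMap ?F f \<in> hom C'' (OMap ?F a) (OMap ?F b)"
        unfolding om[OF hom_objs(1)[OF cat f]] om[OF hom_objs(2)[OF cat f]] am[OF f]
        using functor_hom[OF F' functor_hom[OF F f]] .
    qed (rule cat functor_cats[OF F'])+
    show "AMap ?F j \<in> incls C'' (OMap ?F a) (OMap ?F b)" if j: "j \<in> incls C a b" for j a b
    proof -
      have "AMap F' (AMap F j) \<in> Incl C''"
        using C'n[OF j] Q by (auto simp: cc_morphisms_def incls_def)
      then show ?thesis
        using functor_hom[OF F' functor_hom[OF F incl_hom[OF j]]]
        unfolding om[OF hom_objs(1)[OF cat incl_hom[OF j]]] om[OF hom_objs(2)[OF cat incl_hom[OF j]]]
          am[OF incl_hom[OF j]]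
        by (auto simp: incls_def hom_def)
    qed
    show "?G \<in> DSet C \<rightarrow>\<^sub>E DSet C''"
      using cc_DMap[OF P] cc_DMap[OF Q] by (auto simp: compose_def PiE_iff)
    fix d c assume d: "d \<in> DSet C" and con: "connected_to C c d"
    have c: "c \<in> Obj C" using connected_to_obj[OF con] .
    note con' = cc_connected[OF P d con]
    show "connected_to C'' (OMap ?F c) (?G d)"
      unfolding om[OF c] gm(1)[OF d] by (rule cc_connected[OF Q gm(2)[OF d] con'])
    show "AMap ?F (eps C c d c') = eps C'' (OMap ?F c) (?G d) (OMap ?F c')" if c': "c' \<in> Obj C" for c'
      unfolding om[OF c] om[OF c'] gm(1)[OF d] am[OF cone_hom[OF eps_cone[OF C d con] c']]
        cc_eps[OF P d con c'] cc_eps[OF Q gm(2)[OF d] con' functor_obj[OF F c']] ..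
  qed (use cc_mono[OF P] cc_mono[OF Q] gm in \<open>auto simp: compose_def\<close>)
  then show ?thesis by (simp add: cc_comp_def)
qed

lemma CC_simps [simp]:
  "Obj CC = {C. connected_category C}"
  "Dom CC (C, \<Phi>, C') = C" "Cod CC (C, \<Phi>, C') = C'"
  "Ide CC C = (C, cc_id C, C)"
  "(C, \<Phi>, C') \<cdot>\<^bsub>CC\<^esub> (C'', \<Psi>, C''') = (C, cc_comp C \<Phi> \<Psi>, C''')"
  by (simp_all add: CC_def)

lemma hom_CC: "hom CC C C' =
  (if connected_category C \<and> connected_category C' then {(C, \<Phi>, C') |\<Phi>. \<Phi> \<in> cc_morphisms C C'} else {})"
  by (auto simp: CC_def hom_def)

lemma category_CC: "category CC"
proof (rule categoryI)
  fix f :: "('a, 'a) conn_cat \<times> ('a, 'a, 'a, 'a) cc_map \<times> ('a, 'a) conn_cat" assume "f \<in> Arr CC"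
  then show "Dom CC f \<in> Obj CC \<and> Cod CC f \<in> Obj CC" by (auto simp: CC_def)
next
  fix C :: "('a, 'a) conn_cat" assume "C \<in> Obj CC"
  then show "Ide CC C \<in> hom CC C C" 
    using cc_id_morphism[of C] by (cases "cc_id C") (simp add: hom_CC)
next
  fix f g :: "('a, 'a) conn_cat \<times> ('a, 'a, 'a, 'a) cc_map \<times> ('a, 'a) conn_cat" and C C' C''
  assume "f \<in> hom CC C C'" "g \<in> hom CC C' C''"
  then obtain F G F' G' where "f = (C, (F, G), C')" "g = (C', (F', G'), C'')"
    "connected_category C" "connected_category C''"
    "(F, G) \<in> cc_morphisms C C'" "(F', G') \<in> cc_morphisms C' C''"
    by (auto simp: hom_CC split: if_splits)
  then show "f \<cdot>\<^bsub>CC\<^esub> g \<in> hom CC C C''"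
    using cc_comp_morphism[of C F G C' F' G' C''] by (auto simp: hom_CC simp del: split_paired_Ex)
next
  fix f :: "('a, 'a) conn_cat \<times> ('a, 'a, 'a, 'a) cc_map \<times> ('a, 'a) conn_cat" and C C'
  assume "f \<in> hom CC C C'"
  then obtain F G where f: "f = (C, (F, G), C')" and P: "(F, G) \<in> cc_morphisms C C'"
    by (auto simp: hom_CC split: if_splits)
  \<comment> \<open>Identities and composites are \<open>undefined\<close> off objects, arrows and
    classes. Extensionality of all three maps is what turns the unit laws into equations of
    functions.\<close>
  have ext: "OMap F \<in> extensional (Obj C)" "AMap F \<in> extensional (Arr C)" "G \<in> extensional (DSet C)"
    using cc_OMap_ext[OF P] cc_AMap_ext[OF P] cc_DMap[OF P] by (auto simp: PiE_iff)
  have im: "OMap F c \<in> Obj C'" if "c \<in> Obj C" for c using functor_obj[OF cc_functor[OF P] that] .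
  have im': "AMap F h \<in> Arr C'" if "h \<in> Arr C" for h
    using homD(1)[OF functor_hom[OF cc_functor[OF P] arr_in_hom[OF that]]] .
  have im'': "G d \<in> DSet C'" if "d \<in> DSet C" for d using cc_DMap[OF P] that by auto
  show "Ide CC C \<cdot>\<^bsub>CC\<^esub> f = f"
    unfolding f using ext
    by (auto simp: cc_comp_def cc_id_def compose_def fun_eq_iff extensional_def intro!: func_eqI)
  show "f \<cdot>\<^bsub>CC\<^esub> Ide CC C' = f"
    unfolding f using ext im im' im''
    by (auto simp: cc_comp_def cc_id_def compose_def fun_eq_iff extensional_def intro!: func_eqI)
next
  fix f g h :: "('a, 'a) conn_cat \<times> ('a, 'a, 'a, 'a) cc_map \<times> ('a, 'a) conn_cat" and A B C D
  assume "f \<in> hom CC A B" "g \<in> hom CC B C" "h \<in> hom CC C D"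
  then obtain F G F' G' F'' G'' where f: "f = (A, (F, G), B)" and P: "(F, G) \<in> cc_morphisms A B"
    and g: "g = (B, (F', G'), C)" and h: "h = (C, (F'', G''), D)"
    by (auto simp: hom_CC split: if_splits)
  have im: "OMap F c \<in> Obj B" if "c \<in> Obj A" for c using functor_obj[OF cc_functor[OF P] that] .
  have im': "AMap F h \<in> Arr B" if "h \<in> Arr A" for h
    using homD(1)[OF functor_hom[OF cc_functor[OF P] arr_in_hom[OF that]]] .
  have im'': "G d \<in> DSet B" if "d \<in> DSet A" for d using cc_DMap[OF P] that by auto
  show "(f \<cdot>\<^bsub>CC\<^esub> g) \<cdot>\<^bsub>CC\<^esub> h = f \<cdot>\<^bsub>CC\<^esub> (g \<cdot>\<^bsub>CC\<^esub> h)"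
    unfolding f g h using im im' im''
    by (auto simp: cc_comp_def compose_def fun_eq_iff intro!: func_eqI)
qed

lemma SC_simps [simp]:
  "Obj SC = {C. supported_category C}" "Cmp SC = Cmp CC" "Ide SC = Ide CC" "Dom SC = Dom CC" "Cod SC = Cod CC"
  by (simp_all add: SC_def)

lemma supported_connected: "supported_category C \<Longrightarrow> connected_category C"
  by (simp add: supported_category_def)

lemma hom_SC: "hom SC C C' =
  (if supported_category C \<and> supported_category C' then {(C, \<Phi>, C') |\<Phi>. \<Phi> \<in> cc_morphisms C C'} else {})"
  by (simp add: SC_def hom_full_subcat hom_CC supported_connected)

lemma category_SC: "category SC"
  unfolding SC_def by (rule category_full_subcat[OF category_CC]) (auto simp: supported_connected)

section \<open>The functor from supported categories to bands\<close>

definition band_functor ::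
  "(('u, 'u) conn_cat, ('u, 'u) conn_cat \<times> ('u, 'u, 'u, 'u) cc_map \<times> ('u, 'u) conn_cat,
    'u sgrp, 'u sgrp \<times> ('u \<Rightarrow> 'u) \<times> 'u sgrp) func" where
  "band_functor = \<lparr>OMap = band_of, AMap = (\<lambda>(C, (F, G), C'). (band_of C, OMap F, band_of C'))\<rparr>"

lemma supported_catI: "supported_category C \<Longrightarrow> supported_cat C"
  by (simp add: supported_cat_def)

text \<open>The object \<open>F c\<close> is connected to the image of the class supporting
  \<open>c\<close>, and in a supported target no other class of \<open>DSet\<close> is
  available.\<close>

lemma cc_sup_class:
  assumes P: "(F, G) \<in> cc_morphisms C C'" and C: "supported_category C" and C': "supported_category C'"
    and c: "c \<in> Obj C"
  shows "sup_class C' (OMap F c) = G (sup_class C c)"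
proof -
  interpret C: supported_cat C using supported_catI[OF C] .
  interpret C': supported_cat C' using supported_catI[OF C'] .
  have "G (sup_class C c) \<in> DSet C'" using cc_DMap[OF P] C.sup_class(1)[OF c] by auto
  then show ?thesis using C'.sup_class_eq cc_connected[OF P C.sup_class[OF c]] by blast
qed

lemma cc_sup_cone:
  assumes P: "(F, G) \<in> cc_morphisms C C'" and C: "supported_category C" and C': "supported_category C'"
    and a: "a \<in> Obj C" and c: "c \<in> Obj C"
  shows "AMap F (sup_cone C c a) = sup_cone C' (OMap F c) (OMap F a)"
proof -
  interpret C: supported_cat C using supported_catI[OF C] .
  show ?thesis using cc_eps[OF P C.sup_class[OF c] a] cc_sup_class[OF P C C' c] by (simp add: sup_cone_def)
qed

text \<open>An inclusion preserving functor also preserves split epimorphisms, so it carries the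
  factorisation of \<open>\<epsilon>\<^sub>b(a)\<close> to one of the corresponding component in the
  target. The middle objects of these factorisations are the two products.\<close>

lemma cc_band_hom:
  assumes P: "(F, G) \<in> cc_morphisms C C'" and C: "supported_category C" and C': "supported_category C'"
  shows "OMap F \<in> sgrp_homs (band_of C) (band_of C')"
proof -
  interpret C: supported_cat C using supported_catI[OF C] .
  interpret C': supported_cat C' using supported_catI[OF C'] .
  note F = cc_functor[OF P]
  have "OMap F (a \<star>\<^bsub>C.band\<^esub> b) = OMap F a \<star>\<^bsub>C'.band\<^esub> OMap F b" if a: "a \<in> Obj C" and b: "b \<in> Obj C" for a b
  proof -
    let ?p = "epi_part C (sup_cone C b a)"
    obtain j where p: "?p \<in> split_epis C a (a \<star>\<^bsub>C.band\<^esub> b)"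
      and j: "j \<in> incls C (a \<star>\<^bsub>C.band\<^esub> b) b" and pj: "sup_cone C b a = ?p \<cdot>\<^bsub>C\<^esub> j"
      by (rule C.sup_cone_factor[OF a b])
    obtain s where ph: "?p \<in> hom C a (a \<star>\<^bsub>C.band\<^esub> b)" and s: "s \<in> hom C (a \<star>\<^bsub>C.band\<^esub> b) a"
      and sp: "s \<cdot>\<^bsub>C\<^esub> ?p = Ide C (a \<star>\<^bsub>C.band\<^esub> b)"
      using p by (rule split_episE)
    have "AMap F s \<cdot>\<^bsub>C'\<^esub> AMap F ?p = Ide C' (OMap F (a \<star>\<^bsub>C.band\<^esub> b))"
      using functor_cmp[OF F s ph] sp functor_ide[OF F C.band_closed[OF a b]] by simp
    then have Fp: "AMap F ?p \<in> split_epis C' (OMap F a) (OMap F (a \<star>\<^bsub>C.band\<^esub> b))"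
      by (rule split_episI[OF functor_hom[OF F ph] functor_hom[OF F s]])
    have "sup_cone C' (OMap F b) (OMap F a) = AMap F ?p \<cdot>\<^bsub>C'\<^esub> AMap F j"
      using cc_sup_cone[OF P C C' a b] functor_cmp[OF F ph C.incl_hom[OF j]] pj by simp
    then show ?thesis
      using C'.img_eq[OF Fp cc_incl[OF P C.normal_cat_axioms j]] by (simp add: C'.band_mult)
  qed
  then show ?thesis
    using functor_obj[OF F] cc_OMap_ext[OF P] by (auto simp: sgrp_homs_def PiE_iff)
qed

lemma functor_band: "is_functor SC RRB band_functor"
proof (rule is_functorI)
  fix C :: "('a, 'a) conn_cat" assume "C \<in> Obj SC"
  then show "OMap band_functor C \<in> Obj RRB"
    using supported_cat.band_rrb[OF supported_catI] by (simp add: band_functor_def)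
  show "AMap band_functor (Ide SC C) = Ide RRB (OMap band_functor C)"
    by (simp add: band_functor_def cc_id_def)
next
  fix f g :: "('a, 'a) conn_cat \<times> ('a, 'a, 'a, 'a) cc_map \<times> ('a, 'a) conn_cat" and A B C
  assume f: "f \<in> hom SC A B"
  then show "AMap band_functor f \<in> hom RRB (OMap band_functor A) (OMap band_functor B)"
    using supported_cat.band_rrb[OF supported_catI] cc_band_hom
    by (auto simp: hom_SC hom_RRB band_functor_def split: if_splits)
  assume "g \<in> hom SC B C"
  with f show "AMap band_functor (f \<cdot>\<^bsub>SC\<^esub> g) = AMap band_functor f \<cdot>\<^bsub>RRB\<^esub> AMap band_functor g"
    by (auto simp: hom_SC band_functor_def cc_comp_def split: if_splits)
qed (rule category_SC category_RRB)+

section \<open>The category of right translations of a band\<close>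

text \<open>Any injection serves, since triples are only ever recovered through
  \<open>inv code3\<close>.\<close>

definition code3 :: "'u \<times> 'u \<times> 'u \<Rightarrow> 'u" where
  "code3 = (SOME f. inj f)"

text \<open>An infinite set is equipotent with its square; nesting a pairing function codes
  triples.\<close>

lemma inj_code3:
  assumes "infinite (UNIV :: 'u set)"
  shows "inj (code3 :: 'u \<times> 'u \<times> 'u \<Rightarrow> 'u)"
proof -
  obtain g :: "'u \<times> 'u \<Rightarrow> 'u" where "bij_betw g (UNIV \<times> UNIV) UNIV"
    using card_of_Times_same_infinite[OF assms] unfolding card_of_ordIso[symmetric] by blast
  then have g: "inj g" by (simp add: bij_betw_def)
  have "inj (\<lambda>(a, p). g (a, g p))"
    by (rule injI) (simp add: inj_eq[OF g] split_def prod_eq_iff)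
  then show ?thesis unfolding code3_def by (rule someI[where P = inj])
qed

text \<open>The component at \<open>a\<close> stands for right translation by \<open>c\<close> on
  \<open>Ba\<close>. Its middle entry is the value at the generator, which determines the map:
  \<open>x c = x (a c)\<close> for \<open>x\<close> in \<open>Ba\<close>.\<close>

definition trans_cone :: "'u sgrp \<Rightarrow> 'u \<Rightarrow> 'u \<Rightarrow> 'u" where
  "trans_cone B c = (\<lambda>a \<in> carrier B. code3 (a, a \<star>\<^bsub>B\<^esub> c, c))"

text \<open>The \<open>\<R>\<close>-class of the principal cone of \<open>a\<close>, written out because it is part of the category
  whose cone semigroup it belongs to.\<close>

definition trans_class :: "'u sgrp \<Rightarrow> 'u \<Rightarrow> ('u \<Rightarrow> 'u) set" where
  "trans_class B a = trans_cone B ` {b \<in> carrier B. a \<star>\<^bsub>B\<^esub> b = b \<and> b \<star>\<^bsub>B\<^esub> a = a}"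

text \<open>In a right regular band every principal left ideal \<open>Be\<close> has a unique generator, so that \<open>e\<close>
  stands for \<open>Be\<close>, and the code of \<open>(e, u, f)\<close> stands for the right translation
  \<open>Be \<rightarrow> Bf\<close>, \<open>x \<mapsto> xu\<close> with \<open>u \<in> eBf\<close>.\<close>

definition trans_cat :: "'u sgrp \<Rightarrow> ('u, 'u) conn_cat" where
  "trans_cat B = \<lparr>
     Obj = carrier B,
     Arr = {code3 (e, u, f) |e u f. e \<in> carrier B \<and> u \<in> carrier B \<and> f \<in> carrier B \<and>
       e \<star>\<^bsub>B\<^esub> u = u \<and> u \<star>\<^bsub>B\<^esub> f = u},
     Dom = (\<lambda>x. case inv code3 x of (e, u, f) \<Rightarrow> e),
     Cod = (\<lambda>x. case inv code3 x of (e, u, f) \<Rightarrow> f),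
     Ide = (\<lambda>e. code3 (e, e, e)),
     Cmp = (\<lambda>x y. case (inv code3 x, inv code3 y) of
       ((e, u, f), (e', u', f')) \<Rightarrow> code3 (e, u \<star>\<^bsub>B\<^esub> u', f')),
     Incl = {code3 (e, e, f) |e f. e \<in> carrier B \<and> f \<in> carrier B \<and> e \<star>\<^bsub>B\<^esub> f = e},
     DSet = trans_class B ` carrier B\<rparr>"

text \<open>The map is the identity, but source and target may differ as records: their
  multiplications are only shown to agree on the carrier. An identity arrow of \<open>RRB\<close>
  would therefore not do.\<close>

definition band_unit :: "'u sgrp \<Rightarrow> 'u sgrp \<times> ('u \<Rightarrow> 'u) \<times> 'u sgrp" where
  "band_unit B = (B, \<lambda>x \<in> carrier B. x, band_of (trans_cat B))"

locale rrb =
  fixes B :: "'u sgrp" (structure)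
  assumes rrb: "right_regular_band B" and inf: "infinite (UNIV :: 'u set)"
begin

abbreviation \<open>L \<equiv> trans_cat B\<close>
abbreviation \<open>S \<equiv> carrier B\<close>
abbreviation t :: "'u \<Rightarrow> 'u \<Rightarrow> 'u \<Rightarrow> 'u" where "t e u f \<equiv> code3 (e, u, f)"

lemmas closed = rrb_closed[OF rrb] and assoc = rrb_assoc[OF rrb] and idem = rrb_idem[OF rrb]
  and regular = rrb_regular[OF rrb]

lemma t_eq_iff: "t e u f = t e' u' f' \<longleftrightarrow> e = e' \<and> u = u' \<and> f = f'"
  using inj_eq[OF inj_code3[OF inf], of "(e, u, f)" "(e', u', f')"] by simp

lemma inv_t: "inv code3 (t e u f) = (e, u, f)"
  by (rule inv_f_f[OF inj_code3[OF inf]])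

lemma L_simps [simp]:
  "Obj L = S" "Dom L (t e u f) = e" "Cod L (t e u f) = f" "Ide L e = t e e e"
  "t e u f \<cdot>\<^bsub>L\<^esub> t e' u' f' = t e (u \<star> u') f'" "DSet L = trans_class B ` S"
  by (simp_all add: trans_cat_def inv_t)

lemma L_hom: "hom L e f = {t e u f |u. e \<in> S \<and> u \<in> S \<and> f \<in> S \<and> e \<star> u = u \<and> u \<star> f = u}"
  by (auto simp: hom_def trans_cat_def inv_t)

lemma L_homI: "e \<in> S \<Longrightarrow> u \<in> S \<Longrightarrow> f \<in> S \<Longrightarrow> e \<star> u = u \<Longrightarrow> u \<star> f = u \<Longrightarrow> t e u f \<in> hom L e f"
  by (auto simp: L_hom)

lemma L_homE:
  assumes "x \<in> hom L e f"
  obtains u where "x = t e u f" "e \<in> S" "u \<in> S" "f \<in> S" "e \<star> u = u" "u \<star> f = u"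
  using assms by (auto simp: L_hom)

lemma L_incls: "incls L e f = (if e \<in> S \<and> f \<in> S \<and> e \<star> f = e then {t e e f} else {})"
  by (auto simp: incls_def trans_cat_def inv_t)

lemma L_InclE:
  assumes "j \<in> Incl L"
  obtains e f where "j = t e e f" "e \<in> S" "f \<in> S" "e \<star> f = e" "j \<in> incls L e f"
proof -
  obtain e f where *: "j = t e e f" "e \<in> S" "f \<in> S" "e \<star> f = e"
    using assms by (auto simp: trans_cat_def)
  then have "j \<in> incls L e f" by (simp add: L_incls)
  with * that show ?thesis by blast
qed

lemma L_incls_hom: "j \<in> incls L e f \<Longrightarrow> j \<in> hom L e f"
  by (auto simp: L_incls L_hom idem split: if_splits)

lemma category_L: "category L"
proof (rule categoryI)
  fix x assume "x \<in> Arr L"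
  then show "Dom L x \<in> Obj L \<and> Cod L x \<in> Obj L"
    by (auto simp: trans_cat_def inv_t)
next
  fix e assume "e \<in> Obj L"
  then show "Ide L e \<in> hom L e e" by (simp add: L_homI idem)
next
  fix x y e f g assume "x \<in> hom L e f" "y \<in> hom L f g"
  then obtain u v where "x = t e u f" "y = t f v g" and
    *: "e \<in> S" "u \<in> S" "f \<in> S" "e \<star> u = u" "u \<star> f = u" "v \<in> S" "g \<in> S" "f \<star> v = v" "v \<star> g = v"
    by (elim L_homE) simp
  moreover have "e \<star> (u \<star> v) = u \<star> v" using assoc[of e u v] * by simp
  moreover have "(u \<star> v) \<star> g = u \<star> v" using assoc[of u v g] * by simp
  ultimately show "x \<cdot>\<^bsub>L\<^esub> y \<in> hom L e g" by (simp add: L_homI closed)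
next
  fix x y z e f g h assume "x \<in> hom L e f" "y \<in> hom L f g" "z \<in> hom L g h"
  then show "(x \<cdot>\<^bsub>L\<^esub> y) \<cdot>\<^bsub>L\<^esub> z = x \<cdot>\<^bsub>L\<^esub> (y \<cdot>\<^bsub>L\<^esub> z)"
    by (elim L_homE) (simp add: assoc)
qed (auto elim!: L_homE)

text \<open>The equation \<open>e f = e\<close> means that \<open>Be\<close> is contained in
  \<open>Bf\<close>. Right regularity enters here, to make the generator of a principal left ideal
  unique.\<close>

lemma leq_antisym:
  assumes "e \<in> S" "f \<in> S" "e \<star> f = e" "f \<star> e = f"
  shows "e = f"
  using regular[OF assms(1,2)] assms idem by simp

lemma leq_trans:
  assumes "e \<in> S" "f \<in> S" "g \<in> S" "e \<star> f = e" "f \<star> g = f"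
  shows "e \<star> g = e"
  using assoc[OF assms(1-3)] assms by simp

lemma subobjects_L: "category_with_subobjects L"
  unfolding category_with_subobjects_def
proof (intro conjI ballI impI)
  show "category L" by (rule category_L)
  show "Incl L \<subseteq> Arr L"
  proof
    fix j assume "j \<in> Incl L"
    then obtain e f where "j \<in> incls L e f" by (rule L_InclE)
    then show "j \<in> Arr L" using homD(1)[OF L_incls_hom] by simp
  qed
  show "strict_preorder (incl_cat L)" unfolding strict_preorder_def
  proof (intro conjI ballI allI impI)
    show "category (incl_cat L)"
    proof (rule categoryI)
      fix x assume "x \<in> Arr (incl_cat L)"
      then have "x \<in> Incl L" by simp
      then obtain e f where "x = t e e f" "e \<in> S" "f \<in> S" by (rule L_InclE)
      then show "Dom (incl_cat L) x \<in> Obj (incl_cat L) \<and> Cod (incl_cat L) x \<in> Obj (incl_cat L)"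
        by simp
    next
      fix x y z e f g h
      assume "x \<in> hom (incl_cat L) e f" "y \<in> hom (incl_cat L) f g" "z \<in> hom (incl_cat L) g h"
      then show "(x \<cdot>\<^bsub>incl_cat L\<^esub> y) \<cdot>\<^bsub>incl_cat L\<^esub> z = x \<cdot>\<^bsub>incl_cat L\<^esub> (y \<cdot>\<^bsub>incl_cat L\<^esub> z)"
        using cmp_assoc[OF category_L L_incls_hom L_incls_hom L_incls_hom, of x e f y g z h]
        by (simp add: hom_incl_cat)
    qed (auto simp: hom_incl_cat L_incls idem split: if_splits intro: leq_trans)
    fix x assume "isomorphism (incl_cat L) x"
    then obtain y where x: "x \<in> Incl L" and y: "y \<in> incls L (Cod L x) (Dom L x)"
      by (auto simp: isomorphism_def hom_incl_cat)
    from x obtain e f where ef: "x = t e e f" "e \<in> S" "f \<in> S" "e \<star> f = e" by (rule L_InclE)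
    have "y \<in> incls L f e" using y unfolding ef(1) by simp
    then have "f \<star> e = f" by (metis L_incls empty_iff)
    then have "e = f" by (rule leq_antisym[OF ef(2,3,4)])
    with ef(1,2) show "\<exists>a \<in> Obj (incl_cat L). x = Ide (incl_cat L) a"
      by auto
  next
    fix e f x y assume "x \<in> hom (incl_cat L) e f" "y \<in> hom (incl_cat L) e f"
    then show "x = y" by (simp add: hom_incl_cat L_incls split: if_splits)
  qed
  fix j assume "j \<in> Incl L"
  show "monomorphism L j"
  proof -
    obtain e f where jt: "j = t e e f" and j: "j \<in> incls L e f"
      using \<open>j \<in> Incl L\<close> by (rule L_InclE)
    show ?thesis unfolding monomorphism_def
    proof (intro conjI ballI impI)
      show "j \<in> Arr L" using homD[OF L_incls_hom[OF j]] by simp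
      fix x y assume "x \<in> Arr L" "y \<in> Arr L" and eq: "Cod L x = Dom L j \<and> Cod L y = Dom L j \<and> x \<cdot>\<^bsub>L\<^esub> j = y \<cdot>\<^bsub>L\<^esub> j"
      obtain d u e' where x: "x = t d u e'" "u \<star> e' = u" using arr_in_hom[OF \<open>x \<in> Arr L\<close>] by (rule L_homE)
      obtain d' v e'' where y: "y = t d' v e''" "v \<star> e'' = v" using arr_in_hom[OF \<open>y \<in> Arr L\<close>] by (rule L_homE)
      \<comment> \<open>Composing with \<open>j\<close> multiplies the parameters of
        \<open>x\<close> and \<open>y\<close> by \<open>e\<close>. They do not change, since both
        translations land in \<open>Be\<close>.\<close>
      have "e' = e" "e'' = e" using eq x y jt by simp_all
      with x y have "x = t d u e" "u \<star> e = u" "y = t d' v e" "v \<star> e = v" by simp_all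
      then show "x = y" using eq jt by (simp add: t_eq_iff)
    qed
  qed
next
  fix f g h assume "f \<in> Incl L" "g \<in> Incl L" and h: "h \<in> Arr L" and eq: "Cod L h = Dom L g \<and> f = h \<cdot>\<^bsub>L\<^esub> g"
  obtain e u k where hk: "h = t e u k" "e \<in> S" "k \<in> S" "u \<star> k = u"
    using arr_in_hom[OF h] by (rule L_homE)
  obtain a b where f: "f = t a a b"
    using \<open>f \<in> Incl L\<close> by (rule L_InclE)
  obtain k' c where "g = t k' k' c" using \<open>g \<in> Incl L\<close> by (rule L_InclE)
  then have g: "g = t k k c" using eq hk(1) by simp
  \<comment> \<open>Compare codes in \<open>f = h g\<close>: the sources give \<open>a = e\<close>,
    and the middle entries give \<open>a = u k\<close>, which is \<open>u\<close>.\<close>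
  have "u = e" using eq hk by (auto simp: f g t_eq_iff)
  then have "h \<in> incls L e k" using hk by (simp add: L_incls)
  then show "h \<in> Incl L" by (simp add: incls_def)
qed

text \<open>Right translation by \<open>e\<close> maps \<open>Bf\<close> onto \<open>Be\<close> and
  fixes \<open>Be\<close> pointwise; its parameter is the value \<open>f e\<close> at the
  generator.\<close>

lemma L_retraction:
  assumes "e \<in> S" "f \<in> S" "e \<star> f = e"
  shows "splits_via L (t e e f) (t f (f \<star> e) e)"
proof -
  have j: "t e e f \<in> incls L e f" using assms by (simp add: L_incls)
  have q: "t f (f \<star> e) e \<in> hom L f e"
    using assms assoc[of f f e] assoc[of f e e] by (intro L_homI) (simp_all add: closed idem)
  show ?thesis
    using j q assms regular[of e f] assoc[of e f e]
    by (auto simp: splits_via_def incls_def idem)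
qed

text \<open>The cone condition is associativity, and idempotency of \<open>c\<close> makes the
  component at \<open>c\<close> an identity. These are also the cones demanded by the last axiom of
  a normal category.\<close>

lemma trans_cone:
  assumes c: "c \<in> S"
  shows "cone_at L c (trans_cone B c)" "trans_cone B c c = Ide L c"
proof -
  show 1: "trans_cone B c c = Ide L c" using c by (simp add: trans_cone_def idem)
  show "cone_at L c (trans_cone B c)"
  proof (rule cone_atI[where c = c])
    show "trans_cone B c \<in> extensional (Obj L)" by (simp add: trans_cone_def)
    show "trans_cone B c a \<in> hom L a c" if "a \<in> Obj L" for a
      using that c assoc[of a a c] assoc[of a c c]
      by (auto simp: trans_cone_def closed idem intro!: L_homI)
    show "j \<cdot>\<^bsub>L\<^esub> trans_cone B c b = trans_cone B c a"
      if "a \<in> Obj L" "b \<in> Obj L" "j \<in> incls L a b" for a b j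
      using that c assoc[of a b c] by (auto simp: trans_cone_def L_incls split: if_splits)
    show "isomorphism L (trans_cone B c c)"
      unfolding 1 using c by (intro isomorphismI[of _ _ c c "Ide L c"]) (auto simp: idem intro: L_homI)
  qed (use c in simp_all)
qed

lemma normal_L: "normal_category L"
  unfolding normal_category_def
proof (intro conjI ballI)
  show "category_with_subobjects L" by (rule subobjects_L)
  show "\<exists>q. splits_via L j q" if j: "j \<in> Incl L" for j
  proof -
    obtain e f where "j = t e e f" "e \<in> S" "f \<in> S" "e \<star> f = e" using j by (rule L_InclE)
    then show ?thesis using L_retraction by blast
  qed
  show "\<exists>q u j. normal_factorisation L x q u j" if x: "x \<in> Arr L" for x
  proof -
    obtain e f where "x \<in> hom L e f" using arr_in_hom[OF x] by blast
    then obtain u where x: "x = t e u f" and e: "e \<in> S" and u: "u \<in> S" and f: "f \<in> S"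
      and eu: "e \<star> u = u" and uf: "u \<star> f = u" by (rule L_homE)
    \<comment> \<open>The element \<open>u e\<close> lies below \<open>e\<close> and is R-related to
      \<open>u\<close>. Hence \<open>Be\<close> retracts onto \<open>Bw\<close>, and translation by
      \<open>u\<close> is an isomorphism from \<open>Bw\<close> to \<open>Bu\<close> with inverse
      translation by \<open>w\<close>.\<close>
    let ?w = "u \<star> e"
    have w: "?w \<in> S" by (rule closed[OF u e])
    have we: "?w \<star> e = ?w" using assoc[OF u e e] idem[OF e] by simp
    have ew: "e \<star> ?w = ?w" using assoc[OF e u e] eu by simp
    have wu: "?w \<star> u = u" using assoc[OF u e u] eu idem[OF u] by simp
    have uw: "u \<star> ?w = ?w" using assoc[OF u u e] idem[OF u] by simp
    have r: "retraction L (t e ?w ?w)"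
      using L_retraction[OF w e we] ew by (auto simp: retraction_def)
    have "isomorphism L (t ?w u u)"
      by (rule isomorphismI[of _ _ ?w u "t u ?w ?w"])
        (use w u idem wu uw in \<open>auto intro!: L_homI\<close>)
    moreover have "t u u f \<in> Incl L" using u f uf by (auto simp: trans_cat_def)
    ultimately have "normal_factorisation L x (t e ?w ?w) (t ?w u u) (t u u f)"
      using r wu idem[OF u] by (simp add: normal_factorisation_def x)
    then show ?thesis by blast
  qed
  show "\<exists>\<mu>. cone_at L c \<mu> \<and> \<mu> c = Ide L c" if "c \<in> Obj L" for c
    using that trans_cone by auto
qed

sublocale normal_cat L
  by standard (rule normal_L)

text \<open>If a section has parameter \<open>w\<close>, then \<open>w v = f\<close>, so
  \<open>f v = f\<close>; regularity together with \<open>v f = v\<close> gives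
  \<open>f v = v\<close>. Thus the parameter can only be \<open>f\<close>. Conversely, translation
  by \<open>e\<close> provides a section.\<close>

lemma L_split_epis: "split_epis L e f = (if e \<in> S \<and> f \<in> S \<and> e \<star> f = f then {t e f f} else {})"
proof (intro set_eqI iffI)
  fix x assume "x \<in> split_epis L e f"
  then obtain s where x: "x \<in> hom L e f" and s: "s \<in> hom L f e" and sx: "s \<cdot>\<^bsub>L\<^esub> x = Ide L f"
    by (rule split_episE)
  obtain v where v: "x = t e v f" "e \<in> S" "v \<in> S" "f \<in> S" "e \<star> v = v" "v \<star> f = v"
    using x by (rule L_homE)
  obtain w where w: "s = t f w e" "w \<in> S" using s by (rule L_homE)
  have wv: "w \<star> v = f" using sx v w by (simp add: t_eq_iff)
  have "f \<star> v = f" using assoc[OF w(2) v(3,3)] wv idem[OF v(3)] by simp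
  then have "f = v" using regular[OF v(4,3)] v(6) by simp
  then show "x \<in> (if e \<in> S \<and> f \<in> S \<and> e \<star> f = f then {t e f f} else {})"
    using v by simp
next
  fix x assume "x \<in> (if e \<in> S \<and> f \<in> S \<and> e \<star> f = f then {t e f f} else {})"
  then have x: "x = t e f f" and e: "e \<in> S" and f: "f \<in> S" and ef: "e \<star> f = f"
    by (auto split: if_splits)
  show "x \<in> split_epis L e f"
  proof (rule split_episI)
    show "x \<in> hom L e f" unfolding x using e f ef idem[OF f] by (intro L_homI)
    show "t f (f \<star> e) e \<in> hom L f e"
      using e f assoc[of f f e] assoc[of f e e] by (intro L_homI) (simp_all add: closed idem)
    show "t f (f \<star> e) e \<cdot>\<^bsub>L\<^esub> x = Ide L f"
      using assoc[OF f e f] ef idem[OF f] by (simp add: x)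
  qed
qed

section \<open>Principal cones and the support they provide\<close>

lemma trans_cone_inj:
  assumes "a \<in> S" "trans_cone B a = trans_cone B b"
  shows "a = b"
  using assms(1) fun_cong[OF assms(2), of a] by (simp add: trans_cone_def t_eq_iff)

text \<open>Extending the principal cone of \<open>a\<close> by the split epimorphism with parameter
  \<open>z\<close> gives the principal cone of \<open>z\<close>, because \<open>x a z = x z\<close>.
  No other cones appear, which is why the classes of principal cones form a down-set.\<close>

lemma trans_cone_ideal:
  assumes a: "a \<in> S"
  shows "principal_right_ideal cones (trans_cone B a) = trans_cone B ` {z \<in> S. a \<star> z = z}"
proof -
  have ext: "cone_extend L (trans_cone B a) (t a z z) = trans_cone B z" if z: "z \<in> S" "a \<star> z = z" for z
    using assoc[OF _ a z(1)] z by (auto simp: cone_extend_def trans_cone_def)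
  show ?thesis
    unfolding ideal_eq[OF trans_cone(1)[OF a]]
  proof (intro set_eqI iffI)
    fix \<gamma> assume "\<gamma> \<in> {cone_extend L (trans_cone B a) h |h w. h \<in> split_epis L a w}"
    then obtain h w where h: "h \<in> split_epis L a w" and eq: "\<gamma> = cone_extend L (trans_cone B a) h" by blast
    have "w \<in> S" "a \<star> w = w" "h = t a w w" using h by (simp_all add: L_split_epis split: if_splits)
    then show "\<gamma> \<in> trans_cone B ` {z \<in> S. a \<star> z = z}" using ext eq by simp
  next
    fix \<gamma> assume "\<gamma> \<in> trans_cone B ` {z \<in> S. a \<star> z = z}"
    then obtain z where z: "z \<in> S" "a \<star> z = z" and eq: "\<gamma> = trans_cone B z" by blast
    have "t a z z \<in> split_epis L a z" using a z by (simp add: L_split_epis)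
    then show "\<gamma> \<in> {cone_extend L (trans_cone B a) h |h w. h \<in> split_epis L a w}"
      using ext[OF z] eq by (metis (mono_tags, lifting) mem_Collect_eq)
  qed
qed

lemma trans_ideal_sub:
  assumes a: "a \<in> S" and b: "b \<in> S"
  shows "principal_right_ideal cones (trans_cone B b) \<subseteq> principal_right_ideal cones (trans_cone B a)
    \<longleftrightarrow> a \<star> b = b"
proof
  assume "principal_right_ideal cones (trans_cone B b) \<subseteq> principal_right_ideal cones (trans_cone B a)"
  then have "trans_cone B b \<in> trans_cone B ` {z \<in> S. a \<star> z = z}"
    using ideal_self trans_cone_ideal[OF a] by blast
  then show "a \<star> b = b" using trans_cone_inj[OF b] by auto
next
  assume ab: "a \<star> b = b"
  have "a \<star> z = z" if "z \<in> S" "b \<star> z = z" for z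
    using assoc[OF a b that(1)] ab that by simp
  then show "principal_right_ideal cones (trans_cone B b) \<subseteq> principal_right_ideal cones (trans_cone B a)"
    unfolding trans_cone_ideal[OF a] trans_cone_ideal[OF b] by blast
qed

lemma trans_class_green:
  assumes a: "a \<in> S"
  shows "trans_class B a = green_R cones `` {trans_cone B a}"
proof (intro set_eqI iffI)
  fix \<gamma> assume "\<gamma> \<in> trans_class B a"
  then obtain b where b: "b \<in> S" "a \<star> b = b" "b \<star> a = a" "\<gamma> = trans_cone B b"
    by (auto simp: trans_class_def)
  then show "\<gamma> \<in> green_R cones `` {trans_cone B a}"
    using trans_ideal_sub[OF a b(1)] trans_ideal_sub[OF b(1) a] a cones_carrier[OF trans_cone(1)]
    by (auto simp: green_R_def)
next
  fix \<gamma> assume "\<gamma> \<in> green_R cones `` {trans_cone B a}"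
  then have eq: "principal_right_ideal cones (trans_cone B a) = principal_right_ideal cones \<gamma>"
    by (simp add: green_R_def)
  then obtain b where b: "b \<in> S" "a \<star> b = b" "\<gamma> = trans_cone B b"
    using ideal_self[of \<gamma>] trans_cone_ideal[OF a] by auto
  then have "b \<star> a = a" using eq trans_ideal_sub[OF b(1) a] by simp
  then show "\<gamma> \<in> trans_class B a" using b by (auto simp: trans_class_def)
qed

lemma trans_class_self: "a \<in> S \<Longrightarrow> trans_cone B a \<in> trans_class B a"
  by (simp add: trans_class_def idem)

lemma trans_class_eq:
  assumes a: "a \<in> S" and g: "trans_cone B c \<in> trans_class B a" "c \<in> S"
  shows "trans_class B a = trans_class B c"
proof -
  have "green_R cones `` {trans_cone B a} \<in> R_classes cones"
    by (rule green_class_in[OF cones_carrier[OF trans_cone(1)[OF a]]])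
  from green_class(1)[OF this] g show ?thesis by (simp add: trans_class_green a)
qed

lemma trans_class_le_iff:
  assumes "a \<in> S" "b \<in> S"
  shows "R_class_le cones (trans_class B b) (trans_class B a) \<longleftrightarrow> a \<star> b = b"
  using assms by (simp add: trans_class_green green_class_le_iff cones_carrier[OF trans_cone(1)] trans_ideal_sub)

lemma trans_idempotent:
  assumes c: "c \<in> S"
  shows "idempotent_cone_in L c (trans_class B c) (trans_cone B c)"
  using trans_cone[OF c] cone_idempotent_iff trans_class_self[OF c] by (simp add: idempotent_cone_in_def)

text \<open>All members of \<open>d\<close> are principal cones, and a principal cone is determined
  by its vertex. So \<open>c\<close> meets only the class of its own principal cone, which is the
  uniqueness required of a supported category.\<close>

lemma connected_L_iff:
  assumes "d \<in> DSet L"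
  shows "connected_to L c d \<longleftrightarrow> c \<in> S \<and> d = trans_class B c"
proof
  assume "connected_to L c d"
  then obtain \<gamma> where g: "\<gamma> \<in> d" "cone_at L c \<gamma>" by (auto simp: connected_to_def idempotent_cone_in_def)
  obtain a where a: "a \<in> S" "d = trans_class B a" using assms by auto
  then obtain b where b: "b \<in> S" "\<gamma> = trans_cone B b" using g(1) by (auto simp: trans_class_def)
  then have "b = c" using vertex_eq[OF g(2)] vertex_eq[OF trans_cone(1)[OF b(1)]] by simp
  then show "c \<in> S \<and> d = trans_class B c" using trans_class_eq a b g(1) by blast
qed (use trans_idempotent in \<open>auto simp: connected_to_def\<close>)

lemma supported_L: "supported_category L"
  unfolding supported_category_def connected_category_def
proof (intro conjI ballI impI)
  show "normal_category L" by (rule normal_L)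
  show "DSet L \<subseteq> R_classes cones"
    using green_class_in[OF cones_carrier[OF trans_cone(1)]] by (auto simp: trans_class_green)
  show "\<exists>d \<in> DSet L. connected_to L c d" if "c \<in> Obj L" for c
    using that connected_L_iff[of "trans_class B c" c] by auto
  show "\<exists>!d. d \<in> DSet L \<and> connected_to L c d" if "c \<in> Obj L" for c
    using that connected_L_iff by (intro ex1I[of _ "trans_class B c"]) auto
  fix d d' assume "d \<in> DSet L" and d': "d' \<in> R_classes cones" and le: "R_class_le cones d' d"
  then obtain a where a: "a \<in> S" "d = trans_class B a" by auto
  obtain \<gamma> where "\<gamma> \<in> d'" using le by (auto simp: R_class_le_def)
  then have g: "d' = green_R cones `` {\<gamma>}" "\<gamma> \<in> carrier cones" using green_class[OF d'] by auto
  then have "principal_right_ideal cones \<gamma> \<subseteq> principal_right_ideal cones (trans_cone B a)"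
    using le a green_class_le_iff[OF g(2) cones_carrier[OF trans_cone(1)[OF a(1)]]]
    by (simp add: trans_class_green)
  \<comment> \<open>A cone in the right ideal of a principal cone is principal, so the class under
    consideration has a band element as its index.\<close>
  then obtain b where "b \<in> S" "\<gamma> = trans_cone B b"
    using ideal_self[of \<gamma>] trans_cone_ideal[OF a(1)] by blast
  then show "d' \<in> DSet L" using g by (simp add: trans_class_green)
qed

sublocale supported_cat L
  by standard (rule supported_L)

lemma sup_L:
  assumes "c \<in> S"
  shows "sup_class L c = trans_class B c" "sup_cone L c = trans_cone B c"
  using sup_cone_eq[of "trans_class B c" "trans_cone B c" c] assms trans_cone trans_class_self by auto

text \<open>Translation by \<open>b\<close> maps \<open>Ba\<close> onto \<open>Bab\<close>, so the
  component factors through the object \<open>a b\<close>.\<close>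

lemma band_L:
  assumes a: "a \<in> S" and b: "b \<in> S"
  shows "a \<star>\<^bsub>band\<^esub> b = a \<star> b"
proof -
  note ab = closed[OF a b]
  have p: "t a (a \<star> b) (a \<star> b) \<in> split_epis L a (a \<star> b)"
    using a ab assoc[OF a a b] idem[OF a] by (simp add: L_split_epis)
  have j: "t (a \<star> b) (a \<star> b) b \<in> incls L (a \<star> b) b"
    using b ab assoc[OF a b b] idem[OF b] by (simp add: L_incls)
  have "sup_cone L b a = t a (a \<star> b) (a \<star> b) \<cdot>\<^bsub>L\<^esub> t (a \<star> b) (a \<star> b) b"
    using a idem[OF ab] by (simp add: sup_L(2)[OF b] trans_cone_def)
  then show ?thesis using img_eq[OF p j] by (simp add: band_mult)
qed

lemma unit_hom: "band_unit B \<in> hom RRB B (band_of L)"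
  using rrb band_rrb closed by (auto simp: band_unit_def hom_RRB sgrp_homs_def band_L)

lemma unit_iso: "isomorphism RRB (band_unit B)"
proof (rule isomorphismI[OF unit_hom])
  show "(band_of L, \<lambda>x \<in> S. x, B) \<in> hom RRB (band_of L) B"
    using rrb band_rrb closed by (auto simp: hom_RRB sgrp_homs_def band_L)
qed (auto simp: band_unit_def compose_def)

end

section \<open>The universal property\<close>

locale rrb_to_supported = B: rrb B + Y: supported_cat Y
  for B :: "'u sgrp" and Y :: "('u, 'u) conn_cat" +
  fixes \<phi> :: "'u \<Rightarrow> 'u"
  assumes phi: "\<phi> \<in> sgrp_homs B (band_of Y)"
begin

lemma phi_obj: "a \<in> B.S \<Longrightarrow> \<phi> a \<in> Obj Y"
  and phi_ext: "\<phi> \<in> extensional B.S"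
  and phi_mult: "a \<in> B.S \<Longrightarrow> b \<in> B.S \<Longrightarrow> \<phi> (a \<star>\<^bsub>B\<^esub> b) = \<phi> a \<star>\<^bsub>Y.band\<^esub> \<phi> b"
  using phi by (auto simp: sgrp_homs_def PiE_iff)

text \<open>Inclusions between given objects are unique; one exists as soon as
  \<open>u f = u\<close>, a condition built into the codes of arrows.\<close>

definition incl :: "'u \<Rightarrow> 'u \<Rightarrow> 'u" where
  "incl u f = (THE j. j \<in> incls Y (\<phi> u) (\<phi> f))"

lemma incl_eq: "j \<in> incls Y (\<phi> u) (\<phi> f) \<Longrightarrow> incl u f = j"
  unfolding incl_def using Y.incl_unique by blast

lemma incl:
  assumes "u \<in> B.S" "f \<in> B.S" "u \<star>\<^bsub>B\<^esub> f = u"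
  shows "incl u f \<in> incls Y (\<phi> u) (\<phi> f)"
proof -
  have "\<phi> u \<star>\<^bsub>Y.band\<^esub> \<phi> f = \<phi> u" using phi_mult[OF assms(1,2)] assms(3) by simp
  then obtain j where "j \<in> incls Y (\<phi> u) (\<phi> f)"
    using Y.band_incl_iff[OF phi_obj[OF assms(1)] phi_obj[OF assms(2)]] by blast
  then show ?thesis using incl_eq by simp
qed

definition arr_map :: "'u \<Rightarrow> 'u" where
  "arr_map = (\<lambda>x \<in> Arr B.L. case inv code3 x of (e, u, f) \<Rightarrow> sup_cone Y (\<phi> u) (\<phi> e) \<cdot>\<^bsub>Y\<^esub> incl u f)"

text \<open>A class has no distinguished generator, so one is chosen; \<open>class_map_eq\<close>
  shows independence of the choice.\<close>

definition class_map :: "('u \<Rightarrow> 'u) set \<Rightarrow> ('u \<Rightarrow> 'u) set" where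
  "class_map = (\<lambda>d \<in> DSet B.L. sup_class Y (\<phi> (SOME a. a \<in> B.S \<and> d = trans_class B a)))"

definition ext_func :: "('u, 'u, 'u, 'u) func" where
  "ext_func = \<lparr>OMap = \<phi>, AMap = arr_map\<rparr>"

lemma ext_func_simps [simp]: "OMap ext_func = \<phi>" "AMap ext_func = arr_map"
  by (simp_all add: ext_func_def)

lemma arr_map_eq:
  assumes "B.t e u f \<in> hom B.L e f"
  shows "arr_map (B.t e u f) = sup_cone Y (\<phi> u) (\<phi> e) \<cdot>\<^bsub>Y\<^esub> incl u f"
  using homD(1)[OF assms] by (simp add: arr_map_def B.inv_t)

text \<open>Two generators of one class satisfy \<open>a b = b\<close> and \<open>b a = a\<close>.
  These equations survive under \<phi>, and \<open>sup_class_cong\<close> applies.\<close>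

lemma class_map_eq:
  assumes a: "a \<in> B.S"
  shows "class_map (trans_class B a) = sup_class Y (\<phi> a)"
proof -
  define b where "b = (SOME b. b \<in> B.S \<and> trans_class B a = trans_class B b)"
  have "b \<in> B.S \<and> trans_class B a = trans_class B b"
    unfolding b_def by (rule someI[of _ a]) (use a in simp)
  then have b: "b \<in> B.S" and eq: "trans_class B a = trans_class B b" by simp_all
  have "trans_cone B b \<in> trans_class B a" "trans_cone B a \<in> trans_class B b"
    using B.trans_class_self[OF a] B.trans_class_self[OF b] eq by simp_all
  then have "a \<star>\<^bsub>B\<^esub> b = b" "b \<star>\<^bsub>B\<^esub> a = a"
    using B.trans_cone_inj[OF a] B.trans_cone_inj[OF b] by (auto simp: trans_class_def)
  then have "sup_class Y (\<phi> a) = sup_class Y (\<phi> b)"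
    using Y.sup_class_cong[OF phi_obj[OF a] phi_obj[OF b]] phi_mult[OF a b] phi_mult[OF b a] by simp
  then show ?thesis using a by (simp add: class_map_def b_def)
qed

lemma arr_map_hom:
  assumes "x \<in> hom B.L e f"
  shows "arr_map x \<in> hom Y (\<phi> e) (\<phi> f)"
proof -
  obtain u where x: "x = B.t e u f" and e: "e \<in> B.S" and u: "u \<in> B.S" and f: "f \<in> B.S"
    and uf: "u \<star>\<^bsub>B\<^esub> f = u"
    using assms by (rule B.L_homE)
  show ?thesis
    unfolding x arr_map_eq[OF assms[unfolded x]]
    by (rule cmp_in_hom[OF Y.cat Y.sup_cone_hom[OF phi_obj[OF e] phi_obj[OF u]] Y.incl_hom[OF incl[OF u f uf]]])
qed

text \<open>In the composite, the inner inclusion meets the cone of \<open>\<phi> v\<close>, and the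
  cone condition replaces the pair by the component at \<open>\<phi> u\<close>. Its epi part merges
  with the component on the left by \<open>sup_cone_mult\<close>, giving the cone of
  \<open>\<phi> (u v)\<close>; its inclusion part merges with the inclusion on the right.\<close>

lemma arr_map_cmp:
  assumes x: "x \<in> hom B.L e f" and y: "y \<in> hom B.L f g"
  shows "arr_map (x \<cdot>\<^bsub>B.L\<^esub> y) = arr_map x \<cdot>\<^bsub>Y\<^esub> arr_map y"
proof -
  obtain u where xt: "x = B.t e u f" and e: "e \<in> B.S" and u: "u \<in> B.S" and f: "f \<in> B.S"
    and uf: "u \<star>\<^bsub>B\<^esub> f = u"
    using x by (rule B.L_homE)
  obtain v where yt: "y = B.t f v g" and v: "v \<in> B.S" and g: "g \<in> B.S" and vg: "v \<star>\<^bsub>B\<^esub> g = v"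
    using y by (rule B.L_homE)
  have uv: "u \<star>\<^bsub>B\<^esub> v \<in> B.S" by (rule B.closed[OF u v])
  have xy: "x \<cdot>\<^bsub>B.L\<^esub> y = B.t e (u \<star>\<^bsub>B\<^esub> v) g" by (simp add: xt yt)
  note eo = phi_obj[OF e] and uo = phi_obj[OF u] and fo = phi_obj[OF f] and vo = phi_obj[OF v]
  let ?A = "sup_cone Y (\<phi> u) (\<phi> e)" and ?B = "sup_cone Y (\<phi> v) (\<phi> f)" and ?D = "sup_cone Y (\<phi> v) (\<phi> u)"
  note A = Y.sup_cone_hom[OF eo uo] and Bh = Y.sup_cone_hom[OF fo vo]
  have i: "incl u f \<in> incls Y (\<phi> u) (\<phi> f)" and j: "incl v g \<in> incls Y (\<phi> v) (\<phi> g)"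
    using incl u f uf v g vg by auto
  obtain k where p: "epi_part Y ?D \<in> split_epis Y (\<phi> u) (\<phi> (u \<star>\<^bsub>B\<^esub> v))"
    and k: "k \<in> incls Y (\<phi> (u \<star>\<^bsub>B\<^esub> v)) (\<phi> v)" and pk: "?D = epi_part Y ?D \<cdot>\<^bsub>Y\<^esub> k"
    using Y.sup_cone_factor[OF uo vo] unfolding phi_mult[OF u v] by metis
  note ph = split_epi_hom[OF p] and ih = Y.incl_hom[OF i] and jh = Y.incl_hom[OF j] and kh = Y.incl_hom[OF k]
  have "arr_map x \<cdot>\<^bsub>Y\<^esub> arr_map y = (?A \<cdot>\<^bsub>Y\<^esub> incl u f) \<cdot>\<^bsub>Y\<^esub> (?B \<cdot>\<^bsub>Y\<^esub> incl v g)"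
    using arr_map_eq x y by (simp add: xt yt)
  also have "\<dots> = ?A \<cdot>\<^bsub>Y\<^esub> ((incl u f \<cdot>\<^bsub>Y\<^esub> ?B) \<cdot>\<^bsub>Y\<^esub> incl v g)"
    using cmp_assoc[OF Y.cat A ih cmp_in_hom[OF Y.cat Bh jh]] cmp_assoc[OF Y.cat ih Bh jh] by simp
  also have "incl u f \<cdot>\<^bsub>Y\<^esub> ?B = epi_part Y ?D \<cdot>\<^bsub>Y\<^esub> k"
    using cone_incl[OF Y.sup_cone(1)[OF vo] uo fo i] pk by simp
  also have "?A \<cdot>\<^bsub>Y\<^esub> ((epi_part Y ?D \<cdot>\<^bsub>Y\<^esub> k) \<cdot>\<^bsub>Y\<^esub> incl v g)
      = (?A \<cdot>\<^bsub>Y\<^esub> epi_part Y ?D) \<cdot>\<^bsub>Y\<^esub> (k \<cdot>\<^bsub>Y\<^esub> incl v g)"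
    using cmp_assoc[OF Y.cat A ph cmp_in_hom[OF Y.cat kh jh]] cmp_assoc[OF Y.cat ph kh jh] by simp
  also have "k \<cdot>\<^bsub>Y\<^esub> incl v g = incl (u \<star>\<^bsub>B\<^esub> v) g"
    using incl_eq[OF Y.incl_cmp[OF k j]] by simp
  also have "?A \<cdot>\<^bsub>Y\<^esub> epi_part Y ?D = sup_cone Y (\<phi> (u \<star>\<^bsub>B\<^esub> v)) (\<phi> e)"
    unfolding phi_mult[OF u v] Y.sup_cone_mult[OF uo vo] using eo by (simp add: cone_extend_def)
  finally show ?thesis
    using arr_map_eq[of e "u \<star>\<^bsub>B\<^esub> v" g] cmp_in_hom[OF B.cat x y] by (simp add: xy)
qed

lemma ext_morphism: "(ext_func, class_map) \<in> cc_morphisms B.L Y"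
proof (rule cc_morphismsI)
  show "is_functor B.L Y ext_func"
  proof (rule is_functorI)
    fix a assume "a \<in> Obj B.L"
    then have a: "a \<in> B.S" by simp
    have "incl a a = Ide Y (\<phi> a)" by (rule incl_eq[OF Y.incl_ide[OF phi_obj[OF a]]])
    then have "arr_map (B.t a a a) = Ide Y (\<phi> a) \<cdot>\<^bsub>Y\<^esub> Ide Y (\<phi> a)"
      using arr_map_eq[of a a a] ide_in_hom[OF B.cat, of a] a Y.sup_cone(2)[OF phi_obj[OF a]] by simp
    then show "AMap ext_func (Ide B.L a) = Ide Y (OMap ext_func a)"
      using ide_cmp[OF Y.cat ide_in_hom[OF Y.cat phi_obj[OF a]]] by simp
  qed (simp_all add: B.cat Y.cat phi_obj arr_map_hom arr_map_cmp)
  show "OMap ext_func \<in> extensional (Obj B.L)" using phi_ext by simp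
  show "AMap ext_func \<in> extensional (Arr B.L)" by (simp add: arr_map_def)
  show "AMap ext_func j \<in> incls Y (OMap ext_func e) (OMap ext_func f)" if j: "j \<in> incls B.L e f" for j e f
  proof -
    have jt: "j = B.t e e f" "e \<in> B.S" "f \<in> B.S" "e \<star>\<^bsub>B\<^esub> f = e"
      using j by (simp_all add: B.L_incls split: if_splits)
    note i = incl[OF jt(2-4)]
    have "arr_map j = incl e f"
      using arr_map_eq[of e e f] B.L_incls_hom[OF j] Y.sup_cone(2)[OF phi_obj[OF jt(2)]]
        ide_cmp[OF Y.cat Y.incl_hom[OF i]] by (simp add: jt(1))
    then show ?thesis using i by simp
  qed
  show "class_map \<in> DSet B.L \<rightarrow>\<^sub>E DSet Y"
  proof (rule PiE_I)
    fix d assume "d \<in> DSet B.L"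
    then obtain a where "a \<in> B.S" "d = trans_class B a" by auto
    then show "class_map d \<in> DSet Y" using class_map_eq Y.sup_class(1)[OF phi_obj] by simp
  qed (simp add: class_map_def)
  show "R_class_le (cone_semigroup Y) (class_map d) (class_map d')"
    if d: "d \<in> DSet B.L" "d' \<in> DSet B.L" and le: "R_class_le (cone_semigroup B.L) d d'" for d d'
  proof -
    obtain a where a: "a \<in> B.S" "d = trans_class B a" using d by auto
    obtain b where b: "b \<in> B.S" "d' = trans_class B b" using d by auto
    \<comment> \<open>In the translation category the order on \<open>DSet\<close> is the equation
      \<open>b a = a\<close>, which a homomorphism carries over to \<open>Y\<close>.\<close>
    have "b \<star>\<^bsub>B\<^esub> a = a" using B.trans_class_le_iff[OF b(1) a(1)] le a b by simp
    then show ?thesis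
      using Y.sup_class_le[OF phi_obj[OF a(1)] phi_obj[OF b(1)]] phi_mult[OF b(1) a(1)] class_map_eq a b by simp
  qed
  fix c d assume d: "d \<in> DSet B.L" and con: "connected_to B.L c d"
  have c: "c \<in> B.S" and dc: "d = trans_class B c" using B.connected_L_iff[OF d] con by auto
  note co = phi_obj[OF c]
  have gd: "class_map d = sup_class Y (\<phi> c)" using class_map_eq[OF c] dc by simp
  show "connected_to Y (OMap ext_func c) (class_map d)"
    using Y.sup_class(2)[OF co] gd by simp
  fix c' assume "c' \<in> Obj B.L"
  then have c': "c' \<in> B.S" by simp
  note co' = phi_obj[OF c']
  let ?D = "sup_cone Y (\<phi> c) (\<phi> c')"
  obtain k where p: "epi_part Y ?D \<in> split_epis Y (\<phi> c') (\<phi> (c' \<star>\<^bsub>B\<^esub> c))"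
    and k: "k \<in> incls Y (\<phi> (c' \<star>\<^bsub>B\<^esub> c)) (\<phi> c)" and pk: "?D = epi_part Y ?D \<cdot>\<^bsub>Y\<^esub> k"
    using Y.sup_cone_factor[OF co' co] unfolding phi_mult[OF c' c] by metis
  have "eps B.L c d c' = trans_cone B c c'"
    using B.eps_eq[OF B.DSet_R[OF d], of c] B.trans_idempotent[OF c] dc by simp
  also have "\<dots> = B.t c' (c' \<star>\<^bsub>B\<^esub> c) c" using c' by (simp add: trans_cone_def)
  finally have e: "eps B.L c d c' = B.t c' (c' \<star>\<^bsub>B\<^esub> c) c" .
  have "B.t c' (c' \<star>\<^bsub>B\<^esub> c) c \<in> hom B.L c' c"
    using cone_hom[OF B.trans_cone(1)[OF c], of c'] c' by (simp add: trans_cone_def)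
  then have "arr_map (eps B.L c d c') = sup_cone Y (\<phi> (c' \<star>\<^bsub>B\<^esub> c)) (\<phi> c') \<cdot>\<^bsub>Y\<^esub> k"
    unfolding e using arr_map_eq incl_eq[OF k] by simp
  \<comment> \<open>The product formula is evaluated at \<open>\<phi> c'\<close>, where the
    supporting cone of \<open>\<phi> c'\<close> is the identity. Only the epi part of
    \<open>?D\<close> remains.\<close>
  also have "sup_cone Y (\<phi> (c' \<star>\<^bsub>B\<^esub> c)) (\<phi> c') = epi_part Y ?D"
    unfolding phi_mult[OF c' c] Y.sup_cone_mult[OF co' co]
    using co' Y.sup_cone(2)[OF co'] ide_cmp[OF Y.cat split_epi_hom[OF p]] by (simp add: cone_extend_def)
  finally show "AMap ext_func (eps B.L c d c') = eps Y (OMap ext_func c) (class_map d) (OMap ext_func c')"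
    using pk gd by (simp add: sup_cone_def)
qed

lemma ext_unique:
  assumes P: "(F, G) \<in> cc_morphisms B.L Y" and F: "OMap F = \<phi>"
  shows "F = ext_func" "G = class_map"
proof -
  note sup = B.supported_L Y.supp
  have "AMap F x = arr_map x" for x
  proof (cases "x \<in> Arr B.L")
    case False
    then show ?thesis using cc_AMap_ext[OF P] by (simp add: extensional_def arr_map_def)
  next
    case True
    obtain e u f where x: "x = B.t e u f" and e: "e \<in> B.S" and u: "u \<in> B.S" and f: "f \<in> B.S"
      and eu: "e \<star>\<^bsub>B\<^esub> u = u" and uf: "u \<star>\<^bsub>B\<^esub> f = u"
      using arr_in_hom[OF True] by (rule B.L_homE)
    have c: "sup_cone B.L u e = B.t e u u" using e eu by (simp add: B.sup_L(2)[OF u] trans_cone_def)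
    have ch: "B.t e u u \<in> hom B.L e u" using e u eu by (intro B.L_homI) (simp_all add: B.idem)
    have j: "B.t u u f \<in> incls B.L u f" using u f uf by (simp add: B.L_incls)
    have xc: "x = sup_cone B.L u e \<cdot>\<^bsub>B.L\<^esub> B.t u u f" by (simp add: c x B.idem[OF u])
    have "AMap F x = AMap F (sup_cone B.L u e) \<cdot>\<^bsub>Y\<^esub> AMap F (B.t u u f)"
      unfolding xc c by (rule functor_cmp[OF cc_functor[OF P] ch B.L_incls_hom[OF j]])
    also have "AMap F (sup_cone B.L u e) = sup_cone Y (\<phi> u) (\<phi> e)"
      using cc_sup_cone[OF P sup, of e u] e u by (simp add: F)
    also have "AMap F (B.t u u f) = incl u f"
      using incl_eq cc_incl[OF P B.normal_cat_axioms j] by (simp add: F)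
    finally show ?thesis
      using arr_map_eq[of e u f] B.L_homI[OF e u f eu uf] by (simp add: x)
  qed
  then show "F = ext_func" using F by (intro func_eqI) auto
  \<comment> \<open>Every class in \<open>DSet\<close> supports some object of the translation
    category, so \<open>cc_sup_class\<close> leaves no freedom for \<open>G\<close>.\<close>
  show "G = class_map"
  proof (rule extensionalityI)
    show "G \<in> extensional (DSet B.L)" using cc_DMap[OF P] by (simp add: PiE_iff)
    show "class_map \<in> extensional (DSet B.L)" by (simp add: class_map_def)
    fix d assume "d \<in> DSet B.L"
    then obtain a where a: "a \<in> B.S" "d = trans_class B a" by auto
    then show "G d = class_map d"
      using cc_sup_class[OF P sup, of a] class_map_eq[OF a(1)] B.sup_L(1)[OF a(1)] F by simp
  qed
qed

end

lemma rrbI: "right_regular_band B \<Longrightarrow> infinite (UNIV :: 'u set) \<Longrightarrow> rrb (B :: 'u sgrp)"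
  by (rule rrb.intro)

lemma trans_cat_universal:
  assumes "infinite (UNIV :: 'u set)"
  shows "universal_arrows (RRB :: ('u sgrp, 'u sgrp \<times> ('u \<Rightarrow> 'u) \<times> 'u sgrp) cat) SC
    trans_cat band_functor band_unit"
proof
  show "category (RRB :: ('u sgrp, 'u sgrp \<times> ('u \<Rightarrow> 'u) \<times> 'u sgrp) cat)" by (rule category_RRB)
  show "is_functor SC (RRB :: ('u sgrp, 'u sgrp \<times> ('u \<Rightarrow> 'u) \<times> 'u sgrp) cat) band_functor"
    by (rule functor_band)
next
  fix X :: "'u sgrp" assume "X \<in> Obj RRB"
  then interpret rrb X using assms by (intro rrbI) simp_all
  show "trans_cat X \<in> Obj SC" using supported_L by simp
  show "band_unit X \<in> hom RRB X (OMap band_functor (trans_cat X))"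
    using unit_hom by (simp add: band_functor_def)
next
  fix X :: "'u sgrp" and Y :: "('u, 'u) conn_cat" and \<phi>
  assume X: "X \<in> Obj RRB" and Y: "Y \<in> Obj SC" and "\<phi> \<in> hom RRB X (OMap band_functor Y)"
  then obtain h where phi_eq: "\<phi> = (X, h, band_of Y)" and h: "h \<in> sgrp_homs X (band_of Y)"
    by (auto simp: hom_RRB band_functor_def split: if_splits)
  interpret rrb_to_supported X Y h
    using X Y h assms by (simp add: rrb_to_supported_def rrb_to_supported_axioms_def rrbI supported_catI)
  \<comment> \<open>An arrow of \<open>RRB\<close> retains only the object map of a CC-morphism, and
    the unit acts as the identity, so the triangle condition merely fixes that object map.
    Restriction to the carrier changes nothing because \<open>OMap F\<close> is extensional.\<close>
  have unit_cmp: "band_unit X \<cdot>\<^bsub>RRB\<^esub> AMap band_functor (trans_cat X, (F, G), Y) = \<phi> \<longleftrightarrow> OMap F = h"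
    if "(F, G) \<in> cc_morphisms (trans_cat X) Y" for F G
  proof -
    have ext: "OMap F \<in> extensional (carrier X)" using cc_OMap_ext[OF that] by simp
    have "band_unit X \<cdot>\<^bsub>RRB\<^esub> AMap band_functor (trans_cat X, (F, G), Y)
        = (X, restrict (OMap F) (carrier X), band_of Y)"
      by (auto simp: band_unit_def band_functor_def compose_def)
    then show ?thesis by (simp add: phi_eq extensional_restrict[OF ext])
  qed
  show "\<exists>!\<psi>. \<psi> \<in> hom SC (trans_cat X) Y \<and> band_unit X \<cdot>\<^bsub>RRB\<^esub> AMap band_functor \<psi> = \<phi>"
  proof (rule ex1I[of _ "(trans_cat X, (ext_func, class_map), Y)"])
    show "(trans_cat X, (ext_func, class_map), Y) \<in> hom SC (trans_cat X) Y \<and>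
      band_unit X \<cdot>\<^bsub>RRB\<^esub> AMap band_functor (trans_cat X, (ext_func, class_map), Y) = \<phi>"
      using ext_morphism unit_cmp[OF ext_morphism] B.supported_L Y.supp by (simp add: hom_SC)
    fix \<psi> assume psi: "\<psi> \<in> hom SC (trans_cat X) Y \<and> band_unit X \<cdot>\<^bsub>RRB\<^esub> AMap band_functor \<psi> = \<phi>"
    then obtain F G where eq: "\<psi> = (trans_cat X, (F, G), Y)" and P: "(F, G) \<in> cc_morphisms (trans_cat X) Y"
      by (auto simp: hom_SC split: if_splits)
    with psi unit_cmp[OF P] have "OMap F = h" by simp
    then show "\<psi> = (trans_cat X, (ext_func, class_map), Y)" using ext_unique[OF P] eq by simp
  qed
qed

theorem theorem5p5:
  assumes "infinite (UNIV :: 'u set)"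
  shows "(\<exists>F G \<eta>. adjunction (RRB :: ('u sgrp, 'u sgrp \<times> ('u \<Rightarrow> 'u) \<times> 'u sgrp) cat)
            (SC :: (('u, 'u) conn_cat,
                    ('u, 'u) conn_cat \<times> ('u, 'u, 'u, 'u) cc_map \<times> ('u, 'u) conn_cat) cat) F G \<eta>) \<and>
    coreflective_in (RRB :: ('u sgrp, 'u sgrp \<times> ('u \<Rightarrow> 'u) \<times> 'u sgrp) cat)
            (SC :: (('u, 'u) conn_cat,
                    ('u, 'u) conn_cat \<times> ('u, 'u, 'u, 'u) cc_map \<times> ('u, 'u) conn_cat) cat)"
proof -
  interpret U: universal_arrows "RRB :: ('u sgrp, 'u sgrp \<times> ('u \<Rightarrow> 'u) \<times> 'u sgrp) cat" SC
    trans_cat band_functor band_unit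
    by (rule trans_cat_universal[OF assms])
  interpret I: iso_unit_adjunction "RRB :: ('u sgrp, 'u sgrp \<times> ('u \<Rightarrow> 'u) \<times> 'u sgrp) cat" SC
    U.left_adjoint band_functor band_unit
  proof
    fix X :: "'u sgrp" assume "X \<in> Obj RRB"
    then show "isomorphism RRB (band_unit X)"
      using rrb.unit_iso[OF rrbI] assms by simp
  qed (rule U.adjunction)
  show ?thesis using U.adjunction I.coreflective_in by blast
qed

end
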